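(* Consider the simplified game of baccara banque with parameter $\theta\in(0,1/2]$ (see context), and let $\underline v(\theta)$ be the lower value (to the Players) of the game in which the two Players form a coalition against Banker but must act independently. Then $\underline v$ is continuous on $(0,1/2]$, and there is a point $\theta^\circ\approx0.496000$ such that $\underline v$ is increasing on $(0,\theta^\circ]$ and attains its maximum over $(0,1/2]$ at $\theta^\circ$; the maximum value is $\underline v(\theta^\circ)\approx-0.008679984$ (rounded to the digits shown).
   Context: Simplified game of baccara banque. Let $X_1,X_2,Y$ be i.i.d. on $\{0,\ldots,9\}$ with $P(\cdot=i)=q(i)=(16+9\delta_{i,0})/13^2$ (two-card totals of Player 1, Player 2, Banker), and let $X_1',X_2',Y'$ be i.i.d. on $\{0,\ldots,9\}$, independent of these, with $P(\cdot=k)=q'(k)=(1+3\delta_{k,0})/13$ (third-card values). $M(i)$ is the remainder of $i$ modulo $10$. Player $i$'s pure strategies are $u_i\in\{0,1\}$ ($0$ = stand on two-card total 5, $1$ = draw on 5); Player $i$ draws iff $X_i\le 4+u_i$. Put $K_i=X_i'$ if $X_i\le 4+u_i$, $K_i=10$ if $5+u_i\le X_i\le 7$ (stand), $K_i=11$ if $X_i\in\{8,9\}$ (natural); put $F_i=M(X_i+X_i')$ if $X_i\le 4+u_i$ and $F_i=X_i$ otherwise. Banker's information sets are the 1144 triples $(k_1,k_2,j)\in I:=[\{0,\ldots,11\}^2\setminus\{(11,11)\}]\times\{0,\ldots,7\}$; a Banker pure strategy is a subset $T\subset I$, the set on which he draws. If $Y\ge 8$ or both $X_1,X_2\ge 8$,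 set $G_i=\mathrm{sgn}(X_i-Y)$. Otherwise let $B=M(Y+Y')$ if $(K_1,K_2,Y)\in T$ and $B=Y$ if not, and set $G_i=1$ if $X_i\ge 8$ and $G_i=\mathrm{sgn}(F_i-B)$ if $X_i\le 7$. The joint payoff to the Players is $a_{u_1,u_2,T}(\theta)=E[\theta G_1+(1-\theta)G_2]$; the payoff to Banker is $-a_{u_1,u_2,T}(\theta)$. The lower value is $\underline v(\theta)=\max_{p_1,p_2\in[0,1]}\min_{T\subset I}\big[(1-p_1)(1-p_2)a_{0,0,T}(\theta)+(1-p_1)p_2a_{0,1,T}(\theta)+p_1(1-p_2)a_{1,0,T}(\theta)+p_1p_2a_{1,1,T}(\theta)\big]$. *)

theory Defs
  imports "HOL-Probability.Probability"
begin

definition two_card_prob :: "nat \<Rightarrow> real" where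
  "two_card_prob i = (if i \<le> 9 then (16 + 9 * of_bool (i = 0)) / 13\<^sup>2 else 0)"

definition third_card_prob :: "nat \<Rightarrow> real" where
  "third_card_prob k = (if k \<le> 9 then (1 + 3 * of_bool (k = 0)) / 13 else 0)"

definition two_card_pmf :: "nat pmf" where
  "two_card_pmf = embed_pmf two_card_prob"

definition third_card_pmf :: "nat pmf" where
  "third_card_pmf = embed_pmf third_card_prob"

text \<open>The two functions really are probability mass functions on \<open>{0..9}\<close>, so that
  \<^const>\<open>embed_pmf\<close> has the intended meaning.\<close>

lemma nn_integral_count_space_atMost9:
  fixes f :: "nat \<Rightarrow> real"
  assumes "\<And>i. 0 \<le> f i" and "\<And>i. i > 9 \<Longrightarrow> f i = 0" and "sum f {..9} = 1"
  shows "(\<integral>\<^sup>+ i. ennreal (f i) \<partial>count_space UNIV) = 1"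
proof -
  have "(\<integral>\<^sup>+ i. ennreal (f i) \<partial>count_space UNIV) = (\<Sum>i\<in>{..9}. ennreal (f i))"
    using assms(2) by (intro nn_integral_count_space') (auto simp: not_le[symmetric])
  also have "\<dots> = ennreal (sum f {..9})"
    using assms(1) by (simp add: sum_ennreal)
  finally show ?thesis using assms(3) by simp
qed

lemma pmf_two_card_pmf: "pmf two_card_pmf i = two_card_prob i"
  unfolding two_card_pmf_def
proof (rule pmf_embed_pmf)
  have set: "{..9::nat} = {0, 1, 2, 3, 4, 5, 6, 7, 8, 9}" by auto
  show "(\<integral>\<^sup>+ i. ennreal (two_card_prob i) \<partial>count_space UNIV) = 1"
    by (rule nn_integral_count_space_atMost9) (simp_all add: set two_card_prob_def)
qed (simp add: two_card_prob_def)

lemma pmf_third_card_pmf: "pmf third_card_pmf k = third_card_prob k"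
  unfolding third_card_pmf_def
proof (rule pmf_embed_pmf)
  have set: "{..9::nat} = {0, 1, 2, 3, 4, 5, 6, 7, 8, 9}" by auto
  show "(\<integral>\<^sup>+ i. ennreal (third_card_prob i) \<partial>count_space UNIV) = 1"
    by (rule nn_integral_count_space_atMost9) (simp_all add: set third_card_prob_def)
qed (simp add: third_card_prob_def)

text \<open>The joint law of \<open>(X\<^sub>1, X\<^sub>2, Y, X\<^sub>1', X\<^sub>2', Y')\<close>, all six independent.\<close>

definition deal_pmf :: "(nat \<times> nat \<times> nat \<times> nat \<times> nat \<times> nat) pmf" where
  "deal_pmf =
     pair_pmf two_card_pmf (pair_pmf two_card_pmf (pair_pmf two_card_pmf
       (pair_pmf third_card_pmf (pair_pmf third_card_pmf third_card_pmf))))"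

text \<open>A Player's pure strategy is \<open>u \<in> {0, 1}\<close>: he draws on two-card totals up to \<open>4 + u\<close>.
  In the next definition 10 encodes standing and 11 a natural.\<close>

definition shown_card :: "nat \<Rightarrow> nat \<Rightarrow> nat \<Rightarrow> nat" where
  "shown_card u x x' = (if x \<le> 4 + u then x' else if x \<le> 7 then 10 else 11)"

definition player_total :: "nat \<Rightarrow> nat \<Rightarrow> nat \<Rightarrow> nat" where
  "player_total u x x' = (if x \<le> 4 + u then (x + x') mod 10 else x)"

definition info_sets :: "(nat \<times> nat \<times> nat) set" where
  "info_sets = {(k1, k2, j). k1 \<le> 11 \<and> k2 \<le> 11 \<and> (k1, k2) \<noteq> (11, 11) \<and> j \<le> 7}"

definition banker_total :: "(nat \<times> nat \<times> nat) set \<Rightarrow> nat \<Rightarrow> nat \<Rightarrow> nat \<Rightarrow> nat \<Rightarrow> nat" where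
  "banker_total T k1 k2 y y' = (if (k1, k2, y) \<in> T then (y + y') mod 10 else y)"

text \<open>The result of a Player's hand with two-card total \<open>x\<close> and final total \<open>f\<close> against
  Banker's two-card total \<open>y\<close> and final total \<open>b\<close>; the flag \<open>stop\<close> says that the coup is
  decided by the two-card totals.\<close>

definition hand_result :: "bool \<Rightarrow> nat \<Rightarrow> nat \<Rightarrow> nat \<Rightarrow> nat \<Rightarrow> real" where
  "hand_result stop x f y b =
     (if stop then sgn (real x - real y)
      else if x \<ge> 8 then 1
      else sgn (real f - real b))"

definition coup_payoff ::
  "real \<Rightarrow> nat \<Rightarrow> nat \<Rightarrow> (nat \<times> nat \<times> nat) set \<Rightarrow> nat \<times> nat \<times> nat \<times> nat \<times> nat \<times> nat \<Rightarrow> real" where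
  "coup_payoff \<theta> u1 u2 T = (\<lambda>(x1, x2, y, x1', x2', y').
     let stop = (y \<ge> 8 \<or> (x1 \<ge> 8 \<and> x2 \<ge> 8));
         b = banker_total T (shown_card u1 x1 x1') (shown_card u2 x2 x2') y y';
         g1 = hand_result stop x1 (player_total u1 x1 x1') y b;
         g2 = hand_result stop x2 (player_total u2 x2 x2') y b
     in \<theta> * g1 + (1 - \<theta>) * g2)"

definition payoff :: "real \<Rightarrow> nat \<Rightarrow> nat \<Rightarrow> (nat \<times> nat \<times> nat) set \<Rightarrow> real" where
  "payoff \<theta> u1 u2 T = measure_pmf.expectation deal_pmf (coup_payoff \<theta> u1 u2 T)"

text \<open>Player \<open>i\<close> independently uses \<open>u\<^sub>i = 1\<close> with probability \<open>p\<^sub>i\<close>.\<close>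

definition mixed_payoff ::
  "real \<Rightarrow> real \<times> real \<Rightarrow> (nat \<times> nat \<times> nat) set \<Rightarrow> real" where
  "mixed_payoff \<theta> = (\<lambda>(p1, p2) T.
     (1 - p1) * (1 - p2) * payoff \<theta> 0 0 T + (1 - p1) * p2 * payoff \<theta> 0 1 T
     + p1 * (1 - p2) * payoff \<theta> 1 0 T + p1 * p2 * payoff \<theta> 1 1 T)"

definition guaranteed_payoff :: "real \<Rightarrow> real \<times> real \<Rightarrow> real" where
  "guaranteed_payoff \<theta> p = (MIN T\<in>Pow info_sets. mixed_payoff \<theta> p T)"

definition lower_value :: "real \<Rightarrow> real" where
  "lower_value \<theta> = (SUP p\<in>{0..1} \<times> {0..1}. guaranteed_payoff \<theta> p)"

lemma finite_info_sets: "finite info_sets"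
  by (rule finite_subset[of _ "{..11} \<times> {..11} \<times> {..7}"]) (auto simp: info_sets_def)

lemma continuous_on_Min_image:
  fixes f :: "'a \<Rightarrow> 'b::topological_space \<Rightarrow> real"
  assumes "finite A" "A \<noteq> {}" "\<And>t. t \<in> A \<Longrightarrow> continuous_on S (f t)"
  shows "continuous_on S (\<lambda>p. MIN t\<in>A. f t p)"
  using assms
proof (induction A rule: finite_ne_induct)
  case (insert a A)
  have "continuous_on S (\<lambda>p. min (f a p) (MIN t\<in>A. f t p))"
    using insert.IH insert.prems by (intro continuous_on_min) simp_all
  with insert.hyps show ?case by simp
qed simp

text \<open>The supremum in \<^const>\<open>lower_value\<close> is a maximum.\<close>

lemma lower_value_attained:
  "\<exists>p\<in>{0..1} \<times> {0..1}. lower_value \<theta> = guaranteed_payoff \<theta> p \<and>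
     (\<forall>p'\<in>{0..1} \<times> {0..1}. guaranteed_payoff \<theta> p' \<le> guaranteed_payoff \<theta> p)"
proof -
  let ?S = "{0..1::real} \<times> {0..1::real}"
  have "continuous_on ?S (\<lambda>p. mixed_payoff \<theta> p T)" for T
    unfolding mixed_payoff_def case_prod_beta by (intro continuous_intros)
  then have "continuous_on ?S (\<lambda>p. MIN T\<in>Pow info_sets. mixed_payoff \<theta> p T)"
    using finite_info_sets
    by (intro continuous_on_Min_image[where f = "\<lambda>T p. mixed_payoff \<theta> p T"]) auto
  then have "continuous_on ?S (guaranteed_payoff \<theta>)"
    by (simp add: guaranteed_payoff_def)
  moreover have "compact ?S" by (intro compact_Times compact_Icc)
  moreover have "?S \<noteq> {}" by auto
  ultimately have "\<exists>p\<in>?S. \<forall>p'\<in>?S. guaranteed_payoff \<theta> p' \<le> guaranteed_payoff \<theta> p"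
    by (intro continuous_attains_sup)
  then obtain p where p: "p \<in> ?S"
    "\<forall>p'\<in>?S. guaranteed_payoff \<theta> p' \<le> guaranteed_payoff \<theta> p" ..
  have "lower_value \<theta> = guaranteed_payoff \<theta> p"
    unfolding lower_value_def using p by (intro cSup_eq_maximum) auto
  with p show ?thesis by blast
qed

end

theory Submission
  imports Defs "HOL-Computational_Algebra.Polynomial"
begin

text \<open>
  Write \<open>x\<close> and \<open>y\<close> for the probabilities with which the Players draw on 5.  Conditioned on what
  Banker sees, the two hands are independent, so the payoff is a constant plus a sum, over the
  information sets on which Banker draws, of \<^emph>\<open>edges\<close> (drawing minus standing), and every edge is affine
  in \<open>\<theta>\<close>, in \<open>x\<close> and in \<open>y\<close> (\<open>mixed_payoff_form\<close>).  Banker therefore draws where the edge is negative, and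
  the guaranteed payoff is a constant form plus the sum of the negative parts of the edges.

  Up to \<open>\<theta> = 49/100\<close> growth is a crude matter.  Banker's best replies are only partly determined on a
  cell of parameters, but inequalities that hold at the corners of a cell hold inside it.  This
  gives finitely many integer checks (\<open>cell_ok_sound\<close>), which confine the optimal \<open>(x, y)\<close> to a small
  rectangle and show that the derivative in \<open>\<theta>\<close> under a best reply is positive there
  (\<open>scaled_lower_value_less\<close>).

  For \<open>\<theta>\<close> between 49/100 and 1/2 the optimum lies in a box on which only five of the 1144 edges have an
  undecided sign, so that the game becomes the explicit function \<open>box_payoff\<close>
  (\<open>scaled_payoff_eq_box_payoff\<close>).  Its maximum is on the \<^emph>\<open>ridge\<close> where the edge at (stand, 6, 6) vanishes
  (\<open>optimum_on_ridge\<close>).  On the ridge \<open>\<theta>\<close> is a function of \<open>(x, y)\<close>, and at a fixed \<open>y\<close> the payoff rises in \<open>x\<close>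
  while the edge at (9, 3, 4) is negative and, with the edge at (2, 5, 5) taken as zero, falls once it is
  positive (\<open>along_ridge_increasing\<close>, \<open>along_ridge_decreasing\<close>).  Hence every optimum is bounded by the value at the
  \<^emph>\<open>kink\<close>, the point of the ridge with the same \<open>y\<close> at which the edge at (9, 3, 4) vanishes.  The kinks form a
  rational curve in a parameter \<open>z\<close>; the payoff \<open>kink_value\<close> along it is a rational function that rises to a
  single peak and then falls.

  The share at the peak is the asserted point: the value there equals the peak of \<open>kink_value\<close>, which
  bounds every other value.  Below it the value can always be improved by a slightly larger share, by
  moving \<open>x\<close> along the ridge when the edge at (9, 3, 4) is negative, and by jumping to a later kink
  otherwise (\<open>box_max_step\<close>); with continuity this yields strict growth.
\<close>

section \<open>Banker's options at his information sets\<close>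

text \<open>The result of a hand when the coup is not decided by the two-card totals.\<close>

definition hand_score :: "nat \<Rightarrow> nat \<Rightarrow> nat \<Rightarrow> real" where
  "hand_score x f b = (if x \<ge> 8 then 1 else sgn (real f - real b))"

definition hands :: "nat \<Rightarrow> nat \<Rightarrow> (nat \<times> nat) set" where
  "hands u k = {h \<in> {..9} \<times> {..9}. shown_card u (fst h) (snd h) = k}"

definition hand_prob :: "nat \<times> nat \<Rightarrow> real" where
  "hand_prob h = two_card_prob (fst h) * third_card_prob (snd h)"

definition show_prob :: "nat \<Rightarrow> nat \<Rightarrow> real" where
  "show_prob u k = (\<Sum>h\<in>hands u k. hand_prob h)"

definition stand_score :: "nat \<Rightarrow> nat \<Rightarrow> nat \<Rightarrow> real" where
  "stand_score u k j =
     (\<Sum>h\<in>hands u k. hand_prob h * hand_score (fst h) (player_total u (fst h) (snd h)) j)"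

definition draw_score :: "nat \<Rightarrow> nat \<Rightarrow> nat \<Rightarrow> real" where
  "draw_score u k j =
     (\<Sum>h\<in>hands u k. hand_prob h *
        (\<Sum>c\<le>9. third_card_prob c * hand_score (fst h) (player_total u (fst h) (snd h)) ((j + c) mod 10)))"

text \<open>The contribution of the coups in which nobody may draw; no strategy enters it.\<close>

definition stop_payoff :: "real \<Rightarrow> real" where
  "stop_payoff \<theta> = (\<Sum>y\<le>9. two_card_prob y * (\<Sum>x1\<le>9. \<Sum>x2\<le>9. two_card_prob x1 * two_card_prob x2 *
     (if y \<ge> 8 \<or> (x1 \<ge> 8 \<and> x2 \<ge> 8)
      then \<theta> * sgn (real x1 - real y) + (1 - \<theta>) * sgn (real x2 - real y) else 0)))"

lemma atMost9: "{..9::nat} = {0,1,2,3,4,5,6,7,8,9}" by auto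

lemma sum_third_card_prob: "(\<Sum>c\<le>9. third_card_prob c) = 1"
  by (simp add: atMost9 third_card_prob_def)

lemma sum_two_card_prob: "(\<Sum>c\<le>9. two_card_prob c) = 1"
  by (simp add: atMost9 two_card_prob_def)

lemma payoff_sum:
  "payoff \<theta> u1 u2 T =
    (\<Sum>y\<le>9. two_card_prob y * (\<Sum>h1\<in>{..9}\<times>{..9}. \<Sum>h2\<in>{..9}\<times>{..9}. hand_prob h1 * hand_prob h2 *
       (\<Sum>c\<le>9. third_card_prob c * coup_payoff \<theta> u1 u2 T (fst h1, fst h2, y, snd h1, snd h2, c))))"
proof -
  let ?D = "{..9::nat}"
  have "payoff \<theta> u1 u2 T =
    (\<Sum>a\<in>?D \<times> ?D \<times> ?D \<times> ?D \<times> ?D \<times> ?D. coup_payoff \<theta> u1 u2 T a * pmf deal_pmf a)"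
    unfolding payoff_def
    by (rule integral_measure_pmf_real)
      (auto simp: deal_pmf_def set_pmf_iff pmf_pair pmf_two_card_pmf pmf_third_card_pmf
        two_card_prob_def third_card_prob_def split: if_splits)
  also have "\<dots> = (\<Sum>(y, h1, h2, c)\<in>?D \<times> (?D \<times> ?D) \<times> (?D \<times> ?D) \<times> ?D.
      two_card_prob y * (hand_prob h1 * hand_prob h2 *
        (third_card_prob c * coup_payoff \<theta> u1 u2 T (fst h1, fst h2, y, snd h1, snd h2, c))))"
    by (rule sum.reindex_bij_witness[where
        i = "\<lambda>(y, h1, h2, c). (fst h1, fst h2, y, snd h1, snd h2, c)" and
        j = "\<lambda>(x1, x2, y, z1, z2, c). (y, (x1, z1), (x2, z2), c)"])
      (auto simp: deal_pmf_def pmf_pair pmf_two_card_pmf pmf_third_card_pmf hand_prob_def)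
  also have "\<dots> = (\<Sum>y\<in>?D. \<Sum>h1\<in>?D\<times>?D. \<Sum>h2\<in>?D\<times>?D. \<Sum>c\<in>?D.
      two_card_prob y * (hand_prob h1 * hand_prob h2 *
        (third_card_prob c * coup_payoff \<theta> u1 u2 T (fst h1, fst h2, y, snd h1, snd h2, c))))"
    by (subst sum.cartesian_product[symmetric], rule sum.cong[OF refl],
        subst sum.cartesian_product[symmetric], rule sum.cong[OF refl],
        subst sum.cartesian_product[symmetric], simp)
  finally show ?thesis by (simp only: sum_distrib_left)
qed

lemma shown_le: "u \<le> 1 \<Longrightarrow> x \<le> 9 \<Longrightarrow> z \<le> 9 \<Longrightarrow> shown_card u x z \<le> 11"
  by (simp add: shown_card_def)

lemma shown_eq_11: "u \<le> 1 \<Longrightarrow> z \<le> 9 \<Longrightarrow> shown_card u x z = 11 \<longleftrightarrow> x \<ge> 8"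
  by (auto simp: shown_card_def)

lemma sum_hands: "u \<le> 1 \<Longrightarrow> (\<Sum>k\<le>11. \<Sum>h\<in>hands u k. f h) = (\<Sum>h\<in>{..9}\<times>{..9}. f h)"
  unfolding hands_def
  by (rule sum.group) (auto intro: shown_le)

definition pair_score :: "real \<Rightarrow> nat \<Rightarrow> nat \<Rightarrow> (nat \<times> nat \<times> nat) set \<Rightarrow> nat \<Rightarrow> nat \<Rightarrow> nat \<Rightarrow> real" where
  "pair_score \<theta> u1 u2 T a b j =
     (if (a, b, j) \<in> T
      then \<theta> * draw_score u1 a j * show_prob u2 b + (1 - \<theta>) * show_prob u1 a * draw_score u2 b j
      else \<theta> * stand_score u1 a j * show_prob u2 b + (1 - \<theta>) * show_prob u1 a * stand_score u2 b j)"

lemma sum_hand_prob: "(\<Sum>h\<in>{..9}\<times>{..9}. hand_prob h) = 1"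
  by (simp add: sum.cartesian_product' hand_prob_def sum_two_card_prob sum_third_card_prob
      flip: sum_distrib_left)

lemma sum_hands_pair:
  assumes u: "u1 \<le> 1" "u2 \<le> 1"
  shows "(\<Sum>h1\<in>{..9}\<times>{..9}. \<Sum>h2\<in>{..9}\<times>{..9}. f h1 h2) =
    (\<Sum>a\<le>11. \<Sum>b\<le>11. \<Sum>h1\<in>hands u1 a. \<Sum>h2\<in>hands u2 b. f h1 h2 :: real)"
proof -
  have "(\<Sum>h1\<in>{..9}\<times>{..9}. \<Sum>h2\<in>{..9}\<times>{..9}. f h1 h2) =
    (\<Sum>a\<le>11. \<Sum>h1\<in>hands u1 a. \<Sum>b\<le>11. \<Sum>h2\<in>hands u2 b. f h1 h2)"
    by (simp add: sum_hands[OF u(2)] sum_hands[OF u(1)])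
  also have "\<dots> = (\<Sum>a\<le>11. \<Sum>b\<le>11. \<Sum>h1\<in>hands u1 a. \<Sum>h2\<in>hands u2 b. f h1 h2)"
    by (intro sum.cong refl) (rule sum.swap)
  finally show ?thesis .
qed

text \<open>Given what Banker sees, the hands are independent and each result depends on one of them, so double sums factorize.\<close>

lemma draw_pair:
  "(\<Sum>h1\<in>hands u1 a. \<Sum>h2\<in>hands u2 b. hand_prob h1 * hand_prob h2 * (\<theta> * m1 h1 + (1 - \<theta>) * m2 h2)) =
    \<theta> * (\<Sum>h\<in>hands u1 a. hand_prob h * m1 h) * show_prob u2 b +
    (1 - \<theta>) * show_prob u1 a * (\<Sum>h\<in>hands u2 b. hand_prob h * m2 h)"
proof -
  have "(\<Sum>h1\<in>hands u1 a. \<Sum>h2\<in>hands u2 b. hand_prob h1 * hand_prob h2 * (\<theta> * m1 h1 + \<kappa> * m2 h2)) =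
    \<theta> * (\<Sum>h1\<in>hands u1 a. \<Sum>h2\<in>hands u2 b. (hand_prob h1 * m1 h1) * hand_prob h2) +
    \<kappa> * (\<Sum>h1\<in>hands u1 a. \<Sum>h2\<in>hands u2 b. hand_prob h1 * (hand_prob h2 * m2 h2))" for \<kappa>
    unfolding sum_distrib_left sum.distrib[symmetric]
    by (intro sum.cong refl) (simp add: algebra_simps)
  then show ?thesis unfolding show_prob_def sum_product[symmetric] by (simp add: mult.assoc)
qed

text \<open>Banker's choice at a triple influences only the deals that show this triple.  Two naturals end the coup,
  whence the excluded pair \<open>(11, 11)\<close>.\<close>

lemma payoff_split:
  assumes u: "u1 \<le> 1" "u2 \<le> 1"
  shows "payoff \<theta> u1 u2 T = stop_payoff \<theta> +
    (\<Sum>j\<le>7. two_card_prob j * (\<Sum>a\<le>11. \<Sum>b\<le>11. if a = 11 \<and> b = 11 then 0 else pair_score \<theta> u1 u2 T a b j))"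
proof -
  let ?H = "{..9::nat} \<times> {..9::nat}"
  let ?m = "\<lambda>u (h::nat\<times>nat) b. hand_score (fst h) (player_total u (fst h) (snd h)) b"
  let ?S = "\<lambda>y h1 h2. \<theta> * sgn (real (fst h1) - real y) + (1 - \<theta>) * sgn (real (fst h2) - real y)"
  let ?C = "\<lambda>y h1 h2. \<Sum>c\<le>9. third_card_prob c * coup_payoff \<theta> u1 u2 T (fst h1, fst h2, y, snd h1, snd h2, c)"
  have stop: "?C y h1 h2 = ?S y h1 h2" if "y \<ge> 8 \<or> (fst h1 \<ge> 8 \<and> fst h2 \<ge> 8)"
    for y and h1 h2 :: "nat \<times> nat"
    using that by (simp add: coup_payoff_def hand_result_def Let_def sum_third_card_prob flip: sum_distrib_right)
  have go: "(\<Sum>h1\<in>hands u1 a. \<Sum>h2\<in>hands u2 b. hand_prob h1 * hand_prob h2 * ?C y h1 h2) =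
      pair_score \<theta> u1 u2 T a b y"
    if "y \<le> 7" "\<not> (a = 11 \<and> b = 11)" "a \<le> 11" "b \<le> 11" for y a b
  proof -
    let ?b = "banker_total T a b y"
    have C: "?C y h1 h2 = \<theta> * (\<Sum>c\<le>9. third_card_prob c * ?m u1 h1 (?b c)) +
        (1 - \<theta>) * (\<Sum>c\<le>9. third_card_prob c * ?m u2 h2 (?b c))"
      if "h1 \<in> hands u1 a" "h2 \<in> hands u2 b" for h1 h2
    proof -
      have "\<not> (fst h1 \<ge> 8 \<and> fst h2 \<ge> 8)"
        using that \<open>\<not> (a = 11 \<and> b = 11)\<close> u by (auto simp: hands_def shown_eq_11)
      moreover have "shown_card u1 (fst h1) (snd h1) = a" "shown_card u2 (fst h2) (snd h2) = b"
        using that by (auto simp: hands_def)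
      ultimately have "coup_payoff \<theta> u1 u2 T (fst h1, fst h2, y, snd h1, snd h2, c) =
          \<theta> * ?m u1 h1 (?b c) + (1 - \<theta>) * ?m u2 h2 (?b c)" for c
        using \<open>y \<le> 7\<close> by (auto simp: coup_payoff_def hand_result_def hand_score_def Let_def)
      moreover have "(\<Sum>c\<le>9. third_card_prob c * (\<theta> * f c + \<kappa> * g c)) =
          \<theta> * (\<Sum>c\<le>9. third_card_prob c * f c) + \<kappa> * (\<Sum>c\<le>9. third_card_prob c * g c)" for f g \<kappa>
        by (simp add: distrib_left sum.distrib sum_distrib_left mult.left_commute)
      ultimately show ?thesis by simp
    qed
    have "(\<Sum>h1\<in>hands u1 a. \<Sum>h2\<in>hands u2 b. hand_prob h1 * hand_prob h2 * ?C y h1 h2) =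
      (\<Sum>h1\<in>hands u1 a. \<Sum>h2\<in>hands u2 b. hand_prob h1 * hand_prob h2 *
        (\<theta> * (\<Sum>c\<le>9. third_card_prob c * ?m u1 h1 (?b c)) +
        (1 - \<theta>) * (\<Sum>c\<le>9. third_card_prob c * ?m u2 h2 (?b c))))"
      by (intro sum.cong refl) (simp add: C)
    also have "\<dots> = pair_score \<theta> u1 u2 T a b y"
      unfolding draw_pair
      by (cases "(a, b, y) \<in> T")
        (simp_all add: pair_score_def draw_score_def stand_score_def banker_total_def
          sum_third_card_prob flip: sum_distrib_right)
    finally show ?thesis .
  qed
  have low: "(\<Sum>h1\<in>?H. \<Sum>h2\<in>?H. hand_prob h1 * hand_prob h2 * ?C y h1 h2) =
      (\<Sum>h1\<in>?H. \<Sum>h2\<in>?H. hand_prob h1 * hand_prob h2 * (if fst h1 \<ge> 8 \<and> fst h2 \<ge> 8 then ?S y h1 h2 else 0)) +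
      (\<Sum>a\<le>11. \<Sum>b\<le>11. if a = 11 \<and> b = 11 then 0 else pair_score \<theta> u1 u2 T a b y)"
    if "y \<le> 7" for y
  proof -
    have eq: "(\<Sum>h1\<in>hands u1 a. \<Sum>h2\<in>hands u2 b. hand_prob h1 * hand_prob h2 * ?C y h1 h2) =
        (\<Sum>h1\<in>hands u1 a. \<Sum>h2\<in>hands u2 b. hand_prob h1 * hand_prob h2 *
           (if fst h1 \<ge> 8 \<and> fst h2 \<ge> 8 then ?S y h1 h2 else 0)) +
        (if a = 11 \<and> b = 11 then 0 else pair_score \<theta> u1 u2 T a b y)"
      if "a \<in> {..11}" "b \<in> {..11}" for a b
    proof (cases "a = 11 \<and> b = 11")
      case True
      have "fst h1 \<ge> 8 \<and> fst h2 \<ge> 8" if "h1 \<in> hands u1 a" "h2 \<in> hands u2 b" for h1 h2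
        using that True u by (auto simp: hands_def shown_eq_11)
      then show ?thesis using True by (auto intro!: sum.cong simp: stop)
    next
      case False
      have "\<not> (fst h1 \<ge> 8 \<and> fst h2 \<ge> 8)" if "h1 \<in> hands u1 a" "h2 \<in> hands u2 b" for h1 h2
        using that False u by (auto simp: hands_def shown_eq_11)
      then have "(\<Sum>h1\<in>hands u1 a. \<Sum>h2\<in>hands u2 b. hand_prob h1 * hand_prob h2 *
           (if fst h1 \<ge> 8 \<and> fst h2 \<ge> 8 then ?S y h1 h2 else 0)) = 0"
        by (intro sum.neutral ballI) auto
      moreover have "a \<le> 11" "b \<le> 11" using that by auto
      ultimately show ?thesis using go[OF \<open>y \<le> 7\<close> False] False by auto
    qed
    show ?thesis
      unfolding sum_hands_pair[OF u] sum.distrib[symmetric]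
      by (intro sum.cong refl eq)
  qed
  have Y: "{..9::nat} = {..7} \<union> {8, 9}" by auto
  have SS: "(\<Sum>h1\<in>?H. \<Sum>h2\<in>?H. hand_prob h1 * hand_prob h2 * F (fst h1) (fst h2)) =
      (\<Sum>x1\<le>9. \<Sum>x2\<le>9. two_card_prob x1 * two_card_prob x2 * F x1 x2)" for F :: "nat \<Rightarrow> nat \<Rightarrow> real"
  proof -
    have "(\<Sum>h1\<in>?H. \<Sum>h2\<in>?H. hand_prob h1 * hand_prob h2 * F (fst h1) (fst h2)) =
      (\<Sum>x1\<le>9. \<Sum>z1\<le>9. \<Sum>x2\<le>9. \<Sum>z2\<le>9. (two_card_prob x1 * two_card_prob x2 * F x1 x2 * third_card_prob z1) * third_card_prob z2)"
      by (simp add: sum.cartesian_product' hand_prob_def mult_ac)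
    also have "\<dots> = (\<Sum>x1\<le>9. \<Sum>z1\<le>9. (\<Sum>x2\<le>9. two_card_prob x1 * two_card_prob x2 * F x1 x2) * third_card_prob z1)"
      unfolding sum_distrib_right
      by (intro sum.cong refl) (simp add: sum_third_card_prob flip: sum_distrib_left)
    also have "\<dots> = (\<Sum>x1\<le>9. (\<Sum>x2\<le>9. two_card_prob x1 * two_card_prob x2 * F x1 x2) * (\<Sum>z1\<le>9. third_card_prob z1))"
      by (simp only: sum_distrib_left)
    finally show ?thesis by (simp add: sum_third_card_prob)
  qed
  have stops: "(\<Sum>h1\<in>?H. \<Sum>h2\<in>?H. hand_prob h1 * hand_prob h2 *
         (if y \<ge> 8 \<or> (fst h1 \<ge> 8 \<and> fst h2 \<ge> 8) then ?S y h1 h2 else 0)) =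
      (\<Sum>x1\<le>9. \<Sum>x2\<le>9. two_card_prob x1 * two_card_prob x2 * (if y \<ge> 8 \<or> (x1 \<ge> 8 \<and> x2 \<ge> 8)
         then \<theta> * sgn (real x1 - real y) + (1 - \<theta>) * sgn (real x2 - real y) else 0))" for y :: nat
    by (rule SS)
  have "payoff \<theta> u1 u2 T =
     (\<Sum>y\<le>9. two_card_prob y * (\<Sum>h1\<in>?H. \<Sum>h2\<in>?H. hand_prob h1 * hand_prob h2 * ?C y h1 h2))"
    by (rule payoff_sum)
  also have "\<dots> = (\<Sum>y\<le>9. two_card_prob y *
       ((\<Sum>h1\<in>?H. \<Sum>h2\<in>?H. hand_prob h1 * hand_prob h2 *
         (if y \<ge> 8 \<or> (fst h1 \<ge> 8 \<and> fst h2 \<ge> 8) then ?S y h1 h2 else 0)) +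
       (if y \<le> 7 then (\<Sum>a\<le>11. \<Sum>b\<le>11. if a = 11 \<and> b = 11 then 0 else pair_score \<theta> u1 u2 T a b y) else 0)))"
  proof (intro sum.cong refl arg_cong2[where f = "(*)"])
    fix y :: nat
    show "(\<Sum>h1\<in>?H. \<Sum>h2\<in>?H. hand_prob h1 * hand_prob h2 * ?C y h1 h2) =
      (\<Sum>h1\<in>?H. \<Sum>h2\<in>?H. hand_prob h1 * hand_prob h2 *
         (if y \<ge> 8 \<or> (fst h1 \<ge> 8 \<and> fst h2 \<ge> 8) then ?S y h1 h2 else 0)) +
       (if y \<le> 7 then (\<Sum>a\<le>11. \<Sum>b\<le>11. if a = 11 \<and> b = 11 then 0 else pair_score \<theta> u1 u2 T a b y) else 0)"
      by (cases "y \<le> 7") (simp_all add: low stop)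
  qed
  also have "\<dots> = stop_payoff \<theta> +
      (\<Sum>y\<le>9. if y \<le> 7 then two_card_prob y * (\<Sum>a\<le>11. \<Sum>b\<le>11. if a = 11 \<and> b = 11 then 0 else pair_score \<theta> u1 u2 T a b y) else 0)"
    unfolding stops stop_payoff_def distrib_left sum.distrib
    by (intro arg_cong2[where f = "(+)"] sum.cong refl) auto
  also have "(\<Sum>y\<le>9. if y \<le> 7 then two_card_prob y * (\<Sum>a\<le>11. \<Sum>b\<le>11. if a = 11 \<and> b = 11 then 0 else pair_score \<theta> u1 u2 T a b y) else 0) =
     (\<Sum>j\<le>7. two_card_prob j * (\<Sum>a\<le>11. \<Sum>b\<le>11. if a = 11 \<and> b = 11 then 0 else pair_score \<theta> u1 u2 T a b j))"
    by (simp add: Y)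
  finally show ?thesis .
qed

section \<open>Integer tables for the hands\<close>

text \<open>An entry \<open>(c, d)\<close> stands for the function \<open>c + d * u\<close> of the Player's strategy \<open>u\<close>.  Here it is \<open>13\<^sup>3\<close> times the
  probability of showing the card that is the index; the last two indices are standing and a natural.\<close>

definition card_weights :: "(int \<times> int) list" where
  "card_weights = [(356, 64), (89, 16), (89, 16), (89, 16), (89, 16), (89, 16), (89, 16), (89, 16),
     (89, 16), (89, 16), (624, -208), (416, 0)]"

text \<open>Indexed by Banker's total and then by the card shown: \<open>13\<^sup>4\<close> times the change of a Player's expected
  result, on the event that the card is shown, when Banker draws instead of standing.\<close>

definition card_gains :: "(int \<times> int) list list" where
  "card_gains =
  [[(-4484, -576), (-1193, -112), (-1015, -80), (-837, -48), (-659, -16), (-481, -144), (-463, -272), (-605, -240), (-747, -208), (-889, -176), (-4368, 1872), (0, 0)],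
   [(-2844, -576), (-943, -112), (-1015, -80), (-837, -48), (-659, -16), (-481, 16), (-303, -112), (-285, -240), (-427, -208), (-569, -176), (-4368, 1872), (0, 0)],
   [(-1564, -576), (-533, -112), (-765, -80), (-837, -48), (-659, -16), (-481, 16), (-303, 48), (-125, -80), (-107, -208), (-249, -176), (-4368, 1872), (0, 0)],
   [(-284, -576), (-213, -112), (-355, -80), (-587, -48), (-659, -16), (-481, 16), (-303, 48), (-125, 80), (53, -48), (71, -176), (-4368, 1872), (0, 0)],
   [(996, -576), (107, -112), (-35, -80), (-177, -48), (-409, -16), (-481, 16), (-303, 48), (-125, 80), (53, 112), (231, -16), (-4368, 1872), (0, 0)],
   [(1636, 64), (427, -112), (285, -80), (143, -48), (1, -16), (-231, 16), (-303, 48), (-125, 80), (53, 112), (231, 144), (-2288, -208), (0, 0)],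
   [(1636, 704), (587, 48), (605, -80), (463, -48), (321, -16), (179, 16), (-53, 48), (-125, 80), (53, 112), (231, 144), (1872, -2288), (0, 0)],
   [(1636, 704), (587, 208), (765, 80), (783, -48), (641, -16), (499, 16), (357, 48), (125, 80), (53, 112), (231, 144), (6032, -2288), (0, 0)]]"

definition lin :: "int \<times> int \<Rightarrow> real \<times> real \<Rightarrow> real" where
  "lin c v = of_int (fst c) * fst v + of_int (snd c) * snd v"

lemma hands_card: "k \<le> 9 \<Longrightarrow> u \<le> 1 \<Longrightarrow> hands u k = (\<lambda>x. (x, k)) ` {..4 + u}"
  by (auto simp: hands_def shown_card_def split: if_splits)

lemma hands_stand: "u \<le> 1 \<Longrightarrow> hands u 10 = {5 + u..7} \<times> {..9}"
  by (auto simp: hands_def shown_card_def split: if_splits)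

lemma hands_natural: "u \<le> 1 \<Longrightarrow> hands u 11 = {8, 9} \<times> {..9}"
  by (auto simp: hands_def shown_card_def split: if_splits)

lemma sum_hands_card:
  assumes "k \<le> 9" "u \<le> 1"
  shows "(\<Sum>h\<in>hands u k. hand_prob h * m (fst h) (player_total u (fst h) (snd h))) =
    (\<Sum>x\<le>4 + u. two_card_prob x * third_card_prob k * m x ((x + k) mod 10))"
  unfolding hands_card[OF assms]
  by (subst sum.reindex) (auto simp: inj_on_def hand_prob_def player_total_def)

lemma sum_hands_other:
  assumes "k = 10 \<or> k = 11" "u \<le> 1"
  shows "(\<Sum>h\<in>hands u k. hand_prob h * m (fst h) (player_total u (fst h) (snd h))) =
    (\<Sum>x\<in>(if k = 10 then {5 + u..7} else {8, 9}). two_card_prob x * m x x)" (is "?l = ?r")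
proof -
  let ?X = "if k = 10 then {5 + u..7} else {8, 9}"
  have "hands u k = ?X \<times> {..9}" using assms by (auto simp: hands_stand hands_natural)
  moreover have "player_total u x z = x" if "x \<in> ?X" for x z
    using that assms by (auto simp: player_total_def split: if_splits)
  ultimately have "?l = (\<Sum>x\<in>?X. \<Sum>z\<le>9. two_card_prob x * m x x * third_card_prob z)"
    by (simp add: sum.cartesian_product' hand_prob_def cong: sum.cong) (simp add: mult_ac)
  then show ?thesis by (simp add: sum_third_card_prob flip: sum_distrib_left)
qed

definition compare :: "nat \<Rightarrow> nat \<Rightarrow> real" where
  "compare f b = (if b < f then 1 else if f = b then 0 else - 1)"

text \<open>The expected result of a Player's total against a drawing Banker, in units of \<open>1/13\<close>: rows are
  Banker's two-card totals, columns the Player's final totals.\<close>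

definition draw_rows :: "int list list" where
  "draw_rows =
  [[-9, -4, -2, 0, 2, 4, 6, 8, 10, 12],
   [-12, -7, -2, 0, 2, 4, 6, 8, 10, 12],
   [-12, -10, -5, 0, 2, 4, 6, 8, 10, 12],
   [-12, -10, -8, -3, 2, 4, 6, 8, 10, 12],
   [-12, -10, -8, -6, -1, 4, 6, 8, 10, 12],
   [-12, -10, -8, -6, -4, 1, 6, 8, 10, 12],
   [-12, -10, -8, -6, -4, -2, 3, 8, 10, 12],
   [-12, -10, -8, -6, -4, -2, 0, 5, 10, 12]]"

lemma hand_score_compare: "hand_score x f b = (if x \<ge> 8 then 1 else compare f b)"
  by (auto simp: hand_score_def compare_def sgn_if)

lemma less_12_cases: "k < 12 \<Longrightarrow> k \<in> {0,1,2,3,4,5,6,7,8,9,10,11::nat}"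
  by (simp only: insert_iff empty_iff) presburger

lemma less_8_cases: "j < 8 \<Longrightarrow> j \<in> {0,1,2,3,4,5,6,7::nat}"
  by (simp only: insert_iff empty_iff) presburger

lemma atMost4: "{..4::nat} = {0,1,2,3,4}" by auto
lemma atMost5: "{..5::nat} = {0,1,2,3,4,5}" by auto
lemma Icc57: "{5..7::nat} = {5,6,7}" by auto
lemma Icc67: "{6..7::nat} = {6,7}" by auto

lemma show_prob_sums:
  assumes "u \<le> 1"
  shows "k \<le> 9 \<Longrightarrow> show_prob u k = (\<Sum>x\<le>4 + u. two_card_prob x * third_card_prob k)"
    and "k = 10 \<or> k = 11 \<Longrightarrow> show_prob u k = (\<Sum>x\<in>(if k = 10 then {5 + u..7} else {8, 9}). two_card_prob x)"
  using sum_hands_card[of k u "\<lambda>_ _. 1"] sum_hands_other[of k u "\<lambda>_ _. 1"] assms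
  by (simp_all add: show_prob_def)

lemma show_prob_table:
  assumes "k < 12"
  shows "show_prob 0 k = of_int (fst (card_weights ! k)) / 13 ^ 3"
    and "show_prob 1 k = (of_int (fst (card_weights ! k)) + of_int (snd (card_weights ! k))) / 13 ^ 3"
proof -
  have "\<forall>k\<in>{0,1,2,3,4,5,6,7,8,9,10,11}. show_prob 0 k = of_int (fst (card_weights ! k)) / 13 ^ 3 \<and>
    show_prob 1 k = (of_int (fst (card_weights ! k)) + of_int (snd (card_weights ! k))) / 13 ^ 3"
    by (simp add: show_prob_sums card_weights_def atMost4 atMost5 Icc57 Icc67
        two_card_prob_def third_card_prob_def)
  with less_12_cases[OF assms] show "show_prob 0 k = of_int (fst (card_weights ! k)) / 13 ^ 3"
    and "show_prob 1 k = (of_int (fst (card_weights ! k)) + of_int (snd (card_weights ! k))) / 13 ^ 3"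
    by blast+
qed

definition gain :: "nat \<Rightarrow> nat \<Rightarrow> nat \<Rightarrow> real" where
  "gain u k j = draw_score u k j - stand_score u k j"

lemma draw_compare:
  assumes "j \<in> {0,1,2,3,4,5,6,7}" "f \<in> {0,1,2,3,4,5,6,7,8,9}"
  shows "(\<Sum>c\<le>9. third_card_prob c * compare f ((j + c) mod 10)) = of_int (draw_rows ! j ! f) / 13"
  using assms
  by (elim insertE emptyE; hypsubst; simp add: atMost9 third_card_prob_def compare_def draw_rows_def)

definition draw_gain :: "nat \<Rightarrow> nat \<Rightarrow> real" where
  "draw_gain f j = of_int (draw_rows ! j ! f) / 13 - compare f j"

lemma mod_10_cases: "n mod 10 \<in> {0,1,2,3,4,5,6,7,8,9::nat}"
  by (simp only: insert_iff empty_iff) presburger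

text \<open>A natural contributes nothing: its result does not depend on what Banker draws.\<close>

lemma gain_sums:
  assumes u: "u \<le> 1" and j: "j \<in> {0,1,2,3,4,5,6,7}"
  shows "k \<le> 9 \<Longrightarrow> gain u k j = (\<Sum>x\<le>4 + u. two_card_prob x * third_card_prob k * draw_gain ((x + k) mod 10) j)"
    and "gain u 10 j = (\<Sum>x\<in>{5 + u..7}. two_card_prob x * draw_gain x j)"
    and "gain u 11 j = 0"
proof -
  have small: "(\<Sum>c\<le>9. third_card_prob c * hand_score x f ((j + c) mod 10)) - hand_score x f j = draw_gain f j"
    if "x \<le> 7" "f \<in> {0,1,2,3,4,5,6,7,8,9}" for x f
    using that draw_compare[OF j that(2)] by (simp add: hand_score_compare draw_gain_def)
  show "gain u k j = (\<Sum>x\<le>4 + u. two_card_prob x * third_card_prob k * draw_gain ((x + k) mod 10) j)"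
    if "k \<le> 9"
    unfolding gain_def draw_score_def stand_score_def
      sum_hands_card[OF that u, where m = "\<lambda>x f. hand_score x f j"]
      sum_hands_card[OF that u, where m = "\<lambda>x f. \<Sum>c\<le>9. third_card_prob c * hand_score x f ((j + c) mod 10)"]
      sum_subtractf[symmetric] right_diff_distrib[symmetric]
    using u by (intro sum.cong refl arg_cong2[where f = "(*)"] small mod_10_cases) auto
  have seven: "x \<in> {0,1,2,3,4,5,6,7,8,9}" if "x \<in> {5 + u..7}" for x
    using that by (simp only: insert_iff empty_iff atLeastAtMost_iff) presburger
  show "gain u 10 j = (\<Sum>x\<in>{5 + u..7}. two_card_prob x * draw_gain x j)"
    unfolding gain_def draw_score_def stand_score_def
      sum_hands_other[OF disjI1[OF refl] u, where m = "\<lambda>x f. hand_score x f j"]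
      sum_hands_other[OF disjI1[OF refl] u, where m = "\<lambda>x f. \<Sum>c\<le>9. third_card_prob c * hand_score x f ((j + c) mod 10)"]
      sum_subtractf[symmetric] right_diff_distrib[symmetric] if_True simp_thms
    by (intro sum.cong refl arg_cong2[where f = "(*)"] small seven) auto
  show "gain u 11 j = 0"
    unfolding gain_def draw_score_def stand_score_def
      sum_hands_other[OF disjI2[OF refl] u, where m = "\<lambda>x f. hand_score x f j"]
      sum_hands_other[OF disjI2[OF refl] u, where m = "\<lambda>x f. \<Sum>c\<le>9. third_card_prob c * hand_score x f ((j + c) mod 10)"]
    by (simp add: hand_score_compare sum_third_card_prob)
qed

lemma gain_table_aux:
  assumes "j \<in> {0,1,2,3,4,5,6,7}"
  shows "\<forall>k\<in>{0,1,2,3,4,5,6,7,8,9,10,11}.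
    gain 0 k j = of_int (fst (card_gains ! j ! k)) / 13 ^ 4 \<and>
    gain 1 k j = (of_int (fst (card_gains ! j ! k)) + of_int (snd (card_gains ! j ! k))) / 13 ^ 4"
  using assms
  by (elim insertE emptyE; hypsubst; simp add: gain_sums card_gains_def atMost4 atMost5 Icc57 Icc67
        two_card_prob_def third_card_prob_def draw_gain_def compare_def draw_rows_def)

lemma gain_table:
  assumes "k < 12" "j < 8"
  shows "gain 0 k j = of_int (fst (card_gains ! j ! k)) / 13 ^ 4"
    and "gain 1 k j = (of_int (fst (card_gains ! j ! k)) + of_int (snd (card_gains ! j ! k))) / 13 ^ 4"
  using gain_table_aux[OF less_8_cases[OF assms(2)]] less_12_cases[OF assms(1)] by blast+

definition stand_total :: "nat \<Rightarrow> nat \<Rightarrow> real" where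
  "stand_total u j = (\<Sum>k\<le>11. stand_score u k j)"

lemma atMost7: "{..7::nat} = {0,1,2,3,4,5,6,7}" by auto

lemma stand_sums:
  assumes "u \<le> 1"
  shows "k \<le> 9 \<Longrightarrow> stand_score u k j = (\<Sum>x\<le>4 + u. two_card_prob x * third_card_prob k * hand_score x ((x + k) mod 10) j)"
    and "k = 10 \<or> k = 11 \<Longrightarrow> stand_score u k j = (\<Sum>x\<in>(if k = 10 then {5 + u..7} else {8, 9}). two_card_prob x * hand_score x x j)"
  using assms unfolding stand_score_def
  by (simp_all only: sum_hands_card[where m = "\<lambda>x f. hand_score x f j"]
      sum_hands_other[where m = "\<lambda>x f. hand_score x f j"])

lemma stand_natural: "u \<le> 1 \<Longrightarrow> stand_score u 11 j = 32 / 169"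
  by (simp add: stand_sums two_card_prob_def hand_score_compare compare_def)

lemma stand_total_aux:
  "stand_total u j = (\<Sum>k\<le>9. stand_score u k j) + stand_score u 10 j + stand_score u 11 j"
proof -
  have "{..11::nat} = insert 11 (insert 10 {..9})" by auto
  then show ?thesis by (simp add: stand_total_def)
qed

lemma stand_total_sums:
  "(\<Sum>j\<le>7. two_card_prob j * stand_total 0 j) = 129705 / 13 ^ 5"
  "(\<Sum>j\<le>7. two_card_prob j * stand_total 1 j) = 125977 / 13 ^ 5"
  by (simp_all add: stand_total_aux stand_sums atMost4 atMost5 Icc57 Icc67 atMost7 atMost9
        two_card_prob_def third_card_prob_def hand_score_compare compare_def)

lemma stop_payoff_eq: "stop_payoff \<theta> = - 600608 / 13 ^ 6"
proof -
  let ?q = two_card_prob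
  have "stop_payoff \<theta> = \<theta> * (\<Sum>y\<le>9. ?q y * (\<Sum>x1\<le>9. \<Sum>x2\<le>9. ?q x1 * ?q x2 *
      (if y \<ge> 8 \<or> (x1 \<ge> 8 \<and> x2 \<ge> 8) then sgn (real x1 - real y) else 0))) +
    (1 - \<theta>) * (\<Sum>y\<le>9. ?q y * (\<Sum>x1\<le>9. \<Sum>x2\<le>9. ?q x1 * ?q x2 *
      (if y \<ge> 8 \<or> (x1 \<ge> 8 \<and> x2 \<ge> 8) then sgn (real x2 - real y) else 0)))"
    unfolding stop_payoff_def sum_distrib_left sum.distrib[symmetric]
    by (intro sum.cong refl) (auto simp: algebra_simps)
  also have "(\<Sum>y\<le>9. ?q y * (\<Sum>x1\<le>9. \<Sum>x2\<le>9. ?q x1 * ?q x2 *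
      (if y \<ge> 8 \<or> (x1 \<ge> 8 \<and> x2 \<ge> 8) then sgn (real x2 - real y) else 0))) =
     (\<Sum>y\<le>9. ?q y * (\<Sum>x1\<le>9. \<Sum>x2\<le>9. ?q x1 * ?q x2 *
      (if y \<ge> 8 \<or> (x1 \<ge> 8 \<and> x2 \<ge> 8) then sgn (real x1 - real y) else 0)))"
    by (rule sum.cong[OF refl], rule arg_cong2[where f = "(*)", OF refl], rule trans[OF sum.swap])
      (auto intro!: sum.cong)
  also have "\<dots> = - 600608 / 13 ^ 6"
    by (simp add: atMost9 two_card_prob_def)
  finally show ?thesis by (simp only: distrib_right[symmetric]) simp
qed

section \<open>The payoff as a trilinear form\<close>

definition banker_weight :: "nat \<Rightarrow> int" where
  "banker_weight j = (if j = 0 then 25 else 16)"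

text \<open>The effect on the payoff, scaled by \<open>13\<^sup>9\<close>, of drawing at one information set.  It is kept as a homogeneous
  trilinear form: the arguments \<open>(\<theta>, 1 - \<theta>)\<close>, \<open>(1, x)\<close>, \<open>(1, y)\<close> give the effect itself, while \<open>(1, -1)\<close> or \<open>(0, 1)\<close> in
  one place gives its derivative in that variable.  Derivatives thus need no theory of their own.\<close>

definition edge :: "nat \<times> nat \<times> nat \<Rightarrow> real \<times> real \<Rightarrow> real \<times> real \<Rightarrow> real \<times> real \<Rightarrow> real" where
  "edge = (\<lambda>(a, b, j) A X Y. of_int (banker_weight j) *
     (fst A * lin (card_gains ! j ! a) X * lin (card_weights ! b) Y +
      snd A * lin (card_weights ! a) X * lin (card_gains ! j ! b) Y))"

definition stand_coeffs :: "int \<times> int" where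
  "stand_coeffs = (2076755993, - 106475408)"

text \<open>The scaled payoff against a Banker who always stands.\<close>

definition stand_form :: "real \<times> real \<Rightarrow> real \<times> real \<Rightarrow> real \<times> real \<Rightarrow> real" where
  "stand_form A X Y = fst A * lin stand_coeffs X * fst Y + snd A * fst X * lin stand_coeffs Y"

definition total_form :: "(nat \<times> nat \<times> nat) set \<Rightarrow> real \<times> real \<Rightarrow> real \<times> real \<Rightarrow> real \<times> real \<Rightarrow> real" where
  "total_form T A X Y = stand_form A X Y + (\<Sum>k\<in>T. edge k A X Y)"

lemma show_prob_lin: "u \<le> 1 \<Longrightarrow> k < 12 \<Longrightarrow> show_prob u k = lin (card_weights ! k) (1, real u) / 13 ^ 3"
  using show_prob_table[of k] by (cases "u = 0") (auto simp: lin_def le_Suc_eq)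

lemma gain_lin: "u \<le> 1 \<Longrightarrow> k < 12 \<Longrightarrow> j < 8 \<Longrightarrow> gain u k j = lin (card_gains ! j ! k) (1, real u) / 13 ^ 4"
  using gain_table[of k j] by (cases "u = 0") (auto simp: lin_def le_Suc_eq)

lemma stand_lin: "u \<le> 1 \<Longrightarrow> (\<Sum>j\<le>7. two_card_prob j * stand_total u j) = (129705 - 3728 * real u) / 13 ^ 5"
  using stand_total_sums by (cases "u = 0") (auto simp: le_Suc_eq)

lemma sum_show_prob: "u \<le> 1 \<Longrightarrow> (\<Sum>k\<le>11. show_prob u k) = 1"
  by (simp add: show_prob_def sum_hands sum_hand_prob)

lemma two_card_prob_weight: "j < 8 \<Longrightarrow> two_card_prob j = of_int (banker_weight j) / 13 ^ 2"
  by (simp add: two_card_prob_def banker_weight_def)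

text \<open>The sum over all pairs of cards includes the two naturals, whose contribution does not depend on the
  strategies and is taken off again; the integers in \<open>stand_coeffs\<close> collect all constants.\<close>

lemma payoff_form:
  assumes u: "u1 \<le> 1" "u2 \<le> 1" and T: "T \<subseteq> info_sets"
  shows "payoff \<theta> u1 u2 T = total_form T (\<theta>, 1 - \<theta>) (1, real u1) (1, real u2) / 13 ^ 9"
proof -
  let ?S = "stand_score" and ?P = show_prob and ?q = two_card_prob
  let ?s = "\<lambda>a b j. \<theta> * ?S u1 a j * ?P u2 b + (1 - \<theta>) * ?P u1 a * ?S u2 b j"
  let ?g = "\<lambda>a b j. \<theta> * gain u1 a j * ?P u2 b + (1 - \<theta>) * ?P u1 a * gain u2 b j"
  let ?nat = "\<lambda>a b. a = 11 \<and> b = (11::nat)"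
  have pair: "pair_score \<theta> u1 u2 T a b j = ?s a b j + (if (a, b, j) \<in> T then ?g a b j else 0)" for a b j
    by (simp add: pair_score_def gain_def algebra_simps)
  have nat0: "(11, 11, j) \<notin> T" for j
    using T by (auto simp: info_sets_def)
  have "(\<Sum>a\<le>11. \<Sum>b\<le>11. if ?nat a b then 0 else pair_score \<theta> u1 u2 T a b j) =
     (\<Sum>a\<le>11. \<Sum>b\<le>11. ?s a b j) - ?s 11 11 j + (\<Sum>a\<le>11. \<Sum>b\<le>11. if (a, b, j) \<in> T then ?g a b j else 0)" for j
  proof -
    have "(if ?nat a b then 0 else pair_score \<theta> u1 u2 T a b j) =
        ?s a b j - (if b = 11 then if a = 11 then ?s a b j else 0 else 0) + (if (a, b, j) \<in> T then ?g a b j else 0)" for a b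
      using nat0[of j] by (auto simp: pair)
    then show ?thesis by (simp add: sum.distrib sum_subtractf)
  qed
  moreover have "(\<Sum>a\<le>11. \<Sum>b\<le>11. ?s a b j) = \<theta> * stand_total u1 j + (1 - \<theta>) * stand_total u2 j" for j
  proof -
    have "(\<Sum>a\<le>11. \<Sum>b\<le>11. ?s a b j) = \<theta> * ((\<Sum>a\<le>11. ?S u1 a j) * (\<Sum>b\<le>11. ?P u2 b)) +
        (1 - \<theta>) * ((\<Sum>a\<le>11. ?P u1 a) * (\<Sum>b\<le>11. ?S u2 b j))"
      unfolding sum_product by (simp only: sum_distrib_left sum.distrib mult.assoc)
    then show ?thesis
      by (simp only: sum_show_prob[OF u(1)] sum_show_prob[OF u(2)] stand_total_def mult_1_right mult_1_left)
  qed
  moreover have "?s 11 11 j = (32 / 169) ^ 2" for j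
  proof -
    have "?P u 11 = 32 / 169" if "u \<le> 1" for u
      using that by (simp add: show_prob_lin lin_def card_weights_def)
    note P = this[OF u(1)] this[OF u(2)]
    have "\<theta> * c * c + (1 - \<theta>) * c * c = c ^ 2" for c :: real
      by (simp add: power2_eq_square algebra_simps)
    then show ?thesis
      by (simp only: P stand_natural[OF u(1)] stand_natural[OF u(2)])
  qed
  moreover have swap: "(\<Sum>j\<le>7. \<Sum>a\<le>11. \<Sum>b\<le>11. F a b j) = (\<Sum>a\<le>11. \<Sum>b\<le>11. \<Sum>j\<le>7. F a b j)"
    for F :: "nat \<Rightarrow> nat \<Rightarrow> nat \<Rightarrow> real"
    by (rule trans[OF sum.swap], rule sum.cong[OF refl], rule sum.swap)
  ultimately have "payoff \<theta> u1 u2 T = stop_payoff \<theta> +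
      (\<Sum>j\<le>7. ?q j * (\<theta> * stand_total u1 j + (1 - \<theta>) * stand_total u2 j - (32 / 169) ^ 2)) +
      (\<Sum>j\<le>7. ?q j * (\<Sum>a\<le>11. \<Sum>b\<le>11. if (a, b, j) \<in> T then ?g a b j else 0))"
    unfolding payoff_split[OF u] by (simp add: sum.distrib distrib_left)
  also have "(\<Sum>j\<le>7. ?q j * (\<theta> * stand_total u1 j + (1 - \<theta>) * stand_total u2 j - (32 / 169) ^ 2)) =
      \<theta> * (\<Sum>j\<le>7. ?q j * stand_total u1 j) + (1 - \<theta>) * (\<Sum>j\<le>7. ?q j * stand_total u2 j)
        - (\<Sum>j\<le>7. ?q j) * (32 / 169) ^ 2"
    unfolding sum_distrib_left sum_distrib_right sum.distrib[symmetric] sum_subtractf[symmetric]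
    by (intro sum.cong refl) (simp add: algebra_simps)
  also have "(\<Sum>j\<le>7. ?q j) = 137 / 169" by (simp add: atMost7 two_card_prob_def)
  also have "(\<Sum>j\<le>7. ?q j * (\<Sum>a\<le>11. \<Sum>b\<le>11. if (a, b, j) \<in> T then ?g a b j else 0)) =
      (\<Sum>(a, b, j)\<in>{..11} \<times> {..11} \<times> {..7}. if (a, b, j) \<in> T then ?q j * ?g a b j else 0)"
    unfolding sum.cartesian_product[symmetric] sum_distrib_left swap by (auto intro!: sum.cong)
  also have "\<dots> = (\<Sum>(a, b, j)\<in>T. ?q j * ?g a b j)"
    using T by (intro sum.mono_neutral_cong_right) (auto simp: info_sets_def)
  also have "\<dots> = (\<Sum>k\<in>T. edge k (\<theta>, 1 - \<theta>) (1, real u1) (1, real u2)) / 13 ^ 9"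
    unfolding sum_divide_distrib
  proof (rule sum.cong[OF refl])
    fix k assume "k \<in> T"
    then obtain a b j where k: "k = (a, b, j)" "a < 12" "b < 12" "j < 8"
      using T by (cases k) (auto simp: info_sets_def)
    show "(case k of (a, b, j) \<Rightarrow> ?q j * ?g a b j) = edge k (\<theta>, 1 - \<theta>) (1, real u1) (1, real u2) / 13 ^ 9"
      using k u by (simp add: edge_def gain_lin show_prob_lin two_card_prob_weight field_simps)
  qed
  also have "stop_payoff \<theta> + (\<theta> * (\<Sum>j\<le>7. ?q j * stand_total u1 j) + (1 - \<theta>) * (\<Sum>j\<le>7. ?q j * stand_total u2 j)
        - 137 / 169 * (32 / 169) ^ 2) = stand_form (\<theta>, 1 - \<theta>) (1, real u1) (1, real u2) / 13 ^ 9"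
    by (simp add: stop_payoff_eq stand_lin[OF u(1)] stand_lin[OF u(2)] stand_form_def stand_coeffs_def lin_def power2_eq_square field_simps)
  finally show ?thesis by (simp add: total_form_def add_divide_distrib)
qed

text \<open>A form that is affine in each mixing probability agrees with its mixture over the pure strategies.\<close>

lemma mixed_payoff_form:
  assumes T: "T \<subseteq> info_sets"
  shows "mixed_payoff \<theta> (p1, p2) T = total_form T (\<theta>, 1 - \<theta>) (1, p1) (1, p2) / 13 ^ 9"
proof -
  let ?A = "(\<theta>, 1 - \<theta>)"
  define B where "B f \<longleftrightarrow> f (1, p1) (1, p2) = (1 - p1) * (1 - p2) * f (1, 0) (1, 0) + (1 - p1) * p2 * f (1, 0) (1, 1)
     + p1 * (1 - p2) * f (1, 1) (1, 0) + p1 * p2 * (f (1, 1) (1, 1) :: real)" for f :: "real \<times> real \<Rightarrow> real \<times> real \<Rightarrow> real"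
  have "B (edge k ?A)" for k
    by (cases k) (simp add: B_def edge_def lin_def algebra_simps)
  then have "B (\<lambda>X Y. \<Sum>k\<in>T. edge k ?A X Y)"
    by (simp add: B_def sum.distrib sum_distrib_left)
  moreover have "B (stand_form ?A)"
    by (simp add: B_def stand_form_def lin_def algebra_simps)
  ultimately have "B (total_form T ?A)"
    by (simp add: B_def total_form_def algebra_simps)
  then show ?thesis
    using T by (simp add: B_def mixed_payoff_def payoff_form add_divide_distrib)
qed

section \<open>Sign certificates from the corners of a cell\<close>

definition ilin :: "int \<times> int \<Rightarrow> int \<times> int \<Rightarrow> int" where
  "ilin c v = fst c * fst v + snd c * snd v"

type_synonym corner = "(int \<times> int) \<times> (int \<times> int) \<times> (int \<times> int)"

text \<open>An edge is the inner product of a pair that depends on the first Player's hand and a pair that depends on the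
  second one's.  Evaluating both pairs at all corners once per card keeps the checks below feasible for
  evaluation by rewriting.\<close>

definition left_values :: "corner list \<Rightarrow> int \<times> int \<Rightarrow> int \<times> int \<Rightarrow> (int \<times> int) list" where
  "left_values cs w g = map (\<lambda>(A, X, Y). (fst A * ilin g X, snd A * ilin w X)) cs"

definition right_values :: "corner list \<Rightarrow> int \<times> int \<Rightarrow> int \<times> int \<Rightarrow> (int \<times> int) list" where
  "right_values cs w g = map (\<lambda>(A, X, Y). (ilin w Y, ilin g Y)) cs"

definition dots :: "(int \<times> int) list \<Rightarrow> (int \<times> int) list \<Rightarrow> int list" where
  "dots us vs = map2 (\<lambda>u v. fst u * fst v + snd u * snd v) us vs"

text \<open>Sufficient for the edge to be nonpositive at all corners.  The first alternative, by signs of the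
  factors alone, spares the multiplications in most cases.\<close>

definition surely_nonpos :: "(int \<times> int) list \<Rightarrow> (int \<times> int) list \<Rightarrow> bool" where
  "surely_nonpos us vs \<longleftrightarrow>
     list_all (\<lambda>u. fst u \<le> 0 \<and> 0 \<le> snd u) us \<and> list_all (\<lambda>v. 0 \<le> fst v \<and> snd v \<le> 0) vs
     \<or> list_all (\<lambda>z. z \<le> 0) (dots us vs)"

definition surely_nonneg :: "(int \<times> int) list \<Rightarrow> (int \<times> int) list \<Rightarrow> bool" where
  "surely_nonneg us vs \<longleftrightarrow>
     list_all (\<lambda>u. 0 \<le> fst u \<and> 0 \<le> snd u) us \<and> list_all (\<lambda>v. 0 \<le> fst v \<and> 0 \<le> snd v) vs
     \<or> list_all (\<lambda>z. 0 \<le> z) (dots us vs)"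

definition vadd :: "int list \<Rightarrow> int list \<Rightarrow> int list" where "vadd u v = map2 (+) u v"

text \<open>A lower bound, corner by corner, for what an information set can contribute to a form (given by the primed values) when
  Banker replies optimally to the unprimed point.  If the sign of the edge is undecided, the bound must lie below
  both the contribution and zero, also after averaging over the corners; hence the contribution if this is nowhere positive,
  and else a constant.\<close>

definition edge_bound ::
  "(int \<times> int) list \<Rightarrow> (int \<times> int) list \<Rightarrow> (int \<times> int) list \<Rightarrow> (int \<times> int) list \<Rightarrow> int list" where
  "edge_bound us us' vs vs' =
     (if surely_nonpos us vs then dots us' vs'
      else if surely_nonneg us vs then map (\<lambda>_. 0) us'
      else let d = dots us' vs' in
        if list_all (\<lambda>z. z \<le> 0) d then d
        else let m = foldr min d 0 in map (\<lambda>_. m) us')"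

definition row_sum where
  "row_sum F us us' vss acc = foldr (\<lambda>v acc. vadd (F us us' (fst v) (snd v)) acc) vss acc"

definition column_sum where
  "column_sum F cs ds gs =
     (let lefts = map2 (\<lambda>w g. (left_values cs w g, left_values ds w g)) card_weights gs;
          rights = map2 (\<lambda>w g. (right_values cs w g, right_values ds w g)) card_weights gs
      in foldr (\<lambda>u acc. row_sum F (fst u) (snd u) rights acc) lefts (map (\<lambda>_. 0) ds))"

definition stand_values :: "corner list \<Rightarrow> int list" where
  "stand_values ds =
     map (\<lambda>(A, X, Y). fst A * ilin stand_coeffs X * fst Y + snd A * fst X * ilin stand_coeffs Y) ds"

text \<open>The factors 25 and 16 are Banker's weights \<open>banker_weight\<close>: only a two-card total of 0 has the larger one.\<close>

definition grid_sum where
  "grid_sum F cs ds =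
     vadd (stand_values ds)
      (vadd (map (\<lambda>z. 25 * z) (column_sum F cs ds (hd card_gains)))
        (map (\<lambda>z. 16 * z) (foldr (\<lambda>gs acc. vadd (column_sum F cs ds gs) acc) (tl card_gains) (map (\<lambda>_. 0) ds))))"

definition cell_ok :: "corner list \<Rightarrow> corner list \<Rightarrow> bool" where
  "cell_ok cs ds \<longleftrightarrow> list_all (\<lambda>z. 0 < z) (grid_sum edge_bound cs ds)"

definition corners :: "(int \<times> int) list \<Rightarrow> (int \<times> int) list \<Rightarrow> (int \<times> int) list \<Rightarrow> corner list" where
  "corners As Xs Ys = concat (map (\<lambda>A. concat (map (\<lambda>X. map (\<lambda>Y. (A, X, Y)) Ys) Xs)) As)"

definition weigh :: "real list \<Rightarrow> int list \<Rightarrow> real" where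
  "weigh ws v = sum_list (map2 (\<lambda>w z. w * real_of_int z) ws v)"

definition convex_weights :: "real list \<Rightarrow> bool" where
  "convex_weights ws \<longleftrightarrow> (\<forall>w\<in>set ws. 0 \<le> w) \<and> sum_list ws = 1"

lemma weigh_Nil [simp]: "weigh [] v = 0"
  and weigh_Cons [simp]: "weigh (w # ws) (z # v) = w * real_of_int z + weigh ws v"
  by (simp_all add: weigh_def)

lemma weigh_vadd: "length u = length ws \<Longrightarrow> length v = length ws \<Longrightarrow> weigh ws (vadd u v) = weigh ws u + weigh ws v"
proof (induction ws arbitrary: u v)
  case (Cons w ws)
  then show ?case by (cases u; cases v) (auto simp: vadd_def algebra_simps)
qed simp

lemma length_vadd: "length (vadd u v) = min (length u) (length v)"
  by (simp add: vadd_def)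

lemma weigh_scale: "length v = length ws \<Longrightarrow> weigh ws (map (\<lambda>z. c * z) v) = of_int c * weigh ws v"
proof (induction ws arbitrary: v)
  case (Cons w ws)
  then show ?case by (cases v) (auto simp: algebra_simps)
qed simp

lemma weigh_map_add: "length cs = length ws \<Longrightarrow>
    weigh ws (map (\<lambda>c. f c + g c) cs) = weigh ws (map f cs) + weigh ws (map g cs)"
proof (induction ws arbitrary: cs)
  case (Cons w ws)
  then show ?case by (cases cs) (auto simp: algebra_simps)
qed simp

lemma weigh_const: "length us = length ws \<Longrightarrow> weigh ws (map (\<lambda>_. m) us) = of_int m * sum_list ws"
proof (induction ws arbitrary: us)
  case (Cons w ws)
  then show ?case by (cases us) (auto simp: algebra_simps)
qed simp

lemma weigh_mono:
  assumes "\<forall>w\<in>set ws. 0 \<le> w" "length v = length ws" "\<forall>z\<in>set v. m \<le> z"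
  shows "of_int m * sum_list ws \<le> weigh ws v"
  using assms
proof (induction ws arbitrary: v)
  case (Cons w ws)
  then obtain z v' where v: "v = z # v'" by (cases v) auto
  have "of_int m * w \<le> w * of_int z" using Cons.prems v by (simp add: mult.commute mult_left_mono)
  with Cons v show ?case by (force simp: algebra_simps)
qed simp

lemma weigh_nonneg:
  assumes "convex_weights ws" "length v = length ws" "\<forall>z\<in>set v. 0 \<le> z"
  shows "0 \<le> weigh ws v"
  using weigh_mono[of ws v 0] assms by (simp add: convex_weights_def)

lemma weigh_pos:
  assumes "convex_weights ws" "length v = length ws" "\<forall>z\<in>set v. 0 < z"
  shows "0 < weigh ws v"
  using weigh_mono[of ws v 1] assms by (auto simp: convex_weights_def int_one_le_iff_zero_less)

lemma weigh_nonpos: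
  assumes "convex_weights ws" "length v = length ws" "\<forall>z\<in>set v. z \<le> 0"
  shows "weigh ws v \<le> 0"
  using weigh_nonneg[of ws "map (\<lambda>z. - 1 * z) v"] assms weigh_scale[of v ws "-1"] by auto

lemma set_dots: "z \<in> set (dots us vs) \<Longrightarrow> \<exists>u\<in>set us. \<exists>v\<in>set vs. z = fst u * fst v + snd u * snd v"
  by (auto simp: dots_def in_set_zip) (metis nth_mem fst_conv snd_conv)

lemma surely_nonposD:
  assumes "surely_nonpos us vs" "z \<in> set (dots us vs)"
  shows "z \<le> 0"
proof (cases "list_all (\<lambda>z. z \<le> 0) (dots us vs)")
  case True
  then show ?thesis using assms(2) by (simp add: list_all_iff)
next
  case False
  obtain u v where uv: "u \<in> set us" "v \<in> set vs" "z = fst u * fst v + snd u * snd v"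
    using set_dots[OF assms(2)] by blast
  have "fst u \<le> 0 \<and> 0 \<le> snd u" "0 \<le> fst v \<and> snd v \<le> 0"
    using False assms(1) uv by (auto simp: surely_nonpos_def list_all_iff)
  then show ?thesis unfolding uv
    by (intro add_nonpos_nonpos) (auto intro: mult_nonpos_nonneg mult_nonneg_nonpos)
qed

lemma surely_nonnegD:
  assumes "surely_nonneg us vs" "z \<in> set (dots us vs)"
  shows "0 \<le> z"
proof (cases "list_all (\<lambda>z. 0 \<le> z) (dots us vs)")
  case True
  then show ?thesis using assms(2) by (simp add: list_all_iff)
next
  case False
  obtain u v where uv: "u \<in> set us" "v \<in> set vs" "z = fst u * fst v + snd u * snd v"
    using set_dots[OF assms(2)] by blast
  have "0 \<le> fst u \<and> 0 \<le> snd u" "0 \<le> fst v \<and> 0 \<le> snd v"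
    using False assms(1) uv by (auto simp: surely_nonneg_def list_all_iff)
  then show ?thesis unfolding uv by (intro add_nonneg_nonneg) auto
qed

lemma foldr_min_le: "foldr min d (0::int) \<le> 0" "z \<in> set d \<Longrightarrow> foldr min d (0::int) \<le> z"
  by (induction d) auto

lemma edge_bound_sound:
  fixes us us' vs vs'
  assumes ws: "convex_weights ws"
    and len: "length us = length ws" "length us' = length ws" "length vs = length ws" "length vs' = length ws"
  defines "e \<equiv> weigh ws (dots us vs)" and "e' \<equiv> weigh ws (dots us' vs')"
  shows "weigh ws (edge_bound us us' vs vs') \<le> (if e < 0 \<or> surely_nonpos us vs then e' else 0)"
    and "surely_nonpos us vs \<Longrightarrow> e \<le> 0"
    and "length (edge_bound us us' vs vs') = length ws"
proof -
  have l: "length (dots us vs) = length ws" "length (dots us' vs') = length ws"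
    using len by (auto simp: dots_def)
  show nonpos: "surely_nonpos us vs \<Longrightarrow> e \<le> 0"
    unfolding e_def using surely_nonposD by (intro weigh_nonpos ws l) auto
  have nonneg: "surely_nonneg us vs \<Longrightarrow> 0 \<le> e"
    unfolding e_def using surely_nonnegD by (intro weigh_nonneg ws l) auto
  show "length (edge_bound us us' vs vs') = length ws"
    by (auto simp: edge_bound_def l len Let_def)
  have one: "sum_list ws = 1" using ws by (simp add: convex_weights_def)
  consider "surely_nonpos us vs" | "\<not> surely_nonpos us vs" "surely_nonneg us vs"
    | "\<not> surely_nonpos us vs" "\<not> surely_nonneg us vs" "\<forall>z\<in>set (dots us' vs'). z \<le> 0"
    | "\<not> surely_nonpos us vs" "\<not> surely_nonneg us vs" "\<not> (\<forall>z\<in>set (dots us' vs'). z \<le> 0)"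
    by blast
  then show "weigh ws (edge_bound us us' vs vs') \<le> (if e < 0 \<or> surely_nonpos us vs then e' else 0)"
  proof cases
    case 1 then show ?thesis by (simp add: edge_bound_def e'_def)
  next
    case 2 then show ?thesis using nonneg by (simp add: edge_bound_def weigh_const len)
  next
    case 3
    then have "e' \<le> 0" unfolding e'_def by (intro weigh_nonpos ws l)
    then show ?thesis using 3 by (simp add: edge_bound_def list_all_iff Let_def flip: e'_def)
  next
    case 4
    let ?m = "foldr min (dots us' vs') 0"
    have "of_int ?m * sum_list ws \<le> e'" unfolding e'_def
      using ws foldr_min_le by (intro weigh_mono l) (auto simp: convex_weights_def)
    moreover have "real_of_int ?m \<le> 0" using foldr_min_le(1)[of "dots us' vs'"] by linarith
    moreover have "weigh ws (edge_bound us us' vs vs') = of_int ?m"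
      using 4 weigh_const[OF len(2), of ?m] by (auto simp: edge_bound_def list_all_iff Let_def one)
    ultimately show ?thesis by (simp add: one)
  qed
qed

lemma weigh_foldr:
  assumes "\<forall>v\<in>set vs. length (f v) = length ws" "length acc = length ws"
  shows "weigh ws (foldr (\<lambda>v acc. vadd (f v) acc) vs acc) = (\<Sum>v\<leftarrow>vs. weigh ws (f v)) + weigh ws acc \<and>
    length (foldr (\<lambda>v acc. vadd (f v) acc) vs acc) = length ws"
  using assms by (induction vs) (auto simp: weigh_vadd length_vadd)

text \<open>A point of a cell is a weighted mean of the corners, up to the scale \<open>s\<close> that keeps the corners integral.  Since the
  forms are trilinear, the mean is required of the products of linear forms, not of the arguments.\<close>

definition mixture :: "real list \<Rightarrow> corner list \<Rightarrow> real \<Rightarrow> real \<times> real \<Rightarrow> real \<times> real \<Rightarrow> real \<times> real \<Rightarrow> bool" where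
  "mixture ws cs s A X Y \<longleftrightarrow> length cs = length ws \<and> (\<forall>p q.
     s * (fst A * lin p X * lin q Y) = weigh ws (map (\<lambda>(A, X, Y). fst A * ilin p X * ilin q Y) cs) \<and>
     s * (snd A * lin p X * lin q Y) = weigh ws (map (\<lambda>(A, X, Y). snd A * ilin p X * ilin q Y) cs))"

lemma mixtureD:
  assumes "mixture ws cs s A X Y"
  shows "weigh ws (map (\<lambda>(A, X, Y). fst A * ilin p X * ilin q Y) cs) = s * (fst A * lin p X * lin q Y)"
    and "weigh ws (map (\<lambda>(A, X, Y). snd A * ilin p X * ilin q Y) cs) = s * (snd A * lin p X * lin q Y)"
  using assms unfolding mixture_def by metis+

abbreviation lv where "lv cs j a \<equiv> left_values cs (card_weights ! a) (card_gains ! j ! a)"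
abbreviation rv where "rv cs j b \<equiv> right_values cs (card_weights ! b) (card_gains ! j ! b)"

lemma dots_values:
  "dots (left_values cs w g) (right_values cs w' g') =
    map (\<lambda>c. (case c of (A, X, Y) \<Rightarrow> fst A * ilin g X * ilin w' Y) + (case c of (A, X, Y) \<Rightarrow> snd A * ilin w X * ilin g' Y)) cs"
  by (induction cs) (auto simp: dots_def left_values_def right_values_def)

lemma edge_mixture:
  assumes "mixture ws cs s A X Y"
  shows "s * edge (a, b, j) A X Y = of_int (banker_weight j) * weigh ws (dots (lv cs j a) (rv cs j b))"
proof -
  have len: "length cs = length ws" using assms by (simp add: mixture_def)
  have "weigh ws (dots (lv cs j a) (rv cs j b)) =
      s * (fst A * lin (card_gains ! j ! a) X * lin (card_weights ! b) Y) +
      s * (snd A * lin (card_weights ! a) X * lin (card_gains ! j ! b) Y)"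
    unfolding dots_values weigh_map_add[OF len] by (simp only: mixtureD[OF assms])
  then show ?thesis by (simp add: edge_def algebra_simps)
qed

lemma stand_mixture:
  assumes "mixture ws cs s A X Y"
  shows "s * stand_form A X Y = weigh ws (stand_values cs)"
proof -
  have len: "length cs = length ws" using assms by (simp add: mixture_def)
  have v: "stand_values cs = map (\<lambda>c. (case c of (A, X, Y) \<Rightarrow> fst A * ilin stand_coeffs X * ilin (1, 0) Y) +
      (case c of (A, X, Y) \<Rightarrow> snd A * ilin (1, 0) X * ilin stand_coeffs Y)) cs"
    by (auto simp: stand_values_def ilin_def)
  have "weigh ws (stand_values cs) = s * (fst A * lin stand_coeffs X * lin (1, 0) Y) +
      s * (snd A * lin (1, 0) X * lin stand_coeffs Y)"
    unfolding v weigh_map_add[OF len] by (simp only: mixtureD[OF assms])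
  then show ?thesis by (simp add: stand_form_def lin_def algebra_simps)
qed

lemma lengths: "length card_weights = 12" "length card_gains = 8"
  "j < 8 \<Longrightarrow> length (card_gains ! j) = 12"
  using less_8_cases[of j] by (auto simp: card_weights_def card_gains_def)

lemma sum_list_map2: "length us = n \<Longrightarrow> length vs = n \<Longrightarrow> (\<Sum>x\<leftarrow>map2 f us vs. g x) = (\<Sum>i<n. g (f (us ! i) (vs ! i)))"
  for g :: "_ \<Rightarrow> real"
  by (simp add: sum_list_sum_nth atLeast0LessThan)

definition keeps_length where
  "keeps_length n F \<longleftrightarrow> (\<forall>us us' vs vs'. length us = n \<longrightarrow> length us' = n \<longrightarrow> length vs = n \<longrightarrow>
     length vs' = n \<longrightarrow> length (F us us' vs vs') = n)"

lemma weigh_column_sum: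
  assumes F: "keeps_length (length ws) F"
    and cs: "length cs = length ws" and ds: "length ds = length ws" and j: "j < 8"
  shows "weigh ws (column_sum F cs ds (card_gains ! j)) =
      (\<Sum>a<12. \<Sum>b<12. weigh ws (F (lv cs j a) (lv ds j a) (rv cs j b) (rv ds j b)))"
    and "length (column_sum F cs ds (card_gains ! j)) = length ws"
proof -
  let ?L = "map2 (\<lambda>w g. (left_values cs w g, left_values ds w g)) card_weights (card_gains ! j)"
  let ?R = "map2 (\<lambda>w g. (right_values cs w g, right_values ds w g)) card_weights (card_gains ! j)"
  have L: "length (fst u) = length ws \<and> length (snd u) = length ws" if "u \<in> set ?L" for u
    using that cs ds by (auto simp: left_values_def)
  have R: "length (fst u) = length ws \<and> length (snd u) = length ws" if "u \<in> set ?R" for u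
    using that cs ds by (auto simp: right_values_def)
  have row: "weigh ws (row_sum F (fst u) (snd u) ?R acc) =
      (\<Sum>v\<leftarrow>?R. weigh ws (F (fst u) (snd u) (fst v) (snd v))) + weigh ws acc \<and>
      length (row_sum F (fst u) (snd u) ?R acc) = length ws"
    if "u \<in> set ?L" "length acc = length ws" for u acc
    unfolding row_sum_def
    using L[OF that(1)] R that(2) F by (intro weigh_foldr) (simp_all add: keeps_length_def)
  have "weigh ws (foldr (\<lambda>u acc. row_sum F (fst u) (snd u) ?R acc) us acc) =
      (\<Sum>u\<leftarrow>us. \<Sum>v\<leftarrow>?R. weigh ws (F (fst u) (snd u) (fst v) (snd v))) + weigh ws acc \<and>
      length (foldr (\<lambda>u acc. row_sum F (fst u) (snd u) ?R acc) us acc) = length ws"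
    if "set us \<subseteq> set ?L" "length acc = length ws" for us acc
    using that(1) by (induction us) (use row that(2) in auto)
  from this[of ?L "map (\<lambda>_. 0) ds"]
  have *: "weigh ws (column_sum F cs ds (card_gains ! j)) =
      (\<Sum>u\<leftarrow>?L. \<Sum>v\<leftarrow>?R. weigh ws (F (fst u) (snd u) (fst v) (snd v)))"
    "length (column_sum F cs ds (card_gains ! j)) = length ws"
    using ds by (simp_all add: column_sum_def Let_def weigh_const)
  show "weigh ws (column_sum F cs ds (card_gains ! j)) =
      (\<Sum>a<12. \<Sum>b<12. weigh ws (F (lv cs j a) (lv ds j a) (rv cs j b) (rv ds j b)))"
    unfolding * by (simp only: sum_list_map2[OF lengths(1) lengths(3)[OF j]] fst_conv snd_conv)
  show "length (column_sum F cs ds (card_gains ! j)) = length ws" by (fact *)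
qed

lemma weigh_grid_sum:
  assumes F: "keeps_length (length ws) F"
    and cs: "length cs = length ws" and ds: "length ds = length ws"
  shows "weigh ws (grid_sum F cs ds) = weigh ws (stand_values ds) + (\<Sum>j<8. of_int (banker_weight j) *
      (\<Sum>a<12. \<Sum>b<12. weigh ws (F (lv cs j a) (lv ds j a) (rv cs j b) (rv ds j b))))"
    and "length (grid_sum F cs ds) = length ws"
proof -
  have hd: "hd card_gains = card_gains ! 0" by (simp add: card_gains_def)
  have tl: "tl card_gains = map (\<lambda>i. card_gains ! Suc i) [0..<7]"
    by (simp add: card_gains_def upt_rec)
  have len: "length (column_sum F cs ds gs) = length ws" if "gs \<in> set (tl card_gains)" for gs
    using that unfolding tl by (auto intro!: weigh_column_sum F cs ds)
  have S: "length (stand_values ds) = length ws" by (simp add: stand_values_def ds)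
  have Ft: "weigh ws (foldr (\<lambda>gs acc. vadd (column_sum F cs ds gs) acc) (tl card_gains) (map (\<lambda>_. 0) ds)) =
      (\<Sum>gs\<leftarrow>tl card_gains. weigh ws (column_sum F cs ds gs))"
    "length (foldr (\<lambda>gs acc. vadd (column_sum F cs ds gs) acc) (tl card_gains) (map (\<lambda>_. 0) ds)) = length ws"
    using weigh_foldr[of "tl card_gains" "column_sum F cs ds" ws "map (\<lambda>_. 0) ds"] len ds
    by (auto simp: weigh_const)
  have sum8: "(\<Sum>j<8. f j) = f 0 + (\<Sum>i<7. f (Suc i))" for f :: "nat \<Rightarrow> real"
    using sum.lessThan_Suc_shift[of f 7] by simp
  note C = weigh_column_sum[OF F cs ds]
  have "weigh ws (grid_sum F cs ds) = weigh ws (stand_values ds) + 25 * weigh ws (column_sum F cs ds (card_gains ! 0)) +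
      16 * (\<Sum>gs\<leftarrow>tl card_gains. weigh ws (column_sum F cs ds gs))"
    unfolding grid_sum_def hd using C(2)[of 0] Ft S
    by (simp add: weigh_vadd length_vadd weigh_scale)
  also have "(\<Sum>gs\<leftarrow>tl card_gains. weigh ws (column_sum F cs ds gs)) = (\<Sum>i<7. weigh ws (column_sum F cs ds (card_gains ! Suc i)))"
    unfolding tl by (simp add: sum_list_sum_nth atLeast0LessThan)
  finally show "weigh ws (grid_sum F cs ds) = weigh ws (stand_values ds) + (\<Sum>j<8. of_int (banker_weight j) *
      (\<Sum>a<12. \<Sum>b<12. weigh ws (F (lv cs j a) (lv ds j a) (rv cs j b) (rv ds j b))))"
    unfolding sum8 by (simp add: C banker_weight_def sum_distrib_left)
  show "length (grid_sum F cs ds) = length ws"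
    unfolding grid_sum_def hd using C(2)[of 0] Ft S by (simp add: length_vadd)
qed

definition best_reply :: "(nat \<times> nat \<times> nat) set \<Rightarrow> real \<times> real \<Rightarrow> real \<times> real \<Rightarrow> real \<times> real \<Rightarrow> bool" where
  "best_reply T A X Y \<longleftrightarrow> T \<subseteq> info_sets \<and> (\<forall>k\<in>T. edge k A X Y \<le> 0) \<and> (\<forall>k\<in>info_sets - T. 0 \<le> edge k A X Y)"

text \<open>The certificate behind all numerical claims: at any point in the cell spanned by the first corners, some best
  reply of Banker makes the form at the corresponding point of the second cell positive.  The best reply consists of the
  information sets with negative edge, together with those whose edge is certified nonpositive.\<close>

lemma cell_ok_sound:
  assumes ok: "cell_ok cs ds" and ws: "convex_weights ws"
    and mix: "mixture ws cs s A X Y" "mixture ws ds s' A' X' Y'" and s: "s > 0" "s' > 0"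
  shows "\<exists>T. best_reply T A X Y \<and> 0 < total_form T A' X' Y'"
proof -
  have len: "length cs = length ws" "length ds = length ws" using mix by (auto simp: mixture_def)
  let ?e = "\<lambda>a b j. weigh ws (dots (lv cs j a) (rv cs j b))"
  let ?e' = "\<lambda>a b j. weigh ws (dots (lv ds j a) (rv ds j b))"
  let ?in = "\<lambda>(a, b, j). ?e a b j < 0 \<or> surely_nonpos (lv cs j a) (rv cs j b)"
  let ?B = "\<lambda>a b j. weigh ws (edge_bound (lv cs j a) (lv ds j a) (rv cs j b) (rv ds j b))"
  define T where "T = {k \<in> info_sets. ?in k}"
  have bw: "0 < real_of_int (banker_weight j)" for j by (simp add: banker_weight_def)
  have ll: "length (left_values c w g) = length c" "length (right_values c w g) = length c" for c w g
    by (simp_all add: left_values_def right_values_def)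
  have snd_le: "surely_nonpos (lv cs j a) (rv cs j b) \<Longrightarrow> ?e a b j \<le> 0" for a b j
    by (rule edge_bound_sound(2)[OF ws, where us' = "lv cs j a" and vs' = "rv cs j b"]) (simp_all add: ll len)
  have B: "?B a b j \<le> (if ?in (a, b, j) then ?e' a b j else 0)" for a b j
    using edge_bound_sound(1)[OF ws, of "lv cs j a" "lv ds j a" "rv cs j b" "rv ds j b"] by (simp add: ll len)
  have sgn_edge: "0 \<le> edge (a, b, j) A X Y \<longleftrightarrow> 0 \<le> ?e a b j" "edge (a, b, j) A X Y \<le> 0 \<longleftrightarrow> ?e a b j \<le> 0" for a b j
  proof -
    have "0 \<le> edge (a, b, j) A X Y \<longleftrightarrow> 0 \<le> s * edge (a, b, j) A X Y"
      "edge (a, b, j) A X Y \<le> 0 \<longleftrightarrow> s * edge (a, b, j) A X Y \<le> 0"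
      using s by (auto simp: zero_le_mult_iff mult_le_0_iff)
    then show "0 \<le> edge (a, b, j) A X Y \<longleftrightarrow> 0 \<le> ?e a b j" "edge (a, b, j) A X Y \<le> 0 \<longleftrightarrow> ?e a b j \<le> 0"
      using bw[of j] unfolding edge_mixture[OF mix(1)] by (auto simp: zero_le_mult_iff mult_le_0_iff)
  qed
  have "best_reply T A X Y"
    unfolding best_reply_def T_def using snd_le by (force simp: sgn_edge)
  moreover have "0 < s' * total_form T A' X' Y'"
  proof -
    let ?D = "{..<12::nat} \<times> {..<12::nat} \<times> {..<8::nat}"
    have "keeps_length (length ws) edge_bound"
      using edge_bound_sound(3)[OF ws] by (simp add: keeps_length_def)
    note grid = weigh_grid_sum[OF this len]
    have TD: "T \<subseteq> ?D" by (auto simp: T_def info_sets_def)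
    have "0 < weigh ws (grid_sum edge_bound cs ds)"
      using ok by (intro weigh_pos ws grid(2)) (auto simp: cell_ok_def list_all_iff)
    also have "\<dots> = s' * stand_form A' X' Y' + (\<Sum>(a, b, j)\<in>?D. of_int (banker_weight j) * ?B a b j)"
      unfolding grid(1) stand_mixture[OF mix(2)] sum.cartesian_product[symmetric] sum_distrib_left
      by (intro arg_cong2[where f = "(+)"] refl, rule trans[OF sum.swap], rule sum.cong[OF refl], rule sum.swap)
    also have "(\<Sum>(a, b, j)\<in>?D. of_int (banker_weight j) * ?B a b j) \<le>
        (\<Sum>k\<in>?D. if k \<in> T then s' * edge k A' X' Y' else 0)"
    proof (rule sum_mono, clarify)
      fix a b j :: nat assume D: "a < 12" "b < 12" "j < 8"
      show "of_int (banker_weight j) * ?B a b j \<le> (if (a, b, j) \<in> T then s' * edge (a, b, j) A' X' Y' else 0)"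
      proof (cases "a = 11 \<and> b = 11")
        case True
        have "card_gains ! j ! 11 = (0, 0)" using less_8_cases[OF D(3)] by (auto simp: card_gains_def)
        then have "edge (11, 11, j) A' X' Y' = 0" by (simp add: edge_def lin_def)
        then have "?e' a b j = 0"
          using edge_mixture[OF mix(2), of 11 11 j] bw[of j] True by (simp add: banker_weight_def split: if_splits)
        then have "?B a b j \<le> 0" using B[where a = a and b = b and j = j] by (simp split: if_splits)
        then have "of_int (banker_weight j) * ?B a b j \<le> 0" using bw[of j] by (simp add: mult_le_0_iff)
        moreover have "(a, b, j) \<notin> T" using True by (auto simp: T_def info_sets_def)
        ultimately show ?thesis by simp
      next
        case False
        then have "(a, b, j) \<in> info_sets" using D by (auto simp: info_sets_def)
        then have "(a, b, j) \<in> T \<longleftrightarrow> ?in (a, b, j)" by (simp add: T_def)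
        with B[where a = a and b = b and j = j] mult_left_mono[OF B[where a = a and b = b and j = j] less_imp_le[OF bw[of j]]]
        show ?thesis unfolding edge_mixture[OF mix(2)] by (auto split: if_splits)
      qed
    qed
    also have "\<dots> = (\<Sum>k\<in>T. s' * edge k A' X' Y')"
      using TD by (intro sum.mono_neutral_cong_right) auto
    finally show ?thesis by (simp add: total_form_def distrib_left sum_distrib_left)
  qed
  ultimately show ?thesis using s by (auto simp: zero_less_mult_iff)
qed

section \<open>Optimal mixing probabilities\<close>

definition game :: "(nat \<times> nat \<times> nat) set \<Rightarrow> real \<Rightarrow> real \<Rightarrow> real \<Rightarrow> real" where
  "game T \<theta> x y = total_form T (\<theta>, 1 - \<theta>) (1, x) (1, y)"

definition reply :: "real \<Rightarrow> real \<Rightarrow> real \<Rightarrow> (nat \<times> nat \<times> nat) set \<Rightarrow> bool" where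
  "reply \<theta> x y T \<longleftrightarrow> best_reply T (\<theta>, 1 - \<theta>) (1, x) (1, y)"

definition scaled_payoff :: "real \<Rightarrow> real \<Rightarrow> real \<Rightarrow> real" where
  "scaled_payoff \<theta> x y = 13 ^ 9 * guaranteed_payoff \<theta> (x, y)"

lemma scaled_payoff_le: "T \<subseteq> info_sets \<Longrightarrow> scaled_payoff \<theta> x y \<le> game T \<theta> x y"
  unfolding scaled_payoff_def guaranteed_payoff_def game_def
  using Min_le[of "mixed_payoff \<theta> (x, y) ` Pow info_sets" "mixed_payoff \<theta> (x, y) T"]
  by (simp add: finite_info_sets mixed_payoff_form pos_le_divide_eq mult.commute)

text \<open>The payoff is additive over information sets, so Banker optimizes each of them separately.\<close>

lemma reply_optimal:
  assumes "reply \<theta> x y T" "T' \<subseteq> info_sets"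
  shows "game T \<theta> x y \<le> game T' \<theta> x y"
proof -
  let ?e = "\<lambda>k. edge k (\<theta>, 1 - \<theta>) (1, x) (1, y)"
  have T: "T \<subseteq> info_sets" "\<And>k. k \<in> T \<Longrightarrow> ?e k \<le> 0" "\<And>k. k \<in> info_sets - T \<Longrightarrow> 0 \<le> ?e k"
    using assms(1) by (auto simp: reply_def best_reply_def)
  have fin: "finite T" "finite T'" using T(1) assms(2) finite_info_sets finite_subset by blast+
  have "sum ?e T \<le> sum ?e (T \<inter> T')"
    using fin T(2) sum_nonpos[of "T - T'" ?e] sum.Int_Diff[of T ?e T'] by auto
  also have "\<dots> \<le> sum ?e T'"
    using fin T(3) assms(2) sum_nonneg[of "T' - T" ?e] sum.Int_Diff[of T' ?e T] by (force simp: Int_commute)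
  finally show ?thesis by (simp add: game_def total_form_def)
qed

lemma scaled_payoff_reply: "reply \<theta> x y T \<Longrightarrow> scaled_payoff \<theta> x y = game T \<theta> x y"
proof -
  assume r: "reply \<theta> x y T"
  have T: "T \<subseteq> info_sets" using r by (auto simp: reply_def best_reply_def)
  have "guaranteed_payoff \<theta> (x, y) \<in> mixed_payoff \<theta> (x, y) ` Pow info_sets"
    unfolding guaranteed_payoff_def by (intro Min_in) (auto simp: finite_info_sets)
  then obtain T' where T': "T' \<subseteq> info_sets" "scaled_payoff \<theta> x y = game T' \<theta> x y"
    by (auto simp: scaled_payoff_def game_def mixed_payoff_form)
  show ?thesis
    using scaled_payoff_le[OF T, of \<theta> x y] reply_optimal[OF r T'(1)] T'(2) by linarith
qed

lemma reply_exists: "\<exists>T. reply \<theta> x y T"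
proof
  show "reply \<theta> x y {k \<in> info_sets. edge k (\<theta>, 1 - \<theta>) (1, x) (1, y) \<le> 0}"
    unfolding reply_def best_reply_def by (intro conjI subsetI ballI) (simp_all, linarith)
qed

lemma reply_subset: "reply \<theta> x y T \<Longrightarrow> T \<subseteq> info_sets"
  by (auto simp: reply_def best_reply_def)

definition scaled_lower_value :: "real \<Rightarrow> real" where "scaled_lower_value \<theta> = 13 ^ 9 * lower_value \<theta>"

definition optimal :: "real \<Rightarrow> real \<Rightarrow> real \<Rightarrow> bool" where
  "optimal \<theta> x y \<longleftrightarrow> x \<in> {0..1} \<and> y \<in> {0..1} \<and> scaled_lower_value \<theta> = scaled_payoff \<theta> x y \<and>
     (\<forall>x'\<in>{0..1}. \<forall>y'\<in>{0..1}. scaled_payoff \<theta> x' y' \<le> scaled_payoff \<theta> x y)"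

lemma optimal_exists: "\<exists>x y. optimal \<theta> x y"
  using lower_value_attained[of \<theta>] unfolding optimal_def scaled_lower_value_def scaled_payoff_def by fastforce

lemma scaled_payoff_le_upper: "x \<in> {0..1} \<Longrightarrow> y \<in> {0..1} \<Longrightarrow> scaled_payoff \<theta> x y \<le> scaled_lower_value \<theta>"
  using optimal_exists[of \<theta>] by (auto simp: optimal_def)

lemma edge_linear:
  "edge k (\<theta>, 1 - \<theta>) (1, x) (1, y) = edge k (t, 1 - t) (1, x) (1, y) + (\<theta> - t) * edge k (1, - 1) (1, x) (1, y)"
  "edge k (\<theta>, 1 - \<theta>) (1, x) (1, y) = edge k (\<theta>, 1 - \<theta>) (1, c) (1, y) + (x - c) * edge k (\<theta>, 1 - \<theta>) (0, 1) (1, y)"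
  "edge k (\<theta>, 1 - \<theta>) (1, x) (1, y) = edge k (\<theta>, 1 - \<theta>) (1, x) (1, c) + (y - c) * edge k (\<theta>, 1 - \<theta>) (1, x) (0, 1)"
  by (cases k; simp add: edge_def lin_def algebra_simps)+

lemma game_linear:
  "game T \<theta> x y = game T t x y + (\<theta> - t) * total_form T (1, - 1) (1, x) (1, y)"
  "game T \<theta> x y = game T \<theta> c y + (x - c) * total_form T (\<theta>, 1 - \<theta>) (0, 1) (1, y)"
  "game T \<theta> x y = game T \<theta> x c + (y - c) * total_form T (\<theta>, 1 - \<theta>) (1, x) (0, 1)"
proof -
  have sums: "(\<Sum>k\<in>T. f k + c * g k) = sum f T + c * sum g T" for f g :: "nat \<times> nat \<times> nat \<Rightarrow> real" and c
    by (simp add: sum.distrib sum_distrib_left)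
  show "game T \<theta> x y = game T t x y + (\<theta> - t) * total_form T (1, - 1) (1, x) (1, y)"
    unfolding game_def total_form_def edge_linear(1)[of _ \<theta> x y t] sums
    by (simp add: stand_form_def lin_def algebra_simps)
  show "game T \<theta> x y = game T \<theta> c y + (x - c) * total_form T (\<theta>, 1 - \<theta>) (0, 1) (1, y)"
    unfolding game_def total_form_def edge_linear(2)[of _ \<theta> x y c] sums
    by (simp add: stand_form_def lin_def algebra_simps)
  show "game T \<theta> x y = game T \<theta> x c + (y - c) * total_form T (\<theta>, 1 - \<theta>) (1, x) (0, 1)"
    unfolding game_def total_form_def edge_linear(3)[of _ \<theta> x y c] sums
    by (simp add: stand_form_def lin_def algebra_simps)
qed

lemma total_uminus:
  "total_form T A (0, - 1) Y = - total_form T A (0, 1) Y"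
  "total_form T A X (0, - 1) = - total_form T A X (0, 1)"
proof -
  have "edge k A (0, - 1) Y = - edge k A (0, 1) Y" "edge k A X (0, - 1) = - edge k A X (0, 1)" for k
    by (cases k; simp add: edge_def lin_def algebra_simps)+
  then show "total_form T A (0, - 1) Y = - total_form T A (0, 1) Y" "total_form T A X (0, - 1) = - total_form T A X (0, 1)"
    by (simp_all add: total_form_def stand_form_def lin_def sum_negf)
qed

text \<open>Under a fixed reply of Banker the payoff is affine in \<open>x\<close>.  If it is a best reply at \<open>c\<close> and the slope is positive, every
  point to the left of \<open>c\<close> is worse than \<open>c\<close>, because Banker can use the same reply there.\<close>

lemma optimal_ge_x:
  assumes opt: "optimal \<theta> x y" and r: "reply \<theta> c y T" and c: "c \<in> {0..1}"
    and pos: "0 < total_form T (\<theta>, 1 - \<theta>) (0, 1) (1, y)"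
  shows "c \<le> x"
proof (rule ccontr)
  assume "\<not> c \<le> x"
  then have "game T \<theta> x y < game T \<theta> c y"
    using game_linear(2)[of T \<theta> x y c] pos by (simp add: mult_neg_pos)
  with scaled_payoff_le[OF reply_subset[OF r], of \<theta> x y] scaled_payoff_reply[OF r]
  have "scaled_payoff \<theta> x y < scaled_payoff \<theta> c y" by simp
  with opt c show False by (force simp: optimal_def)
qed

lemma optimal_le_x:
  assumes opt: "optimal \<theta> x y" and r: "reply \<theta> c y T" and c: "c \<in> {0..1}"
    and pos: "0 < total_form T (\<theta>, 1 - \<theta>) (0, - 1) (1, y)"
  shows "x \<le> c"
proof (rule ccontr)
  assume "\<not> x \<le> c"
  then have "game T \<theta> x y < game T \<theta> c y"
    using game_linear(2)[of T \<theta> x y c] pos by (simp add: total_uminus mult_pos_neg)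
  with scaled_payoff_le[OF reply_subset[OF r], of \<theta> x y] scaled_payoff_reply[OF r]
  have "scaled_payoff \<theta> x y < scaled_payoff \<theta> c y" by simp
  with opt c show False by (force simp: optimal_def)
qed

lemma optimal_ge_y:
  assumes opt: "optimal \<theta> x y" and r: "reply \<theta> x c T" and c: "c \<in> {0..1}"
    and pos: "0 < total_form T (\<theta>, 1 - \<theta>) (1, x) (0, 1)"
  shows "c \<le> y"
proof (rule ccontr)
  assume "\<not> c \<le> y"
  then have "game T \<theta> x y < game T \<theta> x c"
    using game_linear(3)[of T \<theta> x y c] pos by (simp add: mult_neg_pos)
  with scaled_payoff_le[OF reply_subset[OF r], of \<theta> x y] scaled_payoff_reply[OF r]
  have "scaled_payoff \<theta> x y < scaled_payoff \<theta> x c" by simp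
  with opt c show False by (force simp: optimal_def)
qed

lemma optimal_le_y:
  assumes opt: "optimal \<theta> x y" and r: "reply \<theta> x c T" and c: "c \<in> {0..1}"
    and pos: "0 < total_form T (\<theta>, 1 - \<theta>) (1, x) (0, - 1)"
  shows "y \<le> c"
proof (rule ccontr)
  assume "\<not> y \<le> c"
  then have "game T \<theta> x y < game T \<theta> x c"
    using game_linear(3)[of T \<theta> x y c] pos by (simp add: total_uminus mult_pos_neg)
  with scaled_payoff_le[OF reply_subset[OF r], of \<theta> x y] scaled_payoff_reply[OF r]
  have "scaled_payoff \<theta> x y < scaled_payoff \<theta> x c" by simp
  with opt c show False by (force simp: optimal_def)
qed

definition slope_positive :: "real \<Rightarrow> real \<Rightarrow> real \<Rightarrow> bool" where
  "slope_positive t x y \<longleftrightarrow> (\<exists>T. reply t x y T \<and> 0 < total_form T (1, - 1) (1, x) (1, y))"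

text \<open>A minimum of functions that are affine in \<open>\<theta>\<close> is concave.\<close>

lemma scaled_payoff_concave:
  assumes "\<theta>1 < \<theta>2" "\<theta>2 \<le> \<theta>3"
  shows "(\<theta>3 - \<theta>2) * scaled_payoff \<theta>1 x y + (\<theta>2 - \<theta>1) * scaled_payoff \<theta>3 x y \<le> (\<theta>3 - \<theta>1) * scaled_payoff \<theta>2 x y"
proof -
  obtain T where T: "reply \<theta>2 x y T" using reply_exists by blast
  note le = scaled_payoff_le[OF reply_subset[OF T]]
  have "(\<theta>3 - \<theta>2) * scaled_payoff \<theta>1 x y + (\<theta>2 - \<theta>1) * scaled_payoff \<theta>3 x y \<le>
      (\<theta>3 - \<theta>2) * game T \<theta>1 x y + (\<theta>2 - \<theta>1) * game T \<theta>3 x y"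
    using assms by (intro add_mono mult_left_mono le) auto
  also have "\<dots> = (\<theta>3 - \<theta>1) * game T \<theta>2 x y"
    unfolding game_linear(1)[of T \<theta>1 x y \<theta>2] game_linear(1)[of T \<theta>3 x y \<theta>2] by (simp add: algebra_simps)
  finally show ?thesis by (simp add: scaled_payoff_reply[OF T])
qed

text \<open>Positivity of the slope is asked only at the right end \<open>t\<close>, at the strategies that are optimal further left:
  concavity carries it back, which makes one check serve for a whole interval of shares.\<close>

lemma scaled_lower_value_strict_mono_slope:
  assumes pos: "\<And>\<theta> x y. s \<le> \<theta> \<Longrightarrow> \<theta> < t \<Longrightarrow> 0 < \<theta> \<Longrightarrow> optimal \<theta> x y \<Longrightarrow> slope_positive t x y"
    and th: "s \<le> \<theta>1" "0 < \<theta>1" "\<theta>1 < \<theta>2" "\<theta>2 \<le> t"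
  shows "scaled_lower_value \<theta>1 < scaled_lower_value \<theta>2"
proof -
  obtain x y where opt: "optimal \<theta>1 x y" using optimal_exists by blast
  then obtain T where T: "reply t x y T" "0 < total_form T (1, - 1) (1, x) (1, y)"
    using pos[of \<theta>1 x y] th by (auto simp: slope_positive_def)
  have "scaled_payoff \<theta>1 x y \<le> game T \<theta>1 x y" by (rule scaled_payoff_le[OF reply_subset[OF T(1)]])
  also have "\<dots> < game T t x y"
    using game_linear(1)[of T \<theta>1 x y t] T(2) th by (simp add: mult_neg_pos)
  also have "\<dots> = scaled_payoff t x y" by (rule scaled_payoff_reply[OF T(1), symmetric])
  finally have lt: "scaled_payoff \<theta>1 x y < scaled_payoff t x y" .
  have "(t - \<theta>2) * scaled_payoff \<theta>1 x y + (\<theta>2 - \<theta>1) * scaled_payoff t x y \<le> (t - \<theta>1) * scaled_payoff \<theta>2 x y"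
    by (rule scaled_payoff_concave) (use th in auto)
  moreover have "(\<theta>2 - \<theta>1) * scaled_payoff \<theta>1 x y < (\<theta>2 - \<theta>1) * scaled_payoff t x y"
    using lt th by simp
  ultimately have "(t - \<theta>1) * scaled_payoff \<theta>1 x y < (t - \<theta>1) * scaled_payoff \<theta>2 x y"
    by (simp add: algebra_simps)
  then have "scaled_payoff \<theta>1 x y < scaled_payoff \<theta>2 x y" using th by simp
  then show ?thesis using opt scaled_payoff_le_upper[of x y \<theta>2] by (auto simp: optimal_def)
qed

definition mix :: "real \<Rightarrow> int \<times> int \<Rightarrow> int \<times> int \<Rightarrow> real \<times> real" where
  "mix r u v = ((1 - r) * of_int (fst u) + r * of_int (fst v), (1 - r) * of_int (snd u) + r * of_int (snd v))"

definition square_weights :: "real \<Rightarrow> real \<Rightarrow> real list" where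
  "square_weights r s = [(1 - r) * (1 - s), (1 - r) * s, r * (1 - s), r * s]"

lemma convex_square_weights:
  assumes "r \<in> {0..1}" "s \<in> {0..1}"
  shows "convex_weights (square_weights r s)"
proof -
  have "sum_list (square_weights r s) = 1" by (simp add: square_weights_def algebra_simps)
  moreover have "\<forall>w\<in>set (square_weights r s). 0 \<le> w" using assms by (auto simp: square_weights_def)
  ultimately show ?thesis by (simp add: convex_weights_def)
qed

lemma lin_mix2: "lin c (mix r u v) = (1 - r) * of_int (ilin c u) + r * of_int (ilin c v)"
  by (simp add: lin_def mix_def ilin_def algebra_simps)

lemma fst_snd_mix:
  "fst (mix r u v) = (1 - r) * of_int (fst u) + r * of_int (fst v)"
  "snd (mix r u v) = (1 - r) * of_int (snd u) + r * of_int (snd v)"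
  by (simp_all add: mix_def)

lemma lin_of_int: "lin c (of_int (fst u), of_int (snd u)) = of_int (ilin c u)"
  by (simp add: lin_def ilin_def)

lemma mixture_XY:
  "mixture (square_weights r s) (corners [A] [X0, X1] [Y0, Y1]) 1
     (of_int (fst A), of_int (snd A)) (mix r X0 X1) (mix s Y0 Y1)"
  unfolding mixture_def lin_mix2 fst_snd_mix lin_of_int square_weights_def corners_def
  by (simp add: distrib_left distrib_right mult_ac)

lemma mixture_AY:
  "mixture (square_weights r s) (corners [A0, A1] [X] [Y0, Y1]) 1
     (mix r A0 A1) (of_int (fst X), of_int (snd X)) (mix s Y0 Y1)"
  unfolding mixture_def lin_mix2 fst_snd_mix lin_of_int square_weights_def corners_def
  by (simp add: distrib_left distrib_right mult_ac)

lemma mixture_AX: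
  "mixture (square_weights r s) (corners [A0, A1] [X0, X1] [Y]) 1
     (mix r A0 A1) (mix s X0 X1) (of_int (fst Y), of_int (snd Y))"
  unfolding mixture_def lin_mix2 fst_snd_mix lin_of_int square_weights_def corners_def
  by (simp add: distrib_left distrib_right mult_ac)

section \<open>Certificates that confine an optimum or give a slope\<close>

lemma mixture_scale:
  assumes "mixture ws cs 1 (c * fst A, c * snd A) (d * fst X, d * snd X) (e * fst Y, e * snd Y)"
  shows "mixture ws cs (c * d * e) A X Y"
proof -
  have l: "lin p (d * fst X, d * snd X) = d * lin p X" "lin p (e * fst Y, e * snd Y) = e * lin p Y" for p
    by (simp_all add: lin_def algebra_simps)
  show ?thesis using assms unfolding mixture_def l fst_conv snd_conv
    by (simp add: mult_ac)
qed

lemma convex_parameter: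
  fixes a b z :: real
  assumes "a < b" "a \<le> z" "z \<le> b"
  shows "\<exists>r\<in>{0..1}. z = (1 - r) * a + r * b"
proof (rule bexI)
  have "(z - a) / (b - a) * (b - a) = z - a" using assms by simp
  then show "z = (1 - (z - a) / (b - a)) * a + (z - a) / (b - a) * b" by (simp only: left_diff_distrib right_diff_distrib)
  show "(z - a) / (b - a) \<in> {0..1}" using assms by (simp add: divide_le_eq)
qed

lemma mix_interval:
  assumes "a < b" "0 < d" "x \<in> {of_int a / of_int d..of_int b / of_int d}"
  shows "\<exists>r\<in>{0..1}. mix r (d, a) (d, b) = (of_int d * fst (1::real, x), of_int d * snd (1::real, x))"
proof -
  have "real_of_int a < of_int b" "of_int a \<le> of_int d * x" "of_int d * x \<le> of_int b"
    using assms by (auto simp: field_simps)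
  from convex_parameter[OF this] obtain r where "r \<in> {0..1}" "of_int d * x = (1 - r) * of_int a + r * of_int b" by blast
  then show ?thesis by (intro bexI[of _ r]) (simp_all add: mix_def, simp add: algebra_simps)
qed

lemma mix_theta:
  assumes "a < b" "0 < c" "\<theta> \<in> {of_int a / of_int c..of_int b / of_int c}"
  shows "\<exists>r\<in>{0..1}. mix r (a, c - a) (b, c - b) = (of_int c * fst (\<theta>, 1 - \<theta>), of_int c * snd (\<theta>, 1 - \<theta>))"
proof -
  have "real_of_int a < of_int b" "of_int a \<le> of_int c * \<theta>" "of_int c * \<theta> \<le> of_int b"
    using assms by (auto simp: field_simps)
  from convex_parameter[OF this] obtain r where "r \<in> {0..1}" "of_int c * \<theta> = (1 - r) * of_int a + r * of_int b" by blast
  then show ?thesis by (intro bexI[of _ r]) (simp_all add: mix_def, simp add: algebra_simps)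
qed

type_synonym interval = "int \<times> int \<times> int"

text \<open>A triple \<open>(a, b, d)\<close> denotes the interval from \<open>a/d\<close> to \<open>b/d\<close>; its ends are the homogeneous integer
  points \<open>(d, a)\<close> and \<open>(d, b)\<close>.\<close>

definition in_interval :: "real \<Rightarrow> interval \<Rightarrow> bool" where
  "in_interval x = (\<lambda>(a, b, d). a < b \<and> 0 < d \<and> x \<in> {of_int a / of_int d..of_int b / of_int d})"

definition ends :: "interval \<Rightarrow> (int \<times> int) list" where
  "ends = (\<lambda>(a, b, d). [(d, a), (d, b)])"

definition share_ends :: "interval \<Rightarrow> (int \<times> int) list" where
  "share_ends = (\<lambda>(a, b, c). [(a, c - a), (b, c - b)])"

text \<open>The first corners carry the point itself, the second ones the direction: \<open>(1, -1)\<close> for a derivative in \<open>\<theta>\<close>, and below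
  \<open>(0, \<sigma>)\<close> for a derivative in a mixing probability towards the side \<open>\<sigma>\<close>.\<close>

definition slope_check :: "int \<times> int \<Rightarrow> interval \<Rightarrow> interval \<Rightarrow> bool" where
  "slope_check = (\<lambda>(n, c) I J. cell_ok (corners [(n, c - n)] (ends I) (ends J)) (corners [(1, - 1)] (ends I) (ends J)))"

definition x_check :: "int \<Rightarrow> int \<times> int \<Rightarrow> interval \<Rightarrow> interval \<Rightarrow> bool" where
  "x_check \<sigma> = (\<lambda>(p, d) I J. cell_ok (corners (share_ends I) [(d, p)] (ends J)) (corners (share_ends I) [(0, \<sigma>)] (ends J)))"

definition y_check :: "int \<Rightarrow> int \<times> int \<Rightarrow> interval \<Rightarrow> interval \<Rightarrow> bool" where
  "y_check \<sigma> = (\<lambda>(p, d) I J. cell_ok (corners (share_ends I) (ends J) [(d, p)]) (corners (share_ends I) (ends J) [(0, \<sigma>)]))"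

lemma slope_check_sound:
  assumes ok: "slope_check (n, c) I J" and c: "0 < c" and I: "in_interval x I" and J: "in_interval y J"
  shows "slope_positive (of_int n / of_int c) x y"
proof -
  obtain a b d f g e where IJ: "I = (a, b, d)" "J = (f, g, e)" by (cases I; cases J)
  let ?t = "real_of_int n / of_int c"
  have pos: "0 < real_of_int c" "0 < real_of_int d" "0 < real_of_int e"
    using c I J by (auto simp: IJ in_interval_def)
  obtain r where r: "r \<in> {0..1}" "mix r (d, a) (d, b) = (of_int d * fst (1::real, x), of_int d * snd (1::real, x))"
    using mix_interval[of a b d x] I by (auto simp: IJ in_interval_def)
  obtain s where s: "s \<in> {0..1}" "mix s (e, f) (e, g) = (of_int e * fst (1::real, y), of_int e * snd (1::real, y))"
    using mix_interval[of f g e y] J by (auto simp: IJ in_interval_def)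
  have A: "(real_of_int (fst (n, c - n)), real_of_int (snd (n, c - n))) =
      (of_int c * fst (?t, 1 - ?t), of_int c * snd (?t, 1 - ?t))"
    using pos by (simp add: field_simps)
  have m1: "mixture (square_weights r s) (corners [(n, c - n)] (ends I) (ends J))
      (of_int c * of_int d * of_int e) (?t, 1 - ?t) (1, x) (1, y)"
    using mixture_XY[of r s "(n, c - n)" "(d, a)" "(d, b)" "(e, f)" "(e, g)"]
    unfolding A r s IJ ends_def prod.case by (rule mixture_scale[where c = "of_int c" and A = "(?t, 1 - ?t)" and d = "of_int d" and X = "(1, x)" and e = "of_int e" and Y = "(1, y)"])
  have B: "(real_of_int (fst (1::int, -1::int)), real_of_int (snd (1::int, -1::int))) =
      (1 * fst (1::real, -1::real), 1 * snd (1::real, -1::real))" by simp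
  have m2: "mixture (square_weights r s) (corners [(1, - 1)] (ends I) (ends J))
      (1 * of_int d * of_int e) (1, - 1) (1, x) (1, y)"
    using mixture_XY[of r s "(1, - 1)" "(d, a)" "(d, b)" "(e, f)" "(e, g)"]
    unfolding B r s IJ ends_def prod.case by (rule mixture_scale[where c = "1" and A = "(1, - 1)" and d = "of_int d" and X = "(1, x)" and e = "of_int e" and Y = "(1, y)"])
  have "\<exists>T. best_reply T (?t, 1 - ?t) (1, x) (1, y) \<and> 0 < total_form T (1, - 1) (1, x) (1, y)"
    using ok pos by (intro cell_ok_sound[OF _ convex_square_weights[OF r(1) s(1)] m1 m2])
      (auto simp: slope_check_def)
  then show ?thesis by (simp add: slope_positive_def reply_def)
qed

lemma x_check_sound:
  assumes ok: "x_check \<sigma> (p, d) I J" and d: "0 < d" and I: "in_interval \<theta> I" and J: "in_interval y J"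
  shows "\<exists>T. reply \<theta> (of_int p / of_int d) y T \<and> 0 < total_form T (\<theta>, 1 - \<theta>) (0, of_int \<sigma>) (1, y)"
proof -
  obtain a b c f g e where IJ: "I = (a, b, c)" "J = (f, g, e)" by (cases I; cases J)
  let ?x = "real_of_int p / of_int d"
  have pos: "0 < real_of_int c" "0 < real_of_int d" "0 < real_of_int e"
    using d I J by (auto simp: IJ in_interval_def)
  obtain r where r: "r \<in> {0..1}" "mix r (a, c - a) (b, c - b) = (of_int c * fst (\<theta>, 1 - \<theta>), of_int c * snd (\<theta>, 1 - \<theta>))"
    using mix_theta[of a b c \<theta>] I by (auto simp: IJ in_interval_def)
  obtain s where s: "s \<in> {0..1}" "mix s (e, f) (e, g) = (of_int e * fst (1::real, y), of_int e * snd (1::real, y))"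
    using mix_interval[of f g e y] J by (auto simp: IJ in_interval_def)
  have X: "(real_of_int (fst (d, p)), real_of_int (snd (d, p))) = (of_int d * fst (1::real, ?x), of_int d * snd (1::real, ?x))"
    using pos by simp
  have m1: "mixture (square_weights r s) (corners (share_ends I) [(d, p)] (ends J))
      (of_int c * of_int d * of_int e) (\<theta>, 1 - \<theta>) (1, ?x) (1, y)"
    using mixture_AY[of r s "(a, c - a)" "(b, c - b)" "(d, p)" "(e, f)" "(e, g)"]
    unfolding X r s IJ ends_def share_ends_def prod.case by (rule mixture_scale[where c = "of_int c" and A = "(\<theta>, 1 - \<theta>)" and d = "of_int d" and X = "(1, ?x)" and e = "of_int e" and Y = "(1, y)"])
  have B: "(real_of_int (fst (0::int, \<sigma>)), real_of_int (snd (0::int, \<sigma>))) =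
      (1 * fst (0::real, real_of_int \<sigma>), 1 * snd (0::real, real_of_int \<sigma>))" by simp
  have m2: "mixture (square_weights r s) (corners (share_ends I) [(0, \<sigma>)] (ends J))
      (of_int c * 1 * of_int e) (\<theta>, 1 - \<theta>) (0, of_int \<sigma>) (1, y)"
    using mixture_AY[of r s "(a, c - a)" "(b, c - b)" "(0, \<sigma>)" "(e, f)" "(e, g)"]
    unfolding B r s IJ ends_def share_ends_def prod.case by (rule mixture_scale[where c = "of_int c" and A = "(\<theta>, 1 - \<theta>)" and d = "1" and X = "(0, of_int \<sigma>)" and e = "of_int e" and Y = "(1, y)"])
  show ?thesis unfolding reply_def
    using ok pos by (intro cell_ok_sound[OF _ convex_square_weights[OF r(1) s(1)] m1 m2])
      (auto simp: x_check_def)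
qed

lemma y_check_sound:
  assumes ok: "y_check \<sigma> (p, d) I J" and d: "0 < d" and I: "in_interval \<theta> I" and J: "in_interval x J"
  shows "\<exists>T. reply \<theta> x (of_int p / of_int d) T \<and> 0 < total_form T (\<theta>, 1 - \<theta>) (1, x) (0, of_int \<sigma>)"
proof -
  obtain a b c f g e where IJ: "I = (a, b, c)" "J = (f, g, e)" by (cases I; cases J)
  let ?y = "real_of_int p / of_int d"
  have pos: "0 < real_of_int c" "0 < real_of_int d" "0 < real_of_int e"
    using d I J by (auto simp: IJ in_interval_def)
  obtain r where r: "r \<in> {0..1}" "mix r (a, c - a) (b, c - b) = (of_int c * fst (\<theta>, 1 - \<theta>), of_int c * snd (\<theta>, 1 - \<theta>))"
    using mix_theta[of a b c \<theta>] I by (auto simp: IJ in_interval_def)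
  obtain s where s: "s \<in> {0..1}" "mix s (e, f) (e, g) = (of_int e * fst (1::real, x), of_int e * snd (1::real, x))"
    using mix_interval[of f g e x] J by (auto simp: IJ in_interval_def)
  have Y: "(real_of_int (fst (d, p)), real_of_int (snd (d, p))) = (of_int d * fst (1::real, ?y), of_int d * snd (1::real, ?y))"
    using pos by simp
  have m1: "mixture (square_weights r s) (corners (share_ends I) (ends J) [(d, p)])
      (of_int c * of_int e * of_int d) (\<theta>, 1 - \<theta>) (1, x) (1, ?y)"
    using mixture_AX[of r s "(a, c - a)" "(b, c - b)" "(e, f)" "(e, g)" "(d, p)"]
    unfolding Y r s IJ ends_def share_ends_def prod.case by (rule mixture_scale[where c = "of_int c" and A = "(\<theta>, 1 - \<theta>)" and d = "of_int e" and X = "(1, x)" and e = "of_int d" and Y = "(1, ?y)"])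
  have B: "(real_of_int (fst (0::int, \<sigma>)), real_of_int (snd (0::int, \<sigma>))) =
      (1 * fst (0::real, real_of_int \<sigma>), 1 * snd (0::real, real_of_int \<sigma>))" by simp
  have m2: "mixture (square_weights r s) (corners (share_ends I) (ends J) [(0, \<sigma>)])
      (of_int c * of_int e * 1) (\<theta>, 1 - \<theta>) (1, x) (0, of_int \<sigma>)"
    using mixture_AX[of r s "(a, c - a)" "(b, c - b)" "(e, f)" "(e, g)" "(0, \<sigma>)"]
    unfolding B r s IJ ends_def share_ends_def prod.case by (rule mixture_scale[where c = "of_int c" and A = "(\<theta>, 1 - \<theta>)" and d = "of_int e" and X = "(1, x)" and e = "1" and Y = "(0, of_int \<sigma>)"])
  show ?thesis unfolding reply_def
    using ok pos by (intro cell_ok_sound[OF _ convex_square_weights[OF r(1) s(1)] m1 m2])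
      (auto simp: y_check_def)
qed

lemma x_check_ge:
  assumes "x_check 1 (p, d) I J" "0 < d" "0 \<le> p" "p \<le> d" "optimal \<theta> x y" "in_interval \<theta> I" "in_interval y J"
  shows "of_int p / of_int d \<le> x"
proof -
  obtain T where "reply \<theta> (of_int p / of_int d) y T" "0 < total_form T (\<theta>, 1 - \<theta>) (0, 1) (1, y)"
    using x_check_sound[OF assms(1,2,6,7)] by auto
  then show ?thesis using assms by (intro optimal_ge_x) auto
qed

lemma x_check_le:
  assumes "x_check (- 1) (p, d) I J" "0 < d" "0 \<le> p" "p \<le> d" "optimal \<theta> x y" "in_interval \<theta> I" "in_interval y J"
  shows "x \<le> of_int p / of_int d"
proof -
  obtain T where "reply \<theta> (of_int p / of_int d) y T" "0 < total_form T (\<theta>, 1 - \<theta>) (0, - 1) (1, y)"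
    using x_check_sound[OF assms(1,2,6,7)] by auto
  then show ?thesis using assms by (intro optimal_le_x) auto
qed

lemma y_check_ge:
  assumes "y_check 1 (p, d) I J" "0 < d" "0 \<le> p" "p \<le> d" "optimal \<theta> x y" "in_interval \<theta> I" "in_interval x J"
  shows "of_int p / of_int d \<le> y"
proof -
  obtain T where "reply \<theta> x (of_int p / of_int d) T" "0 < total_form T (\<theta>, 1 - \<theta>) (1, x) (0, 1)"
    using y_check_sound[OF assms(1,2,6,7)] by auto
  then show ?thesis using assms by (intro optimal_ge_y) auto
qed

lemma y_check_le:
  assumes "y_check (- 1) (p, d) I J" "0 < d" "0 \<le> p" "p \<le> d" "optimal \<theta> x y" "in_interval \<theta> I" "in_interval x J"
  shows "y \<le> of_int p / of_int d"
proof -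
  obtain T where "reply \<theta> x (of_int p / of_int d) T" "0 < total_form T (\<theta>, 1 - \<theta>) (1, x) (0, - 1)"
    using y_check_sound[OF assms(1,2,6,7)] by auto
  then show ?thesis using assms by (intro optimal_le_y) auto
qed

section \<open>Numerical certificates\<close>

lemmas check_defs = x_check_def y_check_def slope_check_def share_ends_def ends_def prod.case

text \<open>The rectangles shrink in stages, because a bound on one variable is certified on the range that is known for
  the other.  Ranges are cut wherever a single cell leaves too many signs undecided.\<close>

lemma x_ge_3_10a: "x_check 1 (3, 10) (8, 9, 20) (0, 1, 1)"
  unfolding check_defs by code_simp
lemma x_ge_3_10b: "x_check 1 (3, 10) (9, 10, 20) (0, 1, 1)"
  unfolding check_defs by code_simp
lemma x_le_9_11: "x_check (- 1) (9, 11) (4, 5, 10) (0, 1, 1)"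
  unfolding check_defs by code_simp
lemma y_ge_18_25: "y_check 1 (18, 25) (4, 5, 10) (33, 90, 110)"
  unfolding check_defs by code_simp
lemma y_le_9_11: "y_check (- 1) (9, 11) (4, 5, 10) (33, 90, 110)"
  unfolding check_defs by code_simp
lemma x_ge_3_5a: "x_check 1 (3, 5) (8, 9, 20) (198, 225, 275)"
  unfolding check_defs by code_simp
lemma x_ge_3_5b: "x_check 1 (3, 5) (9, 10, 20) (198, 225, 275)"
  unfolding check_defs by code_simp
lemma y_ge_3_4: "y_check 1 (3, 4) (4, 5, 10) (33, 45, 55)"
  unfolding check_defs by code_simp
lemma x_ge_10_13: "x_check 1 (10, 13) (8, 9, 18) (33, 36, 44)"
  unfolding check_defs by code_simp
lemma x_le_4_5: "x_check (- 1) (4, 5) (8, 9, 18) (33, 36, 44)"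
  unfolding check_defs by code_simp
lemma y_ge_11_14: "y_check 1 (11, 14) (8, 9, 18) (50, 52, 65)"
  unfolding check_defs by code_simp
lemma x_ge_11_14: "x_check 1 (11, 14) (49, 50, 100) (121, 126, 154)"
  unfolding check_defs by code_simp
lemma x_le_19_24: "x_check (- 1) (19, 24) (49, 50, 100) (121, 126, 154)"
  unfolding check_defs by code_simp
lemma slope_low_a: "slope_check (2, 5) (0, 1, 1) (0, 1, 2)"
  unfolding check_defs by code_simp
lemma slope_low_b: "slope_check (2, 5) (0, 1, 2) (1, 2, 2)"
  unfolding check_defs by code_simp
lemma slope_low_c: "slope_check (2, 5) (2, 3, 4) (1, 2, 2)"
  unfolding check_defs by code_simp
lemma slope_low_d: "slope_check (2, 5) (3, 4, 4) (1, 2, 2)"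
  unfolding check_defs by code_simp
lemma slope_mid_a: "slope_check (4, 9) (6, 7, 10) (33, 36, 44)"
  unfolding check_defs by code_simp
lemma slope_mid_b: "slope_check (4, 9) (28, 29, 40) (33, 36, 44)"
  unfolding check_defs by code_simp
lemma slope_mid_c: "slope_check (4, 9) (29, 30, 40) (33, 36, 44)"
  unfolding check_defs by code_simp
lemma slope_mid_d: "slope_check (4, 9) (33, 36, 44) (33, 36, 44)"
  unfolding check_defs by code_simp
lemma slope_high: "slope_check (49, 100) (50, 52, 65) (121, 126, 154)"
  unfolding check_defs by code_simp

section \<open>Growth up to a share of 49/100\<close>

text \<open>Each bound uses the preceding ones: first a rough interval for \<open>x\<close>, then one for \<open>y\<close>, then better ones for both.\<close>

lemma optimal_box1:
  assumes opt: "optimal \<theta> x y" and th: "\<theta> \<in> {2/5..1/2}"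
  shows "x \<in> {3/5..9/11}" "y \<in> {3/4..9/11}"
proof -
  have xy: "x \<in> {0..1}" "y \<in> {0..1}" using opt by (auto simp: optimal_def)
  have th_cases: "in_interval \<theta> (8, 9, 20) \<or> in_interval \<theta> (9, 10, 20)" and T: "in_interval \<theta> (4, 5, 10)"
    using th by (auto simp: in_interval_def)
  have Y: "in_interval y (0, 1, 1)" using xy by (auto simp: in_interval_def)
  have "3/10 \<le> x"
    using th_cases x_check_ge[OF x_ge_3_10a _ _ _ opt _ Y] x_check_ge[OF x_ge_3_10b _ _ _ opt _ Y] by auto
  moreover have x9: "x \<le> 9/11" using x_check_le[OF x_le_9_11 _ _ _ opt T Y] by simp
  ultimately have X: "in_interval x (33, 90, 110)" by (auto simp: in_interval_def)
  have "18/25 \<le> y" using y_check_ge[OF y_ge_18_25 _ _ _ opt T X] by simp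
  moreover have y9: "y \<le> 9/11" using y_check_le[OF y_le_9_11 _ _ _ opt T X] by simp
  ultimately have Y: "in_interval y (198, 225, 275)" by (auto simp: in_interval_def)
  have "3/5 \<le> x"
    using th_cases x_check_ge[OF x_ge_3_5a _ _ _ opt _ Y] x_check_ge[OF x_ge_3_5b _ _ _ opt _ Y] by auto
  with x9 show "x \<in> {3/5..9/11}" by simp
  then have X: "in_interval x (33, 45, 55)" by (auto simp: in_interval_def)
  have "3/4 \<le> y" using y_check_ge[OF y_ge_3_4 _ _ _ opt T X] by simp
  with y9 show "y \<in> {3/4..9/11}" by simp
qed

lemma optimal_box2:
  assumes opt: "optimal \<theta> x y" and th: "\<theta> \<in> {4/9..1/2}"
  shows "x \<in> {10/13..4/5}" "y \<in> {11/14..9/11}"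
proof -
  have y: "y \<in> {3/4..9/11}" using optimal_box1[OF opt] th by simp
  then have Y: "in_interval y (33, 36, 44)" by (auto simp: in_interval_def)
  have T: "in_interval \<theta> (8, 9, 18)" using th by (auto simp: in_interval_def)
  show x: "x \<in> {10/13..4/5}"
    using x_check_ge[OF x_ge_10_13 _ _ _ opt T Y] x_check_le[OF x_le_4_5 _ _ _ opt T Y] by simp
  then have X: "in_interval x (50, 52, 65)" by (auto simp: in_interval_def)
  show "y \<in> {11/14..9/11}"
    using y_check_ge[OF y_ge_11_14 _ _ _ opt T X] y by simp
qed

lemma optimal_box3:
  assumes opt: "optimal \<theta> x y" and th: "\<theta> \<in> {49/100..1/2}"
  shows "x \<in> {11/14..19/24}" "y \<in> {11/14..9/11}"
proof -
  have xy: "x \<in> {10/13..4/5}" "y \<in> {11/14..9/11}" using optimal_box2[OF opt] th by simp_all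
  have T: "in_interval \<theta> (49, 50, 100)" and Y: "in_interval y (121, 126, 154)"
    using th xy by (auto simp: in_interval_def)
  show "x \<in> {11/14..19/24}" using x_check_ge[OF x_ge_11_14 _ _ _ opt T Y] x_check_le[OF x_le_19_24 _ _ _ opt T Y] by simp
  show "y \<in> {11/14..9/11}" by (fact xy)
qed

lemma scaled_lower_value_less_piece1:
  assumes "0 < \<theta>1" "\<theta>1 < \<theta>2" "\<theta>2 \<le> 2/5"
  shows "scaled_lower_value \<theta>1 < scaled_lower_value \<theta>2"
proof (rule scaled_lower_value_strict_mono_slope[where s = 0 and t = "2/5"])
  fix \<theta> x y assume "optimal \<theta> x y"
  then have xy: "x \<in> {0..1}" "y \<in> {0..1}" by (auto simp: optimal_def)
  have "y \<le> 1/2 \<or> 1/2 \<le> y \<and> (x \<le> 1/2 \<or> 1/2 \<le> x \<and> x \<le> 3/4 \<or> 3/4 \<le> x)" by linarith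
  then consider "in_interval y (0, 1, 2)" | "in_interval y (1, 2, 2)" "in_interval x (0, 1, 2)"
    | "in_interval y (1, 2, 2)" "in_interval x (2, 3, 4)" | "in_interval y (1, 2, 2)" "in_interval x (3, 4, 4)"
    using xy by (auto simp: in_interval_def)
  then show "slope_positive (2/5) x y"
  proof cases
    case 1
    have "in_interval x (0, 1, 1)" using xy by (simp add: in_interval_def)
    from slope_check_sound[OF slope_low_a _ this 1] show ?thesis by simp
  next
    case 2 then show ?thesis using slope_check_sound[OF slope_low_b _ 2(2,1)] by simp
  next
    case 3 then show ?thesis using slope_check_sound[OF slope_low_c _ 3(2,1)] by simp
  next
    case 4 then show ?thesis using slope_check_sound[OF slope_low_d _ 4(2,1)] by simp
  qed
qed (use assms in auto)

lemma scaled_lower_value_less_piece2: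
  assumes "2/5 \<le> \<theta>1" "\<theta>1 < \<theta>2" "\<theta>2 \<le> 4/9"
  shows "scaled_lower_value \<theta>1 < scaled_lower_value \<theta>2"
proof (rule scaled_lower_value_strict_mono_slope[where s = "2/5" and t = "4/9"])
  fix \<theta> x y :: real assume "2/5 \<le> \<theta>" "\<theta> < 4/9" "optimal \<theta> x y"
  then have xy: "x \<in> {3/5..9/11}" "y \<in> {3/4..9/11}" using optimal_box1 by auto
  have Y: "in_interval y (33, 36, 44)" using xy by (auto simp: in_interval_def)
  have "x \<le> 7/10 \<or> 7/10 \<le> x \<and> x \<le> 29/40 \<or> 29/40 \<le> x \<and> x \<le> 3/4 \<or> 3/4 \<le> x" by linarith
  then consider "in_interval x (6, 7, 10)" | "in_interval x (28, 29, 40)" | "in_interval x (29, 30, 40)" | "in_interval x (33, 36, 44)"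
    using xy by (auto simp: in_interval_def)
  then show "slope_positive (4/9) x y"
  proof cases
    case 1 from slope_check_sound[OF slope_mid_a _ this Y] show ?thesis by simp
  next
    case 2 from slope_check_sound[OF slope_mid_b _ this Y] show ?thesis by simp
  next
    case 3 from slope_check_sound[OF slope_mid_c _ this Y] show ?thesis by simp
  next
    case 4 from slope_check_sound[OF slope_mid_d _ this Y] show ?thesis by simp
  qed
qed (use assms in auto)

lemma scaled_lower_value_less_piece3:
  assumes "4/9 \<le> \<theta>1" "\<theta>1 < \<theta>2" "\<theta>2 \<le> 49/100"
  shows "scaled_lower_value \<theta>1 < scaled_lower_value \<theta>2"
proof (rule scaled_lower_value_strict_mono_slope[where s = "4/9" and t = "49/100"])
  fix \<theta> x y :: real assume "4/9 \<le> \<theta>" "\<theta> < 49/100" "optimal \<theta> x y"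
  then have xy: "x \<in> {10/13..4/5}" "y \<in> {11/14..9/11}" using optimal_box2 by auto
  have "in_interval x (50, 52, 65)" "in_interval y (121, 126, 154)" using xy by (auto simp: in_interval_def)
  from slope_check_sound[OF slope_high _ this] show "slope_positive (49/100) x y" by simp
qed (use assms in auto)

lemma scaled_lower_value_less:
  assumes "0 < \<theta>1" "\<theta>1 < \<theta>2" "\<theta>2 \<le> 49/100"
  shows "scaled_lower_value \<theta>1 < scaled_lower_value \<theta>2"
proof -
  have A: "scaled_lower_value a < scaled_lower_value b" if "4/9 > a" "0 < a" "a < b" "b \<le> 4/9" for a b
    using scaled_lower_value_less_piece1[of a b] scaled_lower_value_less_piece2[of a b] scaled_lower_value_less_piece1[of a "2/5"] scaled_lower_value_less_piece2[of "2/5" b] that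
    by (smt (verit))
  show ?thesis
    using A[of \<theta>1 \<theta>2] scaled_lower_value_less_piece3[of \<theta>1 \<theta>2] A[of \<theta>1 "4/9"] scaled_lower_value_less_piece3[of "4/9" \<theta>2] assms
    by (smt (verit))
qed

section \<open>The five undecided information sets\<close>

definition basis :: "(int \<times> int) list" where "basis = [(1, 0), (0, 1)]"

text \<open>The eight products, in the order in which \<open>corners\<close> lists the corners; for the coordinates themselves as weights
  they express a trilinear form by its values on the coordinate vectors.\<close>

definition cube_weights :: "real \<times> real \<Rightarrow> real \<times> real \<Rightarrow> real \<times> real \<Rightarrow> real list" where
  "cube_weights A X Y =
     [fst A * fst X * fst Y, fst A * fst X * snd Y, fst A * snd X * fst Y, fst A * snd X * snd Y,
      snd A * fst X * fst Y, snd A * fst X * snd Y, snd A * snd X * fst Y, snd A * snd X * snd Y]"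

lemma mixture_basis: "mixture (cube_weights A X Y) (corners basis basis basis) 1 A X Y"
  unfolding mixture_def cube_weights_def corners_def basis_def
  by (simp add: lin_def ilin_def distrib_left distrib_right mult_ac)

lemma mixture_box:
  "mixture (cube_weights (1 - r, r) (1 - s, s) (1 - t, t)) (corners [A0, A1] [X0, X1] [Y0, Y1]) 1
     (mix r A0 A1) (mix s X0 X1) (mix t Y0 Y1)"
  unfolding mixture_def lin_mix2 fst_snd_mix cube_weights_def corners_def
  by (simp add: distrib_left distrib_right mult_ac)

lemma convex_cube_weights:
  assumes "r \<in> {0..1}" "s \<in> {0..1}" "t \<in> {0..1}"
  shows "convex_weights (cube_weights (1 - r, r) (1 - s, s) (1 - t, t))"
proof -
  have "sum_list (cube_weights (1 - r, r) (1 - s, s) (1 - t, t)) = 1" by (simp add: cube_weights_def algebra_simps)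
  moreover have "\<forall>w\<in>set (cube_weights (1 - r, r) (1 - s, s) (1 - t, t)). 0 \<le> w" using assms by (auto simp: cube_weights_def)
  ultimately show ?thesis by (simp add: convex_weights_def)
qed

text \<open>The contribution of an information set whose edge is certified nonpositive, which Banker surely uses; all other
  information sets contribute nothing here.\<close>

definition definite_part where
  "definite_part us us' vs vs' = (if surely_nonpos us vs then dots us' vs' else map (\<lambda>_. 0) us')"

definition decided :: "corner list \<Rightarrow> (nat \<times> nat \<times> nat) list \<Rightarrow> bool" where
  "decided cs ks \<longleftrightarrow> list_all (\<lambda>j.
     let rights = map (\<lambda>b. (b, rv cs j b)) [0..<12]
     in list_all (\<lambda>a. let us = lv cs j a in
          list_all (\<lambda>(b, vs). if List.member ks (a, b, j) then \<not> surely_nonpos us vs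
             else surely_nonpos us vs \<or> surely_nonneg us vs) rights) [0..<12]) [0..<8]"

definition box_corners :: "corner list" where
  "box_corners = corners (share_ends (49, 50, 100)) (ends (132, 133, 168)) (ends (121, 126, 154))"

definition undecided :: "(nat \<times> nat \<times> nat) list" where
  "undecided = [(2, 5, 5), (5, 2, 5), (6, 10, 6), (9, 3, 4), (10, 6, 6)]"

text \<open>On the box all but five edges have a constant sign.\<close>

lemma decided_box: "decided box_corners undecided"
  unfolding box_corners_def basis_def share_ends_def ends_def prod.case by code_simp

lemma definite_box: "grid_sum definite_part box_corners (corners basis basis basis) =
    [-94522528, -10015232, 13120624, 45056, -94522528, 13120624, -10015232, 45056]"
  unfolding box_corners_def basis_def share_ends_def ends_def prod.case by code_simp

definition cell_edge :: "nat \<times> nat \<times> nat \<Rightarrow> real \<Rightarrow> real \<Rightarrow> real \<Rightarrow> real" where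
  "cell_edge k \<theta> x y = edge k (\<theta>, 1 - \<theta>) (1, x) (1, y)"

text \<open>Banker draws exactly where this lowers the payoff.\<close>

lemma scaled_payoff_min: "scaled_payoff \<theta> x y = stand_form (\<theta>, 1 - \<theta>) (1, x) (1, y) + (\<Sum>k\<in>info_sets. min 0 (cell_edge k \<theta> x y))"
proof -
  let ?T = "{k \<in> info_sets. cell_edge k \<theta> x y \<le> 0}"
  have "reply \<theta> x y ?T"
    unfolding reply_def best_reply_def cell_edge_def by (intro conjI subsetI ballI) (simp_all, linarith)
  then have "scaled_payoff \<theta> x y = stand_form (\<theta>, 1 - \<theta>) (1, x) (1, y) + (\<Sum>k\<in>?T. cell_edge k \<theta> x y)"
    by (simp add: scaled_payoff_reply game_def total_form_def cell_edge_def)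
  also have "(\<Sum>k\<in>?T. cell_edge k \<theta> x y) = (\<Sum>k\<in>info_sets. min 0 (cell_edge k \<theta> x y))"
    by (intro sum.mono_neutral_cong_left) (auto simp: finite_info_sets min_def)
  finally show ?thesis .
qed

lemma keeps_length_definite: "keeps_length n definite_part"
  by (auto simp: keeps_length_def definite_part_def dots_def)

text \<open>The edges with a certified sign contribute fully or not at all, so their sum is one trilinear form, which is
  evaluated by its eight coefficients; the undecided ones remain as minima.\<close>

lemma scaled_payoff_box:
  assumes K: "\<theta> \<in> {49/100..1/2}" "x \<in> {11/14..19/24}" "y \<in> {11/14..9/11}"
  shows "scaled_payoff \<theta> x y =
    weigh (cube_weights (\<theta>, 1 - \<theta>) (1, x) (1, y)) (grid_sum definite_part box_corners (corners basis basis basis)) +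
    (\<Sum>k\<in>set undecided. min 0 (cell_edge k \<theta> x y))"
proof -
  let ?A = "(\<theta>, 1 - \<theta>)" and ?X = "(1::real, x)" and ?Y = "(1::real, y)"
  let ?ws = "cube_weights ?A ?X ?Y" and ?B = "corners basis basis basis" and ?cs = box_corners
  let ?e = "\<lambda>k. cell_edge k \<theta> x y"
  let ?D = "{..<12::nat} \<times> {..<12::nat} \<times> {..<8::nat}"
  let ?neg = "\<lambda>(a, b, j). surely_nonpos (lv ?cs j a) (rv ?cs j b)"
  let ?pos = "\<lambda>(a, b, j). surely_nonneg (lv ?cs j a) (rv ?cs j b)"
  obtain r where r: "r \<in> {0..1}" "mix r (49, 51) (50, 50) = (100 * fst ?A, 100 * snd ?A)"
    using mix_theta[of 49 50 100 \<theta>] K(1) by auto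
  obtain s where s: "s \<in> {0..1}" "mix s (168, 132) (168, 133) = (168 * fst ?X, 168 * snd ?X)"
    using mix_interval[of 132 133 168 x] K(2) by auto
  obtain t where t: "t \<in> {0..1}" "mix t (154, 121) (154, 126) = (154 * fst ?Y, 154 * snd ?Y)"
    using mix_interval[of 121 126 154 y] K(3) by auto
  let ?vs = "cube_weights (1 - r, r) (1 - s, s) (1 - t, t)"
  have vs: "convex_weights ?vs" by (rule convex_cube_weights) fact+
  have "mixture ?vs ?cs 1 (mix r (49, 51) (50, 50)) (mix s (168, 132) (168, 133)) (mix t (154, 121) (154, 126))"
    using mixture_box[of r s t] by (simp add: box_corners_def share_ends_def ends_def)
  then have m: "mixture ?vs ?cs (100 * 168 * 154) ?A ?X ?Y"
    unfolding r s t by (rule mixture_scale)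
  have len: "length ?cs = 8" "length ?B = 8" "length ?ws = 8" "length ?vs = 8"
    by (simp_all add: box_corners_def corners_def share_ends_def ends_def basis_def cube_weights_def)
  have sgn: "?neg k \<Longrightarrow> ?e k \<le> 0" "?pos k \<Longrightarrow> 0 \<le> ?e k" for k
  proof -
    obtain a b j where k: "k = (a, b, j)" by (cases k)
    have l: "length (dots (lv ?cs j a) (rv ?cs j b)) = length ?vs"
      by (simp add: dots_def left_values_def right_values_def len)
    have bw: "0 < real_of_int (banker_weight j)" by (simp add: banker_weight_def)
    have e: "(100 * 168 * 154) * ?e k = of_int (banker_weight j) * weigh ?vs (dots (lv ?cs j a) (rv ?cs j b))"
      unfolding k cell_edge_def by (rule edge_mixture[OF m])
    show "?e k \<le> 0" if "?neg k"
    proof -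
      have "weigh ?vs (dots (lv ?cs j a) (rv ?cs j b)) \<le> 0"
        using that surely_nonposD by (intro weigh_nonpos vs l) (auto simp: k)
      then have "(100 * 168 * 154) * ?e k \<le> 0" unfolding e using bw by (simp add: mult_le_0_iff)
      then show ?thesis by simp
    qed
    show "0 \<le> ?e k" if "?pos k"
    proof -
      have "0 \<le> weigh ?vs (dots (lv ?cs j a) (rv ?cs j b))"
        using that surely_nonnegD by (intro weigh_nonneg vs l) (auto simp: k)
      then have "0 \<le> (100 * 168 * 154) * ?e k" unfolding e using bw by simp
      then show ?thesis by simp
    qed
  qed
  have dec: "if k \<in> set undecided then \<not> ?neg k else ?neg k \<or> ?pos k" if "k \<in> ?D" for k
  proof -
    obtain a b j where k: "k = (a, b, j)" "a < 12" "b < 12" "j < 8" using \<open>k \<in> ?D\<close> by (cases k) auto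
    have "list_all (\<lambda>j. list_all (\<lambda>a. list_all (\<lambda>(b, vs). if List.member undecided (a, b, j) then \<not> surely_nonpos (lv ?cs j a) vs
         else surely_nonpos (lv ?cs j a) vs \<or> surely_nonneg (lv ?cs j a) vs) (map (\<lambda>b. (b, rv ?cs j b)) [0..<12])) [0..<12]) [0..<8]"
      using decided_box unfolding decided_def Let_def .
    then show ?thesis using k by (auto simp: list_all_iff split: if_splits)
  qed
  have natural: "?e (11, 11, j) = 0" if "j < 8" for j
  proof -
    have "card_gains ! j ! 11 = (0, 0)" using less_8_cases[OF that] by (auto simp: card_gains_def)
    then show ?thesis by (simp add: cell_edge_def edge_def lin_def)
  qed
  have sub: "set undecided \<subseteq> ?D" "info_sets \<subseteq> ?D" by (auto simp: undecided_def info_sets_def)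
  have "(\<Sum>k\<in>info_sets. min 0 (?e k)) = (\<Sum>k\<in>?D. min 0 (?e k))"
    using sub(2) natural by (intro sum.mono_neutral_left) (auto simp: info_sets_def)
  also have "\<dots> = (\<Sum>k\<in>?D. (if ?neg k then ?e k else 0) + (if k \<in> set undecided then min 0 (?e k) else 0))"
  proof (rule sum.cong[OF refl])
    fix k assume "k \<in> ?D"
    from dec[OF this] sgn[of k]
    show "min 0 (?e k) = (if ?neg k then ?e k else 0) + (if k \<in> set undecided then min 0 (?e k) else 0)"
      by (auto simp: min_def split: if_splits)
  qed
  also have "\<dots> = (\<Sum>k\<in>?D. if ?neg k then ?e k else 0) + (\<Sum>k\<in>set undecided. min 0 (?e k))"
  proof -
    have "(\<Sum>k\<in>?D. if k \<in> set undecided then min 0 (?e k) else 0) = (\<Sum>k\<in>set undecided. min 0 (?e k))"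
      using sub(1) by (intro sum.mono_neutral_cong_right) auto
    then show ?thesis by (simp only: sum.distrib)
  qed
  also have "(\<Sum>k\<in>?D. if ?neg k then ?e k else 0) =
      (\<Sum>(a, b, j)\<in>?D. of_int (banker_weight j) * weigh ?ws (definite_part (lv ?cs j a) (lv ?B j a) (rv ?cs j b) (rv ?B j b)))"
  proof (rule sum.cong[OF refl])
    fix k assume "k \<in> ?D"
    obtain a b j where k: "k = (a, b, j)" by (cases k)
    have "length (lv ?B j a) = length ?ws" by (simp add: left_values_def len)
    then show "(if ?neg k then ?e k else 0) = (case k of (a, b, j) \<Rightarrow>
        of_int (banker_weight j) * weigh ?ws (definite_part (lv ?cs j a) (lv ?B j a) (rv ?cs j b) (rv ?B j b)))"
      using edge_mixture[OF mixture_basis, where A = ?A and X = ?X and Y = ?Y and a = a and b = b and j = j]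
      by (simp add: k definite_part_def weigh_const cell_edge_def)
  qed
  also have "\<dots> = weigh ?ws (grid_sum definite_part ?cs ?B) - stand_form ?A ?X ?Y"
  proof -
    have "weigh ?ws (stand_values ?B) = stand_form ?A ?X ?Y"
      using stand_mixture[OF mixture_basis, where A = ?A and X = ?X and Y = ?Y] by simp
    moreover have "(\<Sum>(a, b, j)\<in>?D. of_int (banker_weight j) * weigh ?ws (definite_part (lv ?cs j a) (lv ?B j a) (rv ?cs j b) (rv ?B j b))) =
      (\<Sum>j<8. of_int (banker_weight j) * (\<Sum>a<12. \<Sum>b<12. weigh ?ws (definite_part (lv ?cs j a) (lv ?B j a) (rv ?cs j b) (rv ?B j b))))"
      unfolding sum.cartesian_product[symmetric] sum_distrib_left
      by (rule sym, rule trans[OF sum.swap], rule sum.cong[OF refl], rule sum.swap)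
    ultimately show ?thesis
      using weigh_grid_sum(1)[OF keeps_length_definite, where cs = ?cs and ds = ?B and ws = ?ws] len by simp
  qed
  finally show ?thesis unfolding scaled_payoff_min by simp
qed

section \<open>The ridge\<close>

text \<open>Positivity at the corners suffices for multi-affine forms; the next two lemmas iterate this.\<close>

lemma affine_pos:
  fixes t :: real
  assumes "t \<in> {t0..t1}" "0 < p + q * t0" "0 < p + q * t1"
  shows "0 < p + q * t"
proof (cases "0 \<le> q")
  case True
  then have "q * t0 \<le> q * t" using assms(1) by (simp add: mult_left_mono)
  with assms(2) show ?thesis by linarith
next
  case False
  then have "q * t1 \<le> q * t" using assms(1) by (simp add: mult_left_mono_neg)
  with assms(3) show ?thesis by linarith
qed

lemma bilinear_pos:
  fixes t z :: real
  assumes t: "t \<in> {t0..t1}" and z: "z \<in> {z0..z1}"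
    and c: "0 < a + b * t0 + c * z0 + d * (t0 * z0)" "0 < a + b * t0 + c * z1 + d * (t0 * z1)"
      "0 < a + b * t1 + c * z0 + d * (t1 * z0)" "0 < a + b * t1 + c * z1 + d * (t1 * z1)"
  shows "0 < a + b * t + c * z + d * (t * z)"
proof -
  have e: "0 < (a + c * z') + (b + d * z') * t" if "z' \<in> {z0, z1}" for z'
    by (rule affine_pos[OF t]) (use c that in \<open>auto simp: algebra_simps\<close>)
  from e[of z0] e[of z1] have "0 < (a + b * t) + (c + d * t) * z"
    using affine_pos[OF z, of "a + b * t" "c + d * t"] by (simp add: algebra_simps)
  then show ?thesis by (simp add: algebra_simps)
qed

lemma trilinear_pos:
  fixes t x z :: real
  assumes t: "t \<in> {t0..t1}" and x: "x \<in> {x0..x1}" and z: "z \<in> {z0..z1}"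
    and c: "\<forall>t\<in>{t0, t1}. \<forall>x\<in>{x0, x1}. \<forall>z\<in>{z0, z1}.
      0 < a + b * t + c * x + d * z + e * (t * x) + f * (t * z) + g * (x * z) + k * (t * x * z)"
  shows "0 < a + b * t + c * x + d * z + e * (t * x) + f * (t * z) + g * (x * z) + k * (t * x * z)"
proof -
  have "0 < (a + c * x0) + (b + e * x0) * t + (d + g * x0) * z + (f + k * x0) * (t * z)"
    "0 < (a + c * x1) + (b + e * x1) * t + (d + g * x1) * z + (f + k * x1) * (t * z)"
    by (rule bilinear_pos[OF t z]; use c in \<open>simp add: algebra_simps\<close>)+
  note 1 = this
  have "0 < (a + b * t + d * z + f * (t * z)) + (c + e * t + g * z + k * (t * z)) * x"
    by (rule affine_pos[OF x]) (use 1 in \<open>simp_all add: algebra_simps\<close>)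
  then show ?thesis by (simp add: algebra_simps)
qed

text \<open>A sixteenth of the scaled payoff from all information sets with decided sign, the definite draws included.  The next five forms are the undecided
  edges in the same unit, named by the cards that Banker sees.\<close>

definition fixed_part :: "real \<Rightarrow> real \<Rightarrow> real \<Rightarrow> real" where
  "fixed_part \<theta> x y = - 5907658 + \<theta> * (820039 * x - 625952 * y) + (1 - \<theta>) * (820039 * y - 625952 * x) + 2816 * x * y"

definition edge_2_5 :: "real \<Rightarrow> real \<Rightarrow> real \<Rightarrow> real" where
  "edge_2_5 \<theta> x y = \<theta> * (285 - 80 * x) * (89 + 16 * y) - (1 - \<theta>) * (89 + 16 * x) * (231 - 16 * y)"

definition edge_5_2 :: "real \<Rightarrow> real \<Rightarrow> real \<Rightarrow> real" where
  "edge_5_2 \<theta> x y = (1 - \<theta>) * (89 + 16 * x) * (285 - 80 * y) - \<theta> * (231 - 16 * x) * (89 + 16 * y)"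

definition edge_6_stand :: "real \<Rightarrow> real \<Rightarrow> real \<Rightarrow> real" where
  "edge_6_stand \<theta> x y = 208 * ((1 - \<theta>) * (89 + 16 * x) * (9 - 11 * y) - \<theta> * (53 - 48 * x) * (3 - y))"

definition edge_9_3 :: "real \<Rightarrow> real \<Rightarrow> real \<Rightarrow> real" where
  "edge_9_3 \<theta> x y = \<theta> * (231 - 16 * x) * (89 + 16 * y) - (1 - \<theta>) * (89 + 16 * x) * (177 + 48 * y)"

definition edge_stand_6 :: "real \<Rightarrow> real \<Rightarrow> real \<Rightarrow> real" where
  "edge_stand_6 \<theta> x y = 208 * (\<theta> * (9 - 11 * x) * (89 + 16 * y) - (1 - \<theta>) * (3 - x) * (53 - 48 * y))"

definition box_payoff :: "real \<Rightarrow> real \<Rightarrow> real \<Rightarrow> real" where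
  "box_payoff \<theta> x y = fixed_part \<theta> x y + min 0 (edge_2_5 \<theta> x y) + min 0 (edge_5_2 \<theta> x y) + min 0 (edge_6_stand \<theta> x y) +
     min 0 (edge_9_3 \<theta> x y) + min 0 (edge_stand_6 \<theta> x y)"

abbreviation "Th \<equiv> {49/100..1/2::real}"
abbreviation "Xs \<equiv> {11/14..19/24::real}"
abbreviation "Ys \<equiv> {11/14..9/11::real}"

text \<open>All forms are affine in each variable, so a shift changes each by an exact multiple of the shift.\<close>

lemma shift_x:
  "fixed_part \<theta> (x + e) y = fixed_part \<theta> x y + e * (820039 * \<theta> - 625952 * (1 - \<theta>) + 2816 * y)"
  "edge_2_5 \<theta> (x + e) y = edge_2_5 \<theta> x y - e * (3696 + 3424 * \<theta> + - 256 * y + 1536 * (\<theta> * y))"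
  "edge_5_2 \<theta> (x + e) y = edge_5_2 \<theta> x y + e * (4560 + - 3136 * \<theta> + - 1280 * y + 1536 * (\<theta> * y))"
  "edge_6_stand \<theta> (x + e) y = edge_6_stand \<theta> x y + e * (208 * (16 * (1 - \<theta>) * (9 - 11 * y) + 48 * \<theta> * (3 - y)))"
  "edge_9_3 \<theta> (x + e) y = edge_9_3 \<theta> x y - e * (2832 + - 1408 * \<theta> + 768 * y + - 512 * (\<theta> * y))"
  "edge_stand_6 \<theta> (x + e) y = edge_stand_6 \<theta> x y - e * (- 11024 + 214656 * \<theta> + 9984 * y + 26624 * (\<theta> * y))"
  by (simp_all add: fixed_part_def edge_2_5_def edge_5_2_def edge_6_stand_def edge_9_3_def edge_stand_6_def algebra_simps)

lemma shift_y:
  "fixed_part \<theta> x (y + e) = fixed_part \<theta> x y + e * (- 625952 * \<theta> + 820039 * (1 - \<theta>) + 2816 * x)"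
  "edge_2_5 \<theta> x (y + e) = edge_2_5 \<theta> x y + e * (16 * \<theta> * (285 - 80 * x) + 16 * (1 - \<theta>) * (89 + 16 * x))"
  "edge_5_2 \<theta> x (y + e) = edge_5_2 \<theta> x y - e * (7120 + - 3424 * \<theta> + 1280 * x + - 1536 * (\<theta> * x))"
  "edge_6_stand \<theta> x (y + e) = edge_6_stand \<theta> x y - e * (203632 + - 214656 * \<theta> + 36608 * x + - 26624 * (\<theta> * x))"
  "edge_9_3 \<theta> x (y + e) = edge_9_3 \<theta> x y - e * (4272 + - 7968 * \<theta> + 768 * x + - 512 * (\<theta> * x))"
  "edge_stand_6 \<theta> x (y + e) = edge_stand_6 \<theta> x y + e * (208 * (16 * \<theta> * (9 - 11 * x) + 48 * (1 - \<theta>) * (3 - x)))"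
  by (simp_all add: fixed_part_def edge_2_5_def edge_5_2_def edge_6_stand_def edge_9_3_def edge_stand_6_def algebra_simps)

text \<open>If the edge at (stand, 6) is not zero, move \<open>x\<close> until it is.  If it was positive, this increases \<open>x\<close>, and the
  fixed part then gains more than the edges that fall with \<open>x\<close> can lose.  If it was negative, this decreases \<open>x\<close>, and the removal of the negative edge
  outweighs all losses.\<close>

lemma optimum_on_ridge:
  assumes th: "\<theta> \<in> Th" and x: "x \<in> Xs" and y: "y \<in> Ys"
    and opt: "\<And>x'. x' \<in> Xs \<Longrightarrow> box_payoff \<theta> x' y \<le> box_payoff \<theta> x y"
  shows "edge_stand_6 \<theta> x y = 0"
proof -
  define s1 s2 s3 s4 s5 sr where "s1 = 3696 + 3424 * \<theta> + - 256 * y + 1536 * (\<theta> * y)"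
    and "s2 = 4560 + - 3136 * \<theta> + - 1280 * y + 1536 * (\<theta> * y)"
    and "s3 = 208 * (16 * (1 - \<theta>) * (9 - 11 * y) + 48 * \<theta> * (3 - y))"
    and "s4 = 2832 + - 1408 * \<theta> + 768 * y + - 512 * (\<theta> * y)"
    and "s5 = - 11024 + 214656 * \<theta> + 9984 * y + 26624 * (\<theta> * y)"
    and "sr = 820039 * \<theta> - 625952 * (1 - \<theta>) + 2816 * y"
  note s_defs = s1_def s2_def s3_def s4_def s5_def sr_def
  have pos: "0 < s1" "0 < s2" "0 < s4" "0 < s5"
    unfolding s_defs by (rule bilinear_pos[OF th y]; simp)+
  have "0 \<le> s3" using th y by (simp add: s3_def)
  have up: "0 < sr - s1 - s4"
  proof -
    have "0 < - 632480 + 1443975 * \<theta> + 2304 * y + - 1024 * (\<theta> * y)"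
      by (rule bilinear_pos[OF th y]) simp_all
    then show ?thesis by (simp add: s_defs algebra_simps)
  qed
  have down: "0 < s5 - sr - s2 - s3"
  proof -
    have "0 < 580416 + - 1228199 * \<theta> + 45056 * y + - 1536 * (\<theta> * y)"
      by (rule bilinear_pos[OF th y]) simp_all
    then show ?thesis by (simp add: s_defs algebra_simps)
  qed
  note sh = shift_x[of \<theta> x _ y, folded s1_def s2_def s3_def s4_def s5_def sr_def]
  show ?thesis
  proof (rule ccontr)
    assume "edge_stand_6 \<theta> x y \<noteq> 0"
    define e where "e = edge_stand_6 \<theta> x y / s5"
    have e: "e * s5 = edge_stand_6 \<theta> x y" using pos by (simp add: e_def)
    have zero: "edge_stand_6 \<theta> (x + e) y = 0" using sh(6)[of e] e by simp
    have hi: "0 < - edge_stand_6 \<theta> (19/24) y"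
    proof -
      have "0 < 73034/3 + - 29744 * \<theta> + - 22048 * y + 63232/3 * (\<theta> * y)"
        by (rule bilinear_pos[OF th y]) simp_all
      then show ?thesis by (simp add: edge_stand_6_def algebra_simps)
    qed
    have lo: "0 < edge_stand_6 \<theta> (11/14) y"
    proof -
      have "0 < - 170872/7 + 217152/7 * \<theta> + 154752/7 * y + - 146432/7 * (\<theta> * y)"
        by (rule bilinear_pos[OF th y]) simp_all
      then show ?thesis by (simp add: edge_stand_6_def algebra_simps)
    qed
    have "(19/24 - (x + e)) * s5 > 0" "(x + e - 11/14) * s5 > 0"
      using sh(6)[of "19/24 - x"] sh(6)[of "11/14 - x"] hi lo e by (simp_all add: algebra_simps)
    then have "x + e \<in> Xs" using pos by (simp add: zero_less_mult_iff)
    then have le: "box_payoff \<theta> (x + e) y \<le> box_payoff \<theta> x y" by (rule opt)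
    show False
    proof (cases "0 < e")
      case True
      have "0 < e * (sr - s1 - s4)" "0 \<le> e * s2" "0 \<le> e * s3" "0 \<le> e * s1" "0 \<le> e * s4"
        using True up pos \<open>0 \<le> s3\<close> by simp_all
      moreover have "0 < edge_stand_6 \<theta> x y" using True e pos by (metis mult_pos_pos)
      ultimately show False using le zero sh(1-5)[of e]
        unfolding box_payoff_def by (simp add: algebra_simps)
    next
      case False
      then have e0: "e < 0" using \<open>edge_stand_6 \<theta> x y \<noteq> 0\<close> e by (cases "e = 0") auto
      have "0 < - e * (s5 - sr - s2 - s3)" "e * s2 \<le> 0" "e * s3 \<le> 0" "e * s1 \<le> 0" "e * s4 \<le> 0"
        using e0 down pos \<open>0 \<le> s3\<close> by (simp_all add: mult_less_0_iff mult_le_0_iff)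
      moreover have "edge_stand_6 \<theta> x y < 0" using e0 e pos by (metis mult_neg_pos)
      ultimately show False using le zero sh(1-5)[of e] e
        unfolding box_payoff_def by (simp add: algebra_simps)
    qed
  qed
qed

text \<open>As long as this edge is positive, increasing \<open>y\<close> costs nothing there and the fixed part gains more than the
  other edges can lose.\<close>

lemma optimum_edge_6_stand:
  assumes th: "\<theta> \<in> Th" and x: "x \<in> Xs" and y: "y \<in> Ys"
    and opt: "\<And>y'. y' \<in> Ys \<Longrightarrow> box_payoff \<theta> x y' \<le> box_payoff \<theta> x y"
  shows "edge_6_stand \<theta> x y \<le> 0"
proof (rule ccontr)
  assume edge_6_stand: "\<not> edge_6_stand \<theta> x y \<le> 0"
  define s1 s2 s3 s4 s5 sr where "s1 = 16 * \<theta> * (285 - 80 * x) + 16 * (1 - \<theta>) * (89 + 16 * x)"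
    and "s2 = 7120 + - 3424 * \<theta> + 1280 * x + - 1536 * (\<theta> * x)"
    and "s3 = 203632 + - 214656 * \<theta> + 36608 * x + - 26624 * (\<theta> * x)"
    and "s4 = 4272 + - 7968 * \<theta> + 768 * x + - 512 * (\<theta> * x)"
    and "s5 = 208 * (16 * \<theta> * (9 - 11 * x) + 48 * (1 - \<theta>) * (3 - x))"
    and "sr = - 625952 * \<theta> + 820039 * (1 - \<theta>) + 2816 * x"
  note s_defs = s1_def s2_def s3_def s4_def s5_def sr_def
  note sh = shift_y[of \<theta> x y, folded s1_def s2_def s3_def s4_def s5_def sr_def]
  have pos: "0 < s2" "0 < s3" "0 < s4"
    unfolding s_defs by (rule bilinear_pos[OF th x]; simp)+
  have nn: "0 \<le> s1" "0 \<le> s5" using th x by (simp_all add: s_defs)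
  have up: "0 < sr - s2 - s4"
  proof -
    have "0 < 808647 + - 1434599 * \<theta> + 768 * x + 2048 * (\<theta> * x)"
      by (rule bilinear_pos[OF th x]) simp_all
    then show ?thesis by (simp add: s_defs algebra_simps)
  qed
  define e where "e = edge_6_stand \<theta> x y / s3"
  have e: "e * s3 = edge_6_stand \<theta> x y" "0 < e" using pos edge_6_stand by (simp_all add: e_def)
  have zero: "edge_6_stand \<theta> x (y + e) = 0" using sh(4)[of e] e by simp
  have "edge_6_stand \<theta> x (9/11) < 0"
    using th x by (simp add: edge_6_stand_def)
  then have "(9/11 - (y + e)) * s3 > 0"
    using sh(4)[of "9/11 - y"] e by (simp add: algebra_simps)
  then have "y + e \<in> Ys" using pos y e by (simp add: zero_less_mult_iff)
  then have le: "box_payoff \<theta> x (y + e) \<le> box_payoff \<theta> x y" by (rule opt)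
  have "0 < e * (sr - s2 - s4)" "0 \<le> e * s2" "0 \<le> e * s1" "0 \<le> e * s4" "0 \<le> e * s5"
    using e up pos nn by simp_all
  then show False using le zero edge_6_stand sh(1-3,5,6)[of e]
    unfolding box_payoff_def by (simp add: algebra_simps)
qed

definition ridge_a :: "real \<Rightarrow> real \<Rightarrow> real" where "ridge_a x y = (3 - x) * (53 - 48 * y)"
definition ridge_b :: "real \<Rightarrow> real \<Rightarrow> real" where "ridge_b x y = (9 - 11 * x) * (89 + 16 * y)"
text \<open>The share for which \<open>(x, y)\<close> lies on the ridge: the edge at (stand, 6) is affine in the share and vanishes when the two
  Players' parts balance.\<close>

definition ridge_share :: "real \<Rightarrow> real \<Rightarrow> real" where "ridge_share x y = ridge_a x y / (ridge_a x y + ridge_b x y)"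

lemma ridge_ab_pos: "x \<in> Xs \<Longrightarrow> y \<in> Ys \<Longrightarrow> 0 < ridge_a x y \<and> 0 < ridge_b x y"
  by (simp add: ridge_a_def ridge_b_def)

lemma ridge_iff:
  assumes "x \<in> Xs" "y \<in> Ys"
  shows "edge_stand_6 \<theta> x y = 0 \<longleftrightarrow> \<theta> = ridge_share x y"
proof -
  have "edge_stand_6 \<theta> x y = 208 * (\<theta> * (ridge_a x y + ridge_b x y) - ridge_a x y)"
    by (simp add: edge_stand_6_def ridge_a_def ridge_b_def algebra_simps)
  then show ?thesis using ridge_ab_pos[OF assms] by (auto simp: ridge_share_def field_simps)
qed

text \<open>On the ridge a multiple of \<open>edge_stand_6\<close> may be added; with the factor 50 for the other edge, the combination is positive on
  the whole box.\<close>

lemma edge_5_2_ridge: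
  assumes th: "\<theta> \<in> Th" and x: "x \<in> Xs" and y: "y \<in> Ys" and r: "edge_stand_6 \<theta> x y = 0"
  shows "0 < edge_5_2 \<theta> x y"
proof -
  have "0 < 50 * edge_5_2 \<theta> x y + edge_stand_6 \<theta> x y"
  proof -
    have "0 < 1235178 + - 2096520 * \<theta> + 239024 * x + - 326048 * y + - 371456 * (\<theta> * x) + 171200 * (\<theta> * y) + - 73984 * (x * y) + 50176 * (\<theta> * x * y)"
      by (rule trilinear_pos[OF th x y]) simp
    then show ?thesis by (simp add: edge_5_2_def edge_stand_6_def algebra_simps)
  qed
  with r show ?thesis by simp
qed

section \<open>The kink curve on the ridge\<close>

text \<open>Horner evaluation with interval bounds: on \<open>{0..b}\<close> a negative tail is worst at \<open>b\<close> and a positive tail at 0.\<close>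

definition lower_bound :: "real list \<Rightarrow> real \<Rightarrow> real" where
  "lower_bound cs b = foldr (\<lambda>c l. c + min 0 (b * l)) cs 0"

lemma lower_bound: "z \<in> {0..b} \<Longrightarrow> lower_bound cs b \<le> poly (Poly cs) z"
proof (induction cs)
  case (Cons c cs)
  let ?l = "lower_bound cs b"
  have "min 0 (b * ?l) \<le> z * ?l"
    using Cons.prems by (cases "0 \<le> ?l") (auto simp: min_def mult_right_mono mult_right_mono_neg not_le intro: order_trans[OF _ mult_right_mono_neg])
  also have "\<dots> \<le> z * poly (Poly cs) z" using Cons by (intro mult_left_mono) auto
  finally show ?case by (simp add: lower_bound_def)
qed (simp add: lower_bound_def)

lemma poly_Poly_pos: "0 < lower_bound cs b \<Longrightarrow> z \<in> {0..b} \<Longrightarrow> 0 < poly (Poly cs) z"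
  using lower_bound[of z b cs] by linarith

lemma ratio_deriv:
  fixes p q :: "real poly"
  assumes "poly q z \<noteq> 0"
  shows "((\<lambda>z. poly p z / poly q z) has_real_derivative poly (pderiv p * q - p * pderiv q) z / (poly q z)\<^sup>2) (at z)"
  using assms by (auto intro!: derivative_eq_intros simp: power2_eq_square)

text \<open>The numerator of the derivative of a quotient of polynomials decides about its monotonicity.\<close>

lemma ratio_less:
  fixes p q :: "real poly"
  assumes "a < b" "\<And>z. z \<in> {a..b} \<Longrightarrow> 0 < poly q z"
    and "\<And>z. z \<in> {a<..<b} \<Longrightarrow> 0 < poly (pderiv p * q - p * pderiv q) z"
  shows "poly p a / poly q a < poly p b / poly q b"
proof -
  have nz: "poly q z \<noteq> 0" if "z \<in> {a..b}" for z using assms(2)[OF that] by simp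
  have c: "continuous_on {a..b} (\<lambda>z. poly p z / poly q z)"
    using nz by (intro continuous_intros) auto
  have d: "\<exists>D. ((\<lambda>z. poly p z / poly q z) has_real_derivative D) (at z) \<and> 0 < D" if "a < z" "z < b" for z
  proof (intro exI conjI)
    have z: "z \<in> {a..b}" "z \<in> {a<..<b}" using that by auto
    show "((\<lambda>z. poly p z / poly q z) has_real_derivative poly (pderiv p * q - p * pderiv q) z / (poly q z)\<^sup>2) (at z)"
      by (rule ratio_deriv[OF nz[OF z(1)]])
    show "0 < poly (pderiv p * q - p * pderiv q) z / (poly q z)\<^sup>2"
      using assms(3)[OF z(2)] nz[OF z(1)] by simp
  qed
  show ?thesis
    by (rule DERIV_pos_imp_increasing_open[of a b "\<lambda>z. poly p z / poly q z", OF assms(1) d c])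
qed

text \<open>The parameter of the kink curve is \<open>x\<close> itself, in units of \<open>1/10000\<close> from 0.787 on; this makes the relevant range
  \<open>{0..42}\<close> and keeps the coefficients integral.\<close>

definition kink_x :: "real \<Rightarrow> real" where "kink_x z = (7870 + z) / 10000"

text \<open>The rational functions below result from solving the vanishing of \<open>edge_9_3\<close> on the ridge, which is affine in
  \<open>y\<close>, and from substituting the solution into \<open>ridge_share\<close> and into the payoff; \<open>ridge_9_3_zero\<close>, \<open>ridge_share_kink\<close> and
  \<open>base_payoff_kink\<close> establish this.\<close>

definition value_num :: "real poly" where "value_num = Poly [- 3644034075490163271326664075000, 1225232238830346134976512500, - 72432621193612634486250, - 2035535053325467125, - 8051031485600, 30211779]"
definition value_den :: "real poly" where "value_den = Poly [633421770815534600000000, - 212901173514680000000, 9713291754000000, 257952800000, 1360000]"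
text \<open>The numerator of the derivative of \<open>kink_value\<close>.\<close>

definition value_wronskian :: "real poly" where "value_wronskian = Poly [269643380862093930850978995873689961500000000000, - 20969666089030639942473934566329123400000000000, 2471861575799415599043692122322130000000000, 234056180742069328068471668098000000000, - 848589788008330766123918250000000, 14884201353816004654920000000, 1571909029427066708000000, 15586425972062400000, 41088019440000]"
definition share_num :: "real poly" where "share_num = Poly [96954960150, - 2854185, - 69]"
definition share_den :: "real poly" where "share_den = Poly [195582431600, - 14185640, - 136]"
definition y_num :: "real poly" where "y_num = Poly [1519461250, 1432625, 25]"
definition y_den :: "real poly" where "y_den = Poly [1943186100, - 512190, - 6]"

lemma denominators_pos:
  assumes "z \<in> {0..42}"
  shows "0 < poly value_den z" "0 < poly share_den z" "0 < poly y_den z"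
  unfolding value_den_def share_den_def y_den_def
  by (rule poly_Poly_pos[OF _ assms], simp add: lower_bound_def min_def)+

lemma value_wronskian: "pderiv value_num * value_den - value_num * pderiv value_den = value_wronskian"
  by (simp add: value_num_def value_den_def value_wronskian_def pderiv_pCons)

definition kink_value :: "real \<Rightarrow> real" where "kink_value z = poly value_num z / poly value_den z"
definition kink_share :: "real \<Rightarrow> real" where "kink_share z = poly share_num z / poly share_den z"
definition kink_y :: "real \<Rightarrow> real" where "kink_y z = poly y_num z / poly y_den z"

lemma kink_share_less: "0 \<le> a \<Longrightarrow> a < b \<Longrightarrow> b \<le> 42 \<Longrightarrow> kink_share a < kink_share b"
proof -
  assume ab: "0 \<le> a" "a < b" "b \<le> 42"
  have k: "pderiv share_num * share_den - share_num * pderiv share_den = Poly [817139718366000000, - 618626400000, 590640000]"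
    by (simp add: share_num_def share_den_def pderiv_pCons)
  have "0 < poly (pderiv share_num * share_den - share_num * pderiv share_den) z" if "z \<in> {0..42}" for z
    unfolding k by (rule poly_Poly_pos[OF _ that]) (simp add: lower_bound_def min_def)
  then show ?thesis unfolding kink_share_def using ab by (intro ratio_less denominators_pos) auto
qed

lemma kink_y_less: "0 \<le> a \<Longrightarrow> a < b \<Longrightarrow> b \<le> 42 \<Longrightarrow> kink_y a < kink_y b"
proof -
  assume ab: "0 \<le> a" "a < b" "b \<le> 42"
  have k: "pderiv y_num * y_den - y_num * pderiv y_den = Poly [3562109844150000, 115392840000, - 4209000]"
    by (simp add: y_num_def y_den_def pderiv_pCons)
  have "0 < poly (pderiv y_num * y_den - y_num * pderiv y_den) z" if "z \<in> {0..42}" for z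
    unfolding k by (rule poly_Poly_pos[OF _ that]) (simp add: lower_bound_def min_def)
  then show ?thesis unfolding kink_y_def using ab by (intro ratio_less denominators_pos) auto
qed

text \<open>With a decreasing numerator the derivative of \<open>kink_value\<close> changes sign only once: there is one peak.\<close>

lemma value_wronskian_decreasing: "0 \<le> a \<Longrightarrow> a < b \<Longrightarrow> b \<le> 42 \<Longrightarrow> poly value_wronskian b < poly value_wronskian a"
proof -
  assume ab: "0 \<le> a" "a < b" "b \<le> 42"
  have k: "- pderiv value_wronskian = Poly [20969666089030639942473934566329123400000000000, - 4943723151598831198087384244644260000000000, - 702168542226207984205415004294000000000, 3394359152033323064495673000000000, - 74421006769080023274600000000, - 9431454176562400248000000, - 109104981804436800000, - 328704155520000]"
    by (simp add: value_wronskian_def pderiv_pCons)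
  have d: "\<exists>D. DERIV (poly value_wronskian) z :> D \<and> D < 0" if "a \<le> z" "z \<le> b" for z
  proof -
    have "0 < poly (- pderiv value_wronskian) z"
      unfolding k by (rule poly_Poly_pos[of _ 42]) (use that ab in \<open>simp_all add: lower_bound_def min_def\<close>)
    then show ?thesis by (intro exI[of _ "poly (pderiv value_wronskian) z"]) (simp add: poly_DERIV)
  qed
  show ?thesis by (rule DERIV_neg_imp_decreasing[OF ab(2) d])
qed

lemma peak_exists: "\<exists>z. 103/8 < z \<and> z < 1289/100 \<and> poly value_wronskian z = 0"
proof -
  have "\<exists>z\<ge>103/8. z \<le> 1289/100 \<and> poly value_wronskian z = 0"
    by (rule IVT2) (simp_all add: value_wronskian_def)
  then obtain z where z: "103/8 \<le> z" "z \<le> 1289/100" "poly value_wronskian z = 0" by blast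
  have "poly value_wronskian (103/8) \<noteq> 0" "poly value_wronskian (1289/100) \<noteq> 0" by (simp_all add: value_wronskian_def)
  with z(3) have "z \<noteq> 103/8" "z \<noteq> 1289/100" by metis+
  with z show ?thesis by (intro exI[of _ z]) simp
qed

definition peak :: real where "peak = (SOME z. 103/8 < z \<and> z < 1289/100 \<and> poly value_wronskian z = 0)"

lemma peak: "103/8 < peak" "peak < 1289/100" "poly value_wronskian peak = 0"
  using someI_ex[OF peak_exists] unfolding peak_def by blast+

lemma kink_value_increasing: "0 \<le> a \<Longrightarrow> a < b \<Longrightarrow> b \<le> peak \<Longrightarrow> kink_value a < kink_value b"
proof -
  assume ab: "0 \<le> a" "a < b" "b \<le> peak"
  have "poly value_num a / poly value_den a < poly value_num b / poly value_den b"
  proof (rule ratio_less[OF ab(2)])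
    show "0 < poly value_den z" if "z \<in> {a..b}" for z
      using that ab peak by (intro denominators_pos) auto
    show "0 < poly (pderiv value_num * value_den - value_num * pderiv value_den) z" if "z \<in> {a<..<b}" for z
      using value_wronskian_decreasing[of z peak] that ab peak unfolding value_wronskian by simp
  qed
  then show ?thesis by (simp add: kink_value_def)
qed

lemma kink_value_le_peak:
  assumes "z \<in> {0..42}"
  shows "kink_value z \<le> kink_value peak"
proof (cases "z \<le> peak")
  case True then show ?thesis using kink_value_increasing[of z peak] assms by (cases "z = peak") simp_all
next
  case False
  have "poly (- value_num) peak / poly value_den peak < poly (- value_num) z / poly value_den z"
  proof (rule ratio_less)
    fix w assume w: "w \<in> {peak<..<z}"
    have "pderiv (- value_num) * value_den - (- value_num) * pderiv value_den = - value_wronskian" by (simp add: pderiv_minus flip: value_wronskian)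
    then show "0 < poly (pderiv (- value_num) * value_den - (- value_num) * pderiv value_den) w"
      using value_wronskian_decreasing[of peak w] w peak assms by simp
  next
    show "peak < z" using False by simp
    show "0 < poly value_den w" if "w \<in> {peak..z}" for w using that peak assms by (intro denominators_pos) auto
  qed
  then have "poly value_num z / poly value_den z < poly value_num peak / poly value_den peak" by simp
  then show ?thesis by (simp add: kink_value_def)
qed

text \<open>The lower bound is the value at 103/8, which is below the peak by maximality.  The upper bound holds on the whole
  interval that contains the peak, by expansion at 103/8.\<close>

lemma kink_value_peak: "\<bar>16 * kink_value peak / 13 ^ 9 + 0.008679984\<bar> \<le> 0.0000000005"
proof -
  have z: "peak \<in> {0..42}" using peak by simp
  have d: "0 < poly value_den peak" by (rule denominators_pos[OF z])
  have lo: "- 0.0086799845 \<le> 16 * kink_value (103/8) / 13 ^ 9"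
    by (simp add: kink_value_def value_num_def value_den_def)
  have "kink_value (103/8) \<le> kink_value peak" by (rule kink_value_le_peak) simp
  then have 1: "- 0.0086799845 \<le> 16 * kink_value peak / 13 ^ 9" using lo by simp
  define w where "w = peak - 103/8"
  have w: "w \<in> {0..1/50}" using peak by (simp add: w_def)
  have "- 0.0086799835 * 13 ^ 9 * poly value_den (103/8 + w) - 16 * poly value_num (103/8 + w) = poly (Poly [385585271613938348827959955871133/102400000, - 9678912163363191161304971109/3200000, 212147683654858247141851677471/800000, 441249840930636293480439/50000, 90040735095138253/25000, - 483388464]) w"
    by (simp add: value_num_def value_den_def field_simps)
  also have "\<dots> > 0"
    by (rule poly_Poly_pos[OF _ w]) (simp add: lower_bound_def min_def)
  finally have "0 < - 0.0086799835 * 13 ^ 9 * poly value_den peak - 16 * poly value_num peak" by (simp add: w_def)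
  then have "16 * kink_value peak / 13 ^ 9 < - 0.0086799835"
    using d by (simp add: kink_value_def field_simps)
  with 1 show ?thesis by (intro abs_leI; simp)
qed

lemma kink_share_peak: "\<bar>kink_share peak - 0.496\<bar> \<le> 0.0000005"
proof -
  have "kink_share (103/8) < kink_share peak" "kink_share peak < kink_share (1289/100)"
    using peak by (intro kink_share_less; simp)+
  moreover have "0.4959995 \<le> kink_share (103/8)" "kink_share (1289/100) \<le> 0.4960005"
    by (simp_all add: kink_share_def share_num_def share_den_def)
  ultimately show ?thesis by (intro abs_leI; simp)
qed

text \<open>\<open>edge_9_3\<close> on the ridge, without positive factors.\<close>

definition ridge_9_3 :: "real \<Rightarrow> real \<Rightarrow> real" where
  "ridge_9_3 x y = (3 - x) * (53 - 48 * y) * (231 - 16 * x) - (9 - 11 * x) * (89 + 16 * x) * (177 + 48 * y)"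

text \<open>The payoff where \<open>edge_6_stand\<close> is the only undecided edge that counts.\<close>

definition base_payoff :: "real \<Rightarrow> real \<Rightarrow> real \<Rightarrow> real" where "base_payoff \<theta> x y = fixed_part \<theta> x y + edge_6_stand \<theta> x y"

lemma ridge_9_3_kink: "ridge_9_3 (kink_x z) y = (poly y_num z - y * poly y_den z) * (1/78125)"
  by (simp add: ridge_9_3_def kink_x_def y_num_def y_den_def field_simps)

lemma ridge_9_3_zero:
  assumes "z \<in> {0..42}"
  shows "ridge_9_3 (kink_x z) y = 0 \<longleftrightarrow> y = kink_y z"
  using denominators_pos(3)[OF assms] unfolding ridge_9_3_kink kink_y_def by (auto simp: field_simps)

lemma ridge_share_kink:
  assumes z: "z \<in> {0..42}" and assms2: "0 < ridge_a (kink_x z) (kink_y z) + ridge_b (kink_x z) (kink_y z)"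
  shows "ridge_share (kink_x z) (kink_y z) = kink_share z"
proof -
  have d: "0 < poly y_den z" "0 < poly share_den z" using denominators_pos[OF z] by auto
  let ?x = "kink_x z"
  have A: "poly y_den z * ridge_a ?x (kink_y z) = (3 - ?x) * (53 * poly y_den z - 48 * poly y_num z)"
    using d by (simp add: ridge_a_def kink_y_def field_simps)
  have B: "poly y_den z * ridge_b ?x (kink_y z) = (9 - 11 * ?x) * (89 * poly y_den z + 16 * poly y_num z)"
    using d by (simp add: ridge_b_def kink_y_def field_simps)
  have "poly share_den z * ((3 - ?x) * (53 * poly y_den z - 48 * poly y_num z)) =
    poly share_num z * ((3 - ?x) * (53 * poly y_den z - 48 * poly y_num z) + (9 - 11 * ?x) * (89 * poly y_den z + 16 * poly y_num z))"
    by (simp add: kink_x_def share_num_def share_den_def y_num_def y_den_def field_simps)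
  then have "poly y_den z * (poly share_den z * ridge_a ?x (kink_y z)) = poly y_den z * (poly share_num z * (ridge_a ?x (kink_y z) + ridge_b ?x (kink_y z)))"
    unfolding A[symmetric] B[symmetric] by (simp add: algebra_simps)
  then have e: "poly share_den z * ridge_a ?x (kink_y z) = poly share_num z * (ridge_a ?x (kink_y z) + ridge_b ?x (kink_y z))" using d by simp
  have "ridge_a ?x (kink_y z) + ridge_b ?x (kink_y z) \<noteq> 0"
    using assms2 by simp
  then show ?thesis using e d by (simp add: ridge_share_def kink_share_def field_simps)
qed

text \<open>\<open>base_payoff\<close> is affine in the share and in \<open>y\<close>, so the denominators can be cleared one at a time.\<close>

lemma base_payoff_kink:
  assumes z: "z \<in> {0..42}"
  shows "base_payoff (kink_share z) (kink_x z) (kink_y z) = kink_value z"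
proof -
  have d: "0 < poly y_den z" "0 < poly share_den z" "0 < poly value_den z" using denominators_pos[OF z] by auto
  have aff: "base_payoff \<theta> x y = \<theta> * base_payoff 1 x y + (1 - \<theta>) * base_payoff 0 x y" for \<theta> x y
    by (simp add: base_payoff_def fixed_part_def edge_6_stand_def algebra_simps)
  have affy: "base_payoff \<theta> x y = base_payoff \<theta> x 0 + (base_payoff \<theta> x 1 - base_payoff \<theta> x 0) * y" for \<theta> x y
    by (simp add: base_payoff_def fixed_part_def edge_6_stand_def algebra_simps)
  let ?x = "kink_x z" and ?T = "poly share_num z" and ?E = "poly share_den z" and ?Y = "poly y_num z" and ?W = "poly y_den z"
  have 1: "?W * base_payoff \<theta> ?x (kink_y z) = base_payoff \<theta> ?x 0 * ?W + (base_payoff \<theta> ?x 1 - base_payoff \<theta> ?x 0) * ?Y" for \<theta>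
    using d by (subst affy) (simp add: kink_y_def field_simps)
  have 2: "?E * base_payoff (kink_share z) ?x (kink_y z) = ?T * base_payoff 1 ?x (kink_y z) + (?E - ?T) * base_payoff 0 ?x (kink_y z)"
    using d by (subst aff) (simp add: kink_share_def field_simps)
  have "?W * ?E * base_payoff (kink_share z) ?x (kink_y z) = ?W * (?T * base_payoff 1 ?x (kink_y z) + (?E - ?T) * base_payoff 0 ?x (kink_y z))"
    by (simp only: 2[symmetric] mult.assoc)
  also have "\<dots> = ?T * (?W * base_payoff 1 ?x (kink_y z)) + (?E - ?T) * (?W * base_payoff 0 ?x (kink_y z))"
    by (simp add: algebra_simps)
  also have "\<dots> = poly value_num z * (3/5000)"
    unfolding 1 unfolding base_payoff_def fixed_part_def edge_6_stand_def kink_x_def share_num_def share_den_def y_num_def y_den_def value_num_def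
    by (simp add: field_simps)
  finally have "?W * ?E * base_payoff (kink_share z) ?x (kink_y z) = poly value_num z * (3/5000)" .
  moreover have "?W * ?E * (5000/3) = poly value_den z"
    by (simp add: share_num_def share_den_def y_num_def y_den_def value_den_def field_simps)
  ultimately have "poly value_den z * base_payoff (kink_share z) ?x (kink_y z) = poly value_num z" by algebra
  then show ?thesis using d by (simp add: kink_value_def nonzero_eq_divide_eq mult.commute)
qed

section \<open>Slopes along the ridge\<close>

text \<open>These four coefficients describe, for a fixed \<open>y\<close>, the payoff of either Player as an affine function of \<open>x\<close>.  The factors
  \<open>c\<close> and \<open>e\<close> switch the edges at (9, 3, 4) and (2, 5, 5) on and off.\<close>

definition hand1_const :: "real \<Rightarrow> real \<Rightarrow> real \<Rightarrow> real" where
  "hand1_const c e y = - 5907658 - 625952 * y - 11024 * (3 - y) + c * (231 * (89 + 16 * y)) + e * (285 * (89 + 16 * y))"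
definition hand1_slope :: "real \<Rightarrow> real \<Rightarrow> real \<Rightarrow> real" where
  "hand1_slope c e y = 820039 + 2816 * y + 9984 * (3 - y) - c * (16 * (89 + 16 * y)) - e * (80 * (89 + 16 * y))"
definition hand2_const :: "real \<Rightarrow> real \<Rightarrow> real \<Rightarrow> real" where
  "hand2_const c e y = - 5907658 + 820039 * y + 18512 * (9 - 11 * y) - c * (89 * (177 + 48 * y)) - e * (89 * (231 - 16 * y))"
definition hand2_slope :: "real \<Rightarrow> real \<Rightarrow> real \<Rightarrow> real" where
  "hand2_slope c e y = - 625952 + 2816 * y + 3328 * (9 - 11 * y) - c * (16 * (177 + 48 * y)) - e * (16 * (231 - 16 * y))"

text \<open>The numerator of the derivative in \<open>x\<close> of the payoff along the ridge, where the share varies with \<open>x\<close>; see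
  \<open>along_ridge_deriv\<close>.\<close>

definition ridge_slope :: "real \<Rightarrow> real \<Rightarrow> real \<Rightarrow> real \<Rightarrow> real" where
  "ridge_slope c e x y = ((53 - 48 * y) * (3 - x) * hand1_slope c e y + (89 + 16 * y) * (9 - 11 * x) * hand2_slope c e y) *
       ((53 - 48 * y) * (3 - x) + (89 + 16 * y) * (9 - 11 * x)) +
     24 * (53 - 48 * y) * (89 + 16 * y) * ((hand1_const c e y + hand1_slope c e y * x) - (hand2_const c e y + hand2_slope c e y * x))"

text \<open>The bound \<open>lower_bound\<close> once more, now with respect to \<open>s\<close>, whose degree is at most two here.\<close>

lemma two_variable_pos:
  assumes u: "u \<in> {0..U}" and s: "s \<in> {0..S}"
    and "0 < lower_bound cs U" "0 \<le> lower_bound ds U + min 0 (S * lower_bound es U)"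
  shows "0 < poly (Poly cs) u + s * (poly (Poly ds) u + s * poly (Poly es) u)"
proof -
  have "min 0 (S * lower_bound es U) \<le> s * lower_bound es U"
    using s by (cases "0 \<le> lower_bound es U") (auto simp: min_def mult_right_mono_neg not_le intro: order_trans[OF _ mult_right_mono_neg])
  also have "\<dots> \<le> s * poly (Poly es) u" using lower_bound[OF u] s by (intro mult_left_mono) auto
  finally have "0 \<le> poly (Poly ds) u + s * poly (Poly es) u"
    using lower_bound[OF u, of ds] assms(4) by linarith
  then show ?thesis using lower_bound[OF u, of cs] assms(3) s by (smt (verit) mult_nonneg_nonneg atLeastAtMost_iff)
qed

text \<open>The region of the ridge that matters is a thin wedge, see \<open>ridge_region\<close>.  Its upper edge is close to the line
  \<open>s = 0\<close> here and its lower edge to the line \<open>s = 0\<close> in the next two lemmas.  In coordinates along these lines \<open>ridge_slope\<close> has a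
  definite sign, which the expansion in \<open>u\<close> and \<open>s\<close> shows.\<close>

lemma ridge_slope_neg:
  assumes u: "u \<in> {0..31/1000}" and s: "s \<in> {0..1/100}"
  shows "ridge_slope 0 0 (2463/3125 + u / 5 - s) (7881/10000 + u) < 0"
proof -
  have A: "hand1_slope 0 0 (7881/10000 + u) = 527713687/625 + (- 7168) * (u)" "hand2_slope 0 0 (7881/10000 + u) = - 389144672/625 + (- 33792) * (u)"
    by (simp_all add: hand1_slope_def hand2_slope_def field_simps)
  have B: "(53 - 48 * (7881/10000 + u)) * (3 - (2463/3125 + u / 5 - s)) = 65539584/1953125 + (9482/625) * (s) + (- 341258/3125) * (u) + (- 48) * (u * s) + (48/5) * (u * u)" "(89 + 16 * (7881/10000 + u)) * (9 - 11 * (2463/3125 + u / 5 - s)) = 65538192/1953125 + (698566/625) * (s) + (- 682054/3125) * (u) + (176) * (u * s) + (- 176/5) * (u * u)"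
    by (simp_all add: field_simps)
  have E: "24 * (53 - 48 * (7881/10000 + u)) * (89 + 16 * (7881/10000 + u)) = 14451933408/390625 + (- 69517824/625) * (u) + (- 18432) * (u * u)"
    by (simp add: field_simps)
  have F: "(hand1_const 0 0 (7881/10000 + u) + hand1_slope 0 0 (7881/10000 + u) * (2463/3125 + u / 5 - s)) - (hand2_const 0 0 (7881/10000 + u) + hand2_slope 0 0 (7881/10000 + u) * (2463/3125 + u / 5 - s)) = - 433918085403/31250000 + (- 916858359/625) * (s) + (- 2865488604/3125) * (u) + (- 26624) * (u * s) + (26624/5) * (u * u)"
    by (simp add: hand1_const_def hand1_slope_def hand2_const_def hand2_slope_def field_simps)
  have D: "65539584/1953125 + (9482/625) * (s) + (- 341258/3125) * (u) + (- 48) * (u * s) + (48/5) * (u * u) + (65538192/1953125 + (698566/625) * (s) + (- 682054/3125) * (u) + (176) * (u * s) + (- 176/5) * (u * u)) = 131077776/1953125 + (708048/625) * (s) + (- 1023312/3125) * (u) + (128) * (u * s) + (- 128/5) * (u * u)"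
    by (simp add: field_simps)
  have N: "(65539584/1953125 + (9482/625) * (s) + (- 341258/3125) * (u) + (- 48) * (u * s) + (48/5) * (u * u)) * (527713687/625 + (- 7168) * (u)) + (65538192/1953125 + (698566/625) * (s) + (- 682054/3125) * (u) + (176) * (u * s) + (- 176/5) * (u * u)) * (- 389144672/625 + (- 33792) * (u)) = 9082297287773184/1220703125 + (- 266839455760218/390625) * (s) + (82646708395866/1953125) * (u) + (- 117493628496/625) * (u * s) + (23862765072/625) * (u * u) + (- 5603328) * (u * u * s) + (5603328/5) * (u * u * u)"
    by (simp add: field_simps)
  have "- ridge_slope 0 0 (2463/3125 + u / 5 - s) (7881/10000 + u) =
    poly (Poly [34308622651572494822466/2384185791015625, 121981300253690304091392/3814697265625, - 555175908222905003616/6103515625, - 5465736894915072/1953125, 22539664828416/15625, 717225984/25]) u + s * (poly (Poly [69953444820199529430336/762939453125, - 103063685454189718848/244140625, - 307307237056736256/1953125, - 41546274459648/3125, - 1434451968/5]) u + s * poly (Poly [188935142972110834464/244140625, 117346579006643712/390625, 19006609631232/625, 717225984]) u)"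
    unfolding ridge_slope_def unfolding F E unfolding A B unfolding D N by (simp add: algebra_simps add_divide_distrib diff_divide_distrib)
  also have "\<dots> > 0"
    by (rule two_variable_pos[OF u s]; simp add: lower_bound_def min_def)
  finally show ?thesis by simp
qed

lemma ridge_slope_pos0:
  assumes u: "u \<in> {0..31/1000}" and s: "s \<in> {0..3/500}"
  shows "0 < ridge_slope 1 0 (3933/5000 + 9 / 100 * u + s) (7881/10000 + u)"
proof -
  have A: "hand1_slope 1 0 (7881/10000 + u) = 526697591/625 + (- 7424) * (u)" "hand2_slope 1 0 (7881/10000 + u) = - 78258592/125 + (- 34560) * (u)"
    by (simp_all add: hand1_slope_def hand2_slope_def field_simps)
  have B: "(53 - 48 * (7881/10000 + u)) * (3 - (3933/5000 + 9 / 100 * u + s)) = 52468647/1562500 + (- 9482/625) * (s) + (- 3362769/31250) * (u) + (48) * (u * s) + (108/25) * (u * u)" "(89 + 16 * (7881/10000 + u)) * (9 - 11 * (3933/5000 + 9 / 100 * u + s)) = 55154961/1562500 + (- 698566/625) * (s) + (- 2969847/31250) * (u) + (- 176) * (u * s) + (- 396/25) * (u * u)"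
    by (simp_all add: field_simps)
  have E: "24 * (53 - 48 * (7881/10000 + u)) * (89 + 16 * (7881/10000 + u)) = 14451933408/390625 + (- 69517824/625) * (u) + (- 18432) * (u * u)"
    by (simp add: field_simps)
  have F: "(hand1_const 1 0 (7881/10000 + u) + hand1_slope 1 0 (7881/10000 + u) * (3933/5000 + 9 / 100 * u + s)) - (hand2_const 1 0 (7881/10000 + u) + hand2_slope 1 0 (7881/10000 + u) * (3933/5000 + 9 / 100 * u + s)) = 174016594791/6250000 + (917990551/625) * (s) + (- 66864448941/62500) * (u) + (27136) * (u * s) + (61056/25) * (u * u)"
    by (simp add: hand1_const_def hand1_slope_def hand2_const_def hand2_slope_def field_simps)
  have D: "52468647/1562500 + (- 9482/625) * (s) + (- 3362769/31250) * (u) + (48) * (u * s) + (108/25) * (u * u) + (55154961/1562500 + (- 698566/625) * (s) + (- 2969847/31250) * (u) + (- 176) * (u * s) + (- 396/25) * (u * u)) = 26905902/390625 + (- 708048/625) * (s) + (- 3166308/15625) * (u) + (- 128) * (u * s) + (- 288/25) * (u * u)"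
    by (simp add: field_simps)
  have N: "(52468647/1562500 + (- 9482/625) * (s) + (- 3362769/31250) * (u) + (48) * (u * s) + (108/25) * (u * u)) * (526697591/625 + (- 7424) * (u)) + (55154961/1562500 + (- 698566/625) * (s) + (- 2969847/31250) * (u) + (- 176) * (u * s) + (- 396/25) * (u * u)) * (- 78258592/125 + (- 34560) * (u)) = 6053362029554817/976562500 + (268349811337498/390625) * (s) + (- 637778141605959/19531250) * (u) + (118361880656/625) * (u * s) + (275636906676/15625) * (u * u) + (5726208) * (u * u * s) + (12883968/25) * (u * u * u)"
    by (simp add: field_simps)
  have "ridge_slope 1 0 (3933/5000 + 9 / 100 * u + s) (7881/10000 + u) =
    poly (Poly [277910289003740542237467/190734863281250, - 176173013878938138506418/3814697265625, 19276999698847627787886/152587890625, 3975675398853264288/244140625, - 137762168072832/390625, - 3710582784/625]) u + s * (poly (Poly [14440387451130420226392/152587890625, - 1540124650799519649168/6103515625, - 896406390998694144/9765625, - 104438319657984/15625, - 3298295808/25]) u + s * poly (Poly [- 190004547217892783904/244140625, - 118154668725919232/390625, - 19204750845952/625, - 732954624]) u)"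
    unfolding ridge_slope_def unfolding F E unfolding A B unfolding D N by (simp add: algebra_simps add_divide_distrib diff_divide_distrib)
  also have "\<dots> > 0"
    by (rule two_variable_pos[OF u s]; simp add: lower_bound_def min_def)
  finally show ?thesis by simp
qed

lemma ridge_slope_pos1:
  assumes u: "u \<in> {0..31/1000}" and s: "s \<in> {0..3/500}"
  shows "0 < ridge_slope 1 1 (3933/5000 + 9 / 100 * u + s) (7881/10000 + u)"
proof -
  have A: "hand1_slope 1 1 (7881/10000 + u) = 521617111/625 + (- 8704) * (u)" "hand2_slope 1 1 (7881/10000 + u) = - 393476864/625 + (- 34304) * (u)"
    by (simp_all add: hand1_slope_def hand2_slope_def field_simps)
  have B: "(53 - 48 * (7881/10000 + u)) * (3 - (3933/5000 + 9 / 100 * u + s)) = 52468647/1562500 + (- 9482/625) * (s) + (- 3362769/31250) * (u) + (48) * (u * s) + (108/25) * (u * u)" "(89 + 16 * (7881/10000 + u)) * (9 - 11 * (3933/5000 + 9 / 100 * u + s)) = 55154961/1562500 + (- 698566/625) * (s) + (- 2969847/31250) * (u) + (- 176) * (u * s) + (- 396/25) * (u * u)"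
    by (simp_all add: field_simps)
  have E: "24 * (53 - 48 * (7881/10000 + u)) * (89 + 16 * (7881/10000 + u)) = 14451933408/390625 + (- 69517824/625) * (u) + (- 18432) * (u * u)"
    by (simp add: field_simps)
  have F: "(hand1_const 1 1 (7881/10000 + u) + hand1_slope 1 1 (7881/10000 + u) * (3933/5000 + 9 / 100 * u + s)) - (hand2_const 1 1 (7881/10000 + u) + hand2_slope 1 1 (7881/10000 + u) * (3933/5000 + 9 / 100 * u + s)) = 18148155519/250000 + (36603759/25) * (s) + (- 2670801269/2500) * (u) + (25600) * (u * s) + (2304) * (u * u)"
    by (simp add: hand1_const_def hand1_slope_def hand2_const_def hand2_slope_def field_simps)
  have D: "52468647/1562500 + (- 9482/625) * (s) + (- 3362769/31250) * (u) + (48) * (u * s) + (108/25) * (u * u) + (55154961/1562500 + (- 698566/625) * (s) + (- 2969847/31250) * (u) + (- 176) * (u * s) + (- 396/25) * (u * u)) = 26905902/390625 + (- 708048/625) * (s) + (- 3166308/15625) * (u) + (- 128) * (u * s) + (- 288/25) * (u * u)"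
    by (simp add: field_simps)
  have N: "(52468647/1562500 + (- 9482/625) * (s) + (- 3362769/31250) * (u) + (48) * (u * s) + (108/25) * (u * u)) * (521617111/625 + (- 8704) * (u)) + (55154961/1562500 + (- 698566/625) * (s) + (- 2969847/31250) * (u) + (- 176) * (u * s) + (- 396/25) * (u * u)) * (- 393476864/625 + (- 34304) * (u)) = 5666342977896513/976562500 + (269923585530522/390625) * (s) + (- 614870802690951/19531250) * (u) + (118335688784/625) * (u * s) + (277725072564/15625) * (u * u) + (5619712) * (u * u * s) + (12644352/25) * (u * u * u)"
    by (simp add: field_simps)
  have "ridge_slope 1 1 (3933/5000 + 9 / 100 * u + s) (7881/10000 + u) =
    poly (Poly [588486720053132120022363/190734863281250, - 194332833100972733892402/3814697265625, 19090556028566022934254/152587890625, 3962559711521660832/244140625, - 136609533790848/390625, - 3641573376/625]) u + s * (poly (Poly [14525075079545685881688/152587890625, - 1550125994231711947152/6103515625, - 897290290413148416/9765625, - 103748834866176/15625, - 3236954112/25]) u + s * poly (Poly [- 191118854887715041056/244140625, - 118337566720040448/390625, - 19125994006528/625, - 719323136]) u)"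
    unfolding ridge_slope_def unfolding F E unfolding A B unfolding D N by (simp add: algebra_simps add_divide_distrib diff_divide_distrib)
  also have "\<dots> > 0"
    by (rule two_variable_pos[OF u s]; simp add: lower_bound_def min_def)
  finally show ?thesis by simp
qed

section \<open>The value as a function of the share\<close>

definition with_edges :: "real \<Rightarrow> real \<Rightarrow> real \<Rightarrow> real \<Rightarrow> real \<Rightarrow> real" where
  "with_edges c e \<theta> x y = base_payoff \<theta> x y + c * edge_9_3 \<theta> x y + e * edge_2_5 \<theta> x y"

text \<open>Without any minima: smooth branches of the payoff on the ridge, of which the payoff is the least.\<close>

definition along_ridge :: "real \<Rightarrow> real \<Rightarrow> real \<Rightarrow> real \<Rightarrow> real" where
  "along_ridge c e x y = with_edges c e (ridge_share x y) x y"

lemma with_edges_affine: "with_edges c e \<theta> x y = \<theta> * (hand1_const c e y + hand1_slope c e y * x) + (1 - \<theta>) * (hand2_const c e y + hand2_slope c e y * x)"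
  by (simp add: with_edges_def base_payoff_def fixed_part_def edge_6_stand_def edge_9_3_def edge_2_5_def hand1_const_def hand1_slope_def hand2_const_def hand2_slope_def algebra_simps)

lemma ridge_share_deriv:
  assumes "ridge_a x y + ridge_b x y \<noteq> 0"
  shows "((\<lambda>x. ridge_share x y) has_real_derivative 24 * (53 - 48 * y) * (89 + 16 * y) / (ridge_a x y + ridge_b x y)\<^sup>2) (at x)"
proof -
  have "((\<lambda>x. ridge_share x y) has_real_derivative
      (- (53 - 48 * y) * (ridge_a x y + ridge_b x y) - ridge_a x y * (- (53 - 48 * y) - 11 * (89 + 16 * y))) /
      ((ridge_a x y + ridge_b x y) * (ridge_a x y + ridge_b x y))) (at x)"
    using assms unfolding ridge_share_def ridge_a_def ridge_b_def by (auto intro!: derivative_eq_intros)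
  moreover have "- (53 - 48 * y) * (ridge_a x y + ridge_b x y) - ridge_a x y * (- (53 - 48 * y) - 11 * (89 + 16 * y)) =
      24 * (53 - 48 * y) * (89 + 16 * y)"
    by (simp add: ridge_a_def ridge_b_def algebra_simps)
  ultimately show ?thesis by (simp add: power2_eq_square)
qed

lemma quotient_slope:
  fixes D k a b t p r :: real
  assumes "D \<noteq> 0"
  shows "k / D\<^sup>2 * a + t * p + (- (k / D\<^sup>2) * b + (1 - t) * r) = (k * (a - b) + (t * D * p + (1 - t) * D * r) * D) / D\<^sup>2"
  using assms by (simp add: field_simps power2_eq_square)

lemma along_ridge_deriv:
  assumes D: "ridge_a x y + ridge_b x y \<noteq> 0"
  shows "((\<lambda>x. along_ridge c e x y) has_real_derivative ridge_slope c e x y / (ridge_a x y + ridge_b x y)\<^sup>2) (at x)"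
proof -
  let ?D = "ridge_a x y + ridge_b x y"
  let ?a = "hand1_const c e y + hand1_slope c e y * x" and ?b = "hand2_const c e y + hand2_slope c e y * x"
  let ?s = "24 * (53 - 48 * y) * (89 + 16 * y) / ?D\<^sup>2"
  have th: "ridge_share x y * ?D = ridge_a x y" "(1 - ridge_share x y) * ?D = ridge_b x y"
    using D by (simp_all add: ridge_share_def field_simps)
  have "((\<lambda>x. along_ridge c e x y) has_real_derivative
      ?s * ?a + ridge_share x y * hand1_slope c e y + (- (?s) * ?b + (1 - ridge_share x y) * hand2_slope c e y)) (at x)"
    unfolding along_ridge_def with_edges_affine
    by (rule derivative_eq_intros ridge_share_deriv[OF D] refl | simp)+
  moreover have "?s * ?a + ridge_share x y * hand1_slope c e y + (- (?s) * ?b + (1 - ridge_share x y) * hand2_slope c e y) =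
      (24 * (53 - 48 * y) * (89 + 16 * y) * (?a - ?b) + (ridge_share x y * ?D * hand1_slope c e y + (1 - ridge_share x y) * ?D * hand2_slope c e y) * ?D) / ?D\<^sup>2"
    by (rule quotient_slope[OF D])
  moreover have "24 * (53 - 48 * y) * (89 + 16 * y) * (?a - ?b) + (ridge_a x y * hand1_slope c e y + ridge_b x y * hand2_slope c e y) * ?D = ridge_slope c e x y"
    by (simp add: ridge_slope_def ridge_a_def ridge_b_def mult_ac)
  ultimately show ?thesis unfolding th by simp
qed

lemma along_ridge_decreasing:
  assumes y: "y \<in> {7881/10000..9/11}" and x: "x1 < x2" "x1 \<in> Xs" "x2 \<in> Xs" "x2 \<le> 2463/3125 + (y - 7881/10000) / 5"
  shows "along_ridge 0 0 x2 y < along_ridge 0 0 x1 y"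
proof (rule DERIV_neg_imp_decreasing[OF x(1)])
  fix x assume "x1 \<le> x" "x \<le> x2"
  moreover define u where "u = y - 7881/10000"
  have u: "0 \<le> u" "u \<le> 31/1000" "x2 \<le> 2463/3125 + u / 5" using y x(4) by (auto simp: u_def)
  ultimately have "x \<in> Xs" "2463/3125 + u / 5 - x \<in> {0..1/100}" using x(2,3) by auto
  then have x': "x \<in> Xs" "2463/3125 + (y - 7881/10000) / 5 - x \<in> {0..1/100}" by (simp_all only: u_def)
  have "0 < ridge_a x y + ridge_b x y" using ridge_ab_pos[OF x'(1), of y] y by simp
  moreover have "ridge_slope 0 0 x y < 0"
    using ridge_slope_neg[of "y - 7881/10000", OF _ x'(2)] y by simp
  ultimately show "\<exists>D. DERIV (\<lambda>x. along_ridge 0 0 x y) x :> D \<and> D < 0"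
    by (intro exI[of _ "ridge_slope 0 0 x y / (ridge_a x y + ridge_b x y)\<^sup>2"] conjI along_ridge_deriv) (auto intro!: divide_neg_pos)
qed

lemma along_ridge_increasing:
  assumes y: "y \<in> {7881/10000..9/11}" and x: "x1 < x2" "x1 \<in> Xs" "x2 \<in> Xs" "3933/5000 + 9/100 * (y - 7881/10000) \<le> x1"
    and e: "e \<in> {0, 1}"
  shows "along_ridge 1 e x1 y < along_ridge 1 e x2 y"
proof (rule DERIV_pos_imp_increasing[OF x(1)])
  fix x assume "x1 \<le> x" "x \<le> x2"
  moreover define u where "u = y - 7881/10000"
  have u: "0 \<le> u" "u \<le> 31/1000" "3933/5000 + 9/100 * u \<le> x1" using y x(4) by (auto simp: u_def)
  ultimately have "x \<in> Xs" "x - (3933/5000 + 9/100 * u) \<in> {0..3/500}" using x(2,3) by auto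
  then have x': "x \<in> Xs" "x - (3933/5000 + 9/100 * (y - 7881/10000)) \<in> {0..3/500}" by (simp_all only: u_def)
  have "0 < ridge_a x y + ridge_b x y" using ridge_ab_pos[OF x'(1), of y] y by simp
  moreover have "ridge_slope 1 e x y > 0"
    using ridge_slope_pos0[of "y - 7881/10000", OF _ x'(2)] ridge_slope_pos1[of "y - 7881/10000", OF _ x'(2)] y e by auto
  ultimately show "\<exists>D. DERIV (\<lambda>x. along_ridge 1 e x y) x :> D \<and> 0 < D"
    by (intro exI[of _ "ridge_slope 1 e x y / (ridge_a x y + ridge_b x y)\<^sup>2"] conjI along_ridge_deriv) auto
qed

text \<open>\<open>edge_6_stand\<close> and, in the next definition, \<open>edge_2_5\<close> on the ridge, up to positive factors; see \<open>ridge_edges\<close>.\<close>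

definition ridge_6_stand :: "real \<Rightarrow> real \<Rightarrow> real" where
  "ridge_6_stand x y = (9 - 11 * x) * (89 + 16 * x) * ((9 - 11 * y) * (89 + 16 * y)) - (3 - x) * (53 - 48 * x) * ((3 - y) * (53 - 48 * y))"

definition ridge_2_5 :: "real \<Rightarrow> real \<Rightarrow> real" where
  "ridge_2_5 x y = (3 - x) * (53 - 48 * y) * (285 - 80 * x) - (9 - 11 * x) * (89 + 16 * x) * (231 - 16 * y)"

lemma ridge_edges:
  assumes "x \<in> Xs" "y \<in> Ys"
  shows "edge_6_stand (ridge_share x y) x y \<le> 0 \<longleftrightarrow> ridge_6_stand x y \<le> 0"
    and "edge_9_3 (ridge_share x y) x y \<le> 0 \<longleftrightarrow> ridge_9_3 x y \<le> 0"
    and "0 \<le> edge_9_3 (ridge_share x y) x y \<longleftrightarrow> 0 \<le> ridge_9_3 x y"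
    and "0 \<le> edge_2_5 (ridge_share x y) x y \<longleftrightarrow> 0 \<le> ridge_2_5 x y"
proof -
  let ?D = "ridge_a x y + ridge_b x y" and ?\<theta> = "ridge_share x y"
  have D: "0 < ?D" using ridge_ab_pos[OF assms] by simp
  have th: "?\<theta> * ?D = ridge_a x y" "(1 - ?\<theta>) * ?D = ridge_b x y"
    using D by (simp_all add: ridge_share_def field_simps)
  have "?D * edge_6_stand ?\<theta> x y = 208 * (((1 - ?\<theta>) * ?D) * (89 + 16 * x) * (9 - 11 * y) - (?\<theta> * ?D) * (53 - 48 * x) * (3 - y))"
    by (simp add: edge_6_stand_def algebra_simps)
  then have 3: "?D * edge_6_stand ?\<theta> x y = 208 * ridge_6_stand x y"
    unfolding th by (simp add: ridge_6_stand_def ridge_a_def ridge_b_def mult_ac)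
  have "?D * edge_9_3 ?\<theta> x y = (?\<theta> * ?D) * (231 - 16 * x) * (89 + 16 * y) - ((1 - ?\<theta>) * ?D) * (89 + 16 * x) * (177 + 48 * y)"
    by (simp add: edge_9_3_def algebra_simps)
  then have 4: "?D * edge_9_3 ?\<theta> x y = (89 + 16 * y) * ridge_9_3 x y"
    unfolding th by (simp add: ridge_9_3_def ridge_a_def ridge_b_def algebra_simps)
  have "?D * edge_2_5 ?\<theta> x y = (?\<theta> * ?D) * (285 - 80 * x) * (89 + 16 * y) - ((1 - ?\<theta>) * ?D) * (89 + 16 * x) * (231 - 16 * y)"
    by (simp add: edge_2_5_def algebra_simps)
  then have 1: "?D * edge_2_5 ?\<theta> x y = (89 + 16 * y) * ridge_2_5 x y"
    unfolding th by (simp add: ridge_2_5_def ridge_a_def ridge_b_def algebra_simps)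
  have y: "0 < 89 + 16 * y" using assms by simp
  note sgn = mult_le_0_iff zero_le_mult_iff not_less[symmetric]
  show "edge_6_stand ?\<theta> x y \<le> 0 \<longleftrightarrow> ridge_6_stand x y \<le> 0"
    using 3 D by (metis mult_le_cancel_left_pos mult_zero_right zero_less_numeral)
  show "edge_9_3 ?\<theta> x y \<le> 0 \<longleftrightarrow> ridge_9_3 x y \<le> 0"
    using 4 D y by (metis mult_le_cancel_left_pos mult_zero_right)
  show "0 \<le> edge_9_3 ?\<theta> x y \<longleftrightarrow> 0 \<le> ridge_9_3 x y"
    using 4 D y by (metis mult_le_cancel_left_pos mult_zero_right)
  show "0 \<le> edge_2_5 ?\<theta> x y \<longleftrightarrow> 0 \<le> ridge_2_5 x y"
    using 1 D y by (metis mult_le_cancel_left_pos mult_zero_right)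
qed

lemma ridge_6_stand_commute: "ridge_6_stand x y = ridge_6_stand y x"
  by (simp add: ridge_6_stand_def mult_ac)

lemma ridge_6_stand_decreasing:
  assumes y: "y \<in> {11/14..4/5}" and x: "x1 \<le> x2" "11/14 \<le> x1" "x2 \<le> 9/11"
  shows "ridge_6_stand x2 y \<le> ridge_6_stand x1 y"
proof -
  let ?f = "(9 - 11 * y) * (89 + 16 * y)" and ?g = "(3 - y) * (53 - 48 * y)"
  have e: "ridge_6_stand x1 y - ridge_6_stand x2 y = (x2 - x1) * (?f * (835 + 176 * (x1 + x2)) - ?g * (197 - 48 * (x1 + x2)))"
    by (simp add: ridge_6_stand_def algebra_simps)
  have "1/5 * 89 \<le> ?f" using y by (intro mult_mono) auto
  then have "1/5 * 89 * (835 + 176 * (11/7)) \<le> ?f * (835 + 176 * (x1 + x2))" using x y by (intro mult_mono) auto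
  moreover have "?g \<le> 3 * 16" using y by (intro mult_mono) auto
  then have "?g * (197 - 48 * (x1 + x2)) \<le> 3 * 16 * (197 - 48 * (11/7))" using x y by (intro mult_mono) auto
  ultimately have "0 < ?f * (835 + 176 * (x1 + x2)) - ?g * (197 - 48 * (x1 + x2))" by simp
  then have "0 \<le> ridge_6_stand x1 y - ridge_6_stand x2 y" unfolding e using x by (intro mult_nonneg_nonneg) auto
  then show ?thesis by simp
qed

lemma ridge_6_stand_mono:
  assumes "x \<in> {11/14..4/5}" "x' \<in> {11/14..4/5}" "y \<in> {11/14..4/5}" "y' \<in> {11/14..4/5}" "x \<le> x'" "y \<le> y'"
  shows "ridge_6_stand x' y' \<le> ridge_6_stand x y"
proof -
  have "ridge_6_stand x' y' \<le> ridge_6_stand x y'" using ridge_6_stand_decreasing[of y' x x'] assms by auto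
  also have "\<dots> \<le> ridge_6_stand x y" using ridge_6_stand_decreasing[of x y y'] assms unfolding ridge_6_stand_commute[of x] by auto
  finally show ?thesis .
qed

lemma ridge_6_stand_neg:
  assumes "x \<in> Xs" "y \<in> {4/5..9/11}"
  shows "ridge_6_stand x y < 0"
proof -
  have "ridge_6_stand y x \<le> ridge_6_stand (4/5) x" using ridge_6_stand_decreasing[of x "4/5" y] assms by auto
  also have "\<dots> = ridge_6_stand x (4/5)" by (rule ridge_6_stand_commute)
  also have "\<dots> \<le> ridge_6_stand (11/14) (4/5)" using ridge_6_stand_decreasing[of "4/5" "11/14" x] assms by auto
  also have "\<dots> < 0" by (simp add: ridge_6_stand_def)
  finally show ?thesis by (simp add: ridge_6_stand_commute)
qed

text \<open>Once the edge at (6, stand) is nonpositive on the ridge, increasing \<open>x\<close> and \<open>y\<close> keeps it so.  Beyond \<open>y = 4/5\<close>, where the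
  monotonicity argument does not reach, it is negative anyway.\<close>

lemma ridge_6_stand_persists:
  assumes "ridge_6_stand x y \<le> 0" "x \<in> Xs" "x' \<in> Xs" "y \<in> Ys" "y' \<in> Ys" "x \<le> x'" "y \<le> y'"
  shows "ridge_6_stand x' y' \<le> 0"
  using ridge_6_stand_mono[of x x' y y'] ridge_6_stand_neg[of x' y'] assms by (cases "y' \<le> 4/5") auto

lemma ridge_share_less:
  assumes y: "y \<in> Ys" and x: "x1 < x2" "x1 \<in> Xs" "x2 \<in> Xs"
  shows "ridge_share x1 y < ridge_share x2 y"
proof (rule DERIV_pos_imp_increasing[OF x(1)])
  fix x assume "x1 \<le> x" "x \<le> x2"
  then have "x \<in> Xs" using x by simp
  then have "0 < ridge_a x y + ridge_b x y" using ridge_ab_pos[OF _ y] by fastforce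
  then show "\<exists>D. DERIV (\<lambda>x. ridge_share x y) x :> D \<and> 0 < D"
    using y by (intro exI[of _ "24 * (53 - 48 * y) * (89 + 16 * y) / (ridge_a x y + ridge_b x y)\<^sup>2"] conjI ridge_share_deriv) auto
qed

lemma ridge_share_antimono:
  assumes y: "y1 \<le> y2" "y1 \<in> Ys" "y2 \<in> Ys" and x: "x \<in> Xs"
  shows "ridge_share x y2 \<le> ridge_share x y1"
proof -
  have "ridge_a x y2 \<le> ridge_a x y1" using y x unfolding ridge_a_def by (intro mult_left_mono) auto
  moreover have "ridge_b x y1 \<le> ridge_b x y2" using y x unfolding ridge_b_def by (intro mult_left_mono) auto
  moreover note ridge_ab_pos[OF x y(2)] ridge_ab_pos[OF x y(3)]
  moreover from calculation have "ridge_a x y2 * ridge_b x y1 \<le> ridge_a x y1 * ridge_b x y2" by (intro mult_mono) auto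
  ultimately show ?thesis unfolding ridge_share_def by (simp add: divide_le_eq le_divide_eq frac_le field_simps)
qed

lemma ridge_share_bounds:
  assumes "x \<in> Xs" "y \<in> Ys"
  shows "ridge_share x y \<le> 1/2 \<longleftrightarrow> 0 \<le> 642 - 926 * x + 288 * y - 224 * (x * y)"
    and "49/100 \<le> ridge_share x y \<longleftrightarrow> 0 \<le> - 31140 - 14400 * y + 45268 * x + 11072 * (x * y)"
proof -
  have D: "0 < ridge_a x y + ridge_b x y" using ridge_ab_pos[OF assms] by simp
  then have "ridge_share x y \<le> 1/2 \<longleftrightarrow> ridge_a x y \<le> ridge_b x y" "49/100 \<le> ridge_share x y \<longleftrightarrow> 49 * ridge_b x y \<le> 51 * ridge_a x y"
    by (auto simp: ridge_share_def field_simps)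
  then show "ridge_share x y \<le> 1/2 \<longleftrightarrow> 0 \<le> 642 - 926 * x + 288 * y - 224 * (x * y)"
    "49/100 \<le> ridge_share x y \<longleftrightarrow> 0 \<le> - 31140 - 14400 * y + 45268 * x + 11072 * (x * y)"
    by (auto simp: ridge_a_def ridge_b_def algebra_simps)
qed

text \<open>A share of at most 1/2 bounds \<open>x\<close> from above, one of at least 49/100 bounds it from below, both in terms of \<open>y\<close>; these
  bounds are almost linear.  Since \<open>ridge_6_stand\<close> is positive near the lower left corner, \<open>y\<close> is bounded away from it.\<close>

lemma ridge_region:
  assumes x: "x \<in> Xs" and y: "y \<in> Ys" and th: "ridge_share x y \<in> Th" and p: "ridge_6_stand x y \<le> 0"
  shows "7881/10000 \<le> y" "x \<le> 2463/3125 + (y - 7881/10000) / 5" "3933/5000 + 9/100 * (y - 7881/10000) \<le> x"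
    "x \<le> kink_x 42"
proof -
  have le: "0 \<le> 642 - 926 * x + 288 * y - 224 * (x * y)"
    and ge: "0 \<le> - 31140 - 14400 * y + 45268 * x + 11072 * (x * y)"
    using th ridge_share_bounds[OF x y] by auto
  show y1: "7881/10000 \<le> y"
  proof (rule ccontr)
    assume y': "\<not> 7881/10000 \<le> y"
    have "x < 2463/3125"
    proof (rule ccontr)
      assume "\<not> x < 2463/3125"
      then have "2463/3125 * (926 + 224 * y) \<le> x * (926 + 224 * y)" using y by (intro mult_right_mono) auto
      then show False using le y' by (simp add: algebra_simps)
    qed
    then have "ridge_6_stand (2463/3125) (7881/10000) \<le> ridge_6_stand x y"
      using x y y' by (intro ridge_6_stand_mono) auto
    moreover have "0 < ridge_6_stand (2463/3125) (7881/10000)" by (simp add: ridge_6_stand_def)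
    ultimately show False using p by simp
  qed
  define u where "u = y - 7881/10000"
  have y_u: "y = 7881/10000 + u" and u: "0 \<le> u" "u \<le> 31/1000" using y1 y by (simp_all add: u_def)
  have uu: "0 \<le> u * u" "u * u \<le> 31/1000 * u" using u mult_right_mono[of u "31/1000" u] by simp_all
  have "x \<le> 2463/3125 + u / 5"
  proof (rule ccontr)
    assume "\<not> x \<le> 2463/3125 + u / 5"
    then have "(2463/3125 + u / 5) * (926 + 224 * y) \<le> x * (926 + 224 * y)" using y by (intro mult_right_mono) auto
    then show False using le u uu unfolding y_u by (simp add: algebra_simps)
  qed
  then show "x \<le> 2463/3125 + (y - 7881/10000) / 5" by (simp add: u_def)
  have "3933/5000 + 9/100 * u \<le> x"
  proof (rule ccontr)
    assume "\<not> 3933/5000 + 9/100 * u \<le> x"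
    then have "x * (45268 + 11072 * y) \<le> (3933/5000 + 9/100 * u) * (45268 + 11072 * y)" using y by (intro mult_right_mono) auto
    then show False using ge u uu unfolding y_u by (simp add: algebra_simps)
  qed
  then show "3933/5000 + 9/100 * (y - 7881/10000) \<le> x" by (simp add: u_def)
  show "x \<le> kink_x 42"
  proof (rule ccontr)
    assume "\<not> x \<le> kink_x 42"
    then have "kink_x 42 * (926 + 224 * y) \<le> x * (926 + 224 * y)" using y by (intro mult_right_mono) auto
    then show False using le y by (simp add: kink_x_def algebra_simps)
  qed
qed

lemma ridge_9_3_increasing:
  assumes "0 \<le> x1" "x1 < x2" "x2 \<le> 1" "y \<in> Ys"
  shows "ridge_9_3 x1 y < ridge_9_3 x2 y"
proof -
  let ?a = "53 - 48 * y" and ?b = "177 + 48 * y"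
  have e: "ridge_9_3 x2 y - ridge_9_3 x1 y = (x2 - x1) * (?b * (835 + 176 * (x1 + x2)) - ?a * (279 - 16 * (x1 + x2)))"
    by (simp add: ridge_9_3_def algebra_simps)
  have "177 * 835 \<le> ?b * (835 + 176 * (x1 + x2))" using assms by (intro mult_mono) auto
  moreover have "?a * (279 - 16 * (x1 + x2)) \<le> 53 * 279" using assms by (intro mult_mono) auto
  ultimately have "0 < ridge_9_3 x2 y - ridge_9_3 x1 y" unfolding e using assms by (intro mult_pos_pos) auto
  then show ?thesis by simp
qed

text \<open>The parameter range is wide enough for \<open>kink_y\<close> to cover all \<open>y\<close> in question.\<close>

lemma kink_point:
  assumes y: "y \<in> {7881/10000..9/11}"
  shows "\<exists>z\<in>{0..42}. kink_y z = y"
proof -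
  let ?p = "y_num - smult y y_den"
  have "\<exists>z\<ge>0. z \<le> 42 \<and> poly ?p z = 0"
    by (rule IVT'[of "poly ?p"]) (use y in \<open>auto simp: y_num_def y_den_def intro!: continuous_intros\<close>)
  then obtain z where z: "z \<in> {0..42}" "poly ?p z = 0" by auto
  then have "kink_y z = y" using denominators_pos(3)[OF z(1)] by (simp add: kink_y_def field_simps)
  with z show ?thesis by blast
qed

lemma kink_x_box: "z \<in> {0..42} \<Longrightarrow> kink_x z \<in> Xs"
  by (simp add: kink_x_def)

text \<open>The edge at (9, 3, 4) vanishes at a kink, so the branches with and without this edge meet there.\<close>

lemma along_ridge_kink:
  assumes z: "z \<in> {0..42}" and y: "kink_y z \<in> Ys"
  shows "along_ridge c 0 (kink_x z) (kink_y z) = kink_value z" "ridge_share (kink_x z) (kink_y z) = kink_share z" "edge_9_3 (kink_share z) (kink_x z) (kink_y z) = 0"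
proof -
  note x = kink_x_box[OF z]
  show s: "ridge_share (kink_x z) (kink_y z) = kink_share z"
    using ridge_ab_pos[OF x y] by (intro ridge_share_kink[OF z]) simp
  have "ridge_9_3 (kink_x z) (kink_y z) = 0" by (simp add: ridge_9_3_zero[OF z])
  then show d: "edge_9_3 (kink_share z) (kink_x z) (kink_y z) = 0"
    using ridge_edges(2,3)[OF x y] unfolding s by linarith
  show "along_ridge c 0 (kink_x z) (kink_y z) = kink_value z" using d base_payoff_kink[OF z] by (simp add: along_ridge_def with_edges_def s)
qed

lemma box_payoff_ridge:
  assumes x: "x \<in> Xs" and y: "y \<in> Ys" and th: "ridge_share x y \<in> Th" and p: "ridge_6_stand x y \<le> 0"
  shows "box_payoff (ridge_share x y) x y = base_payoff (ridge_share x y) x y + min 0 (edge_9_3 (ridge_share x y) x y) + min 0 (edge_2_5 (ridge_share x y) x y)"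
proof -
  have r: "edge_stand_6 (ridge_share x y) x y = 0" using ridge_iff[OF x y] by simp
  show ?thesis
    using r edge_5_2_ridge[OF th x y r] ridge_edges(1)[OF x y] p by (simp add: box_payoff_def base_payoff_def)
qed

text \<open>Phrased for a value \<open>v\<close>, so that the lower value can be inserted without a supremum over the box.\<close>

definition box_max :: "real \<Rightarrow> real \<Rightarrow> bool" where
  "box_max \<theta> v \<longleftrightarrow> (\<exists>x\<in>Xs. \<exists>y\<in>Ys. v = box_payoff \<theta> x y) \<and> (\<forall>x\<in>Xs. \<forall>y\<in>Ys. box_payoff \<theta> x y \<le> v)"

lemma box_max_ridge:
  assumes th: "\<theta> \<in> Th" and m: "box_max \<theta> v"
  obtains x y where "x \<in> Xs" "y \<in> {7881/10000..9/11}" "\<theta> = ridge_share x y" "ridge_6_stand x y \<le> 0"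
    "v = box_payoff (ridge_share x y) x y"
proof -
  obtain x y where xy: "x \<in> Xs" "y \<in> Ys" "v = box_payoff \<theta> x y" using m unfolding box_max_def by blast
  have opt: "box_payoff \<theta> x' y' \<le> box_payoff \<theta> x y" if "x' \<in> Xs" "y' \<in> Ys" for x' y'
    using m that unfolding box_max_def xy(3) by blast
  have "edge_stand_6 \<theta> x y = 0" by (rule optimum_on_ridge[OF th xy(1,2)]) (rule opt[OF _ xy(2)])
  then have s: "\<theta> = ridge_share x y" using ridge_iff[OF xy(1,2)] by simp
  have "edge_6_stand \<theta> x y \<le> 0" by (rule optimum_edge_6_stand[OF th xy(1,2)]) (rule opt[OF xy(1)])
  then have p: "ridge_6_stand x y \<le> 0" using ridge_edges(1)[OF xy(1,2)] s by simp
  have t: "ridge_share x y \<in> Th" using th s by simp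
  show ?thesis
    using that[of x y] xy s p ridge_region(1)[OF xy(1,2) t p] by simp
qed

text \<open>To the right of the kink the edge at (9, 3, 4) is nonnegative and the payoff is at most a falling branch; to
  the left it is at most a rising branch.  Both branches take the value \<open>kink_value\<close> at the kink.\<close>

lemma box_max_le_kink:
  assumes th: "ridge_share x y \<in> Th" and x: "x \<in> Xs" and y: "y \<in> {7881/10000..9/11}" and p: "ridge_6_stand x y \<le> 0"
    and z: "z \<in> {0..42}" "kink_y z = y"
  shows "box_payoff (ridge_share x y) x y \<le> kink_value z" and "0 \<le> ridge_9_3 x y \<longleftrightarrow> kink_x z \<le> x"
proof -
  have y': "y \<in> Ys" using y by simp
  note reg = ridge_region[OF x y' th p] and kink = kink_x_box[OF z(1)]
  have q0: "ridge_9_3 (kink_x z) y = 0" using ridge_9_3_zero[OF z(1)] z(2) by simp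
  have z': "kink_y z \<in> Ys" using z y' by simp
  show ridge_9_3: "0 \<le> ridge_9_3 x y \<longleftrightarrow> kink_x z \<le> x"
    using ridge_9_3_increasing[of x "kink_x z" y] ridge_9_3_increasing[of "kink_x z" x y] q0 x kink y' by (cases x "kink_x z" rule: linorder_cases) auto
  note hr = box_payoff_ridge[OF x y' th p]
  show "box_payoff (ridge_share x y) x y \<le> kink_value z"
  proof (cases "kink_x z \<le> x")
    case True
    have "box_payoff (ridge_share x y) x y \<le> along_ridge 0 0 x y" unfolding hr by (simp add: along_ridge_def with_edges_def)
    also have "\<dots> \<le> along_ridge 0 0 (kink_x z) y"
      using along_ridge_decreasing[OF y _ kink x reg(2)] True by (cases "kink_x z = x") auto
    also have "\<dots> = kink_value z" using along_ridge_kink(1)[OF z(1) z'] z(2) by simp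
    finally show ?thesis .
  next
    case False
    have "box_payoff (ridge_share x y) x y \<le> along_ridge 1 0 x y" unfolding hr by (simp add: along_ridge_def with_edges_def)
    also have "\<dots> \<le> along_ridge 1 0 (kink_x z) y"
      using along_ridge_increasing[OF y _ x kink reg(3), of 0] False by auto
    also have "\<dots> = kink_value z" using along_ridge_kink(1)[OF z(1) z'] z(2) by simp
    finally show ?thesis .
  qed
qed

text \<open>Where \<open>ridge_9_3\<close> vanishes, \<open>y\<close> can be eliminated and \<open>ridge_2_5\<close> has the sign of a quadratic in \<open>z\<close>.  It is nonnegative
  from 353/50 on, a rational point just beyond its root.\<close>

lemma ridge_2_5_kink:
  assumes z: "z \<in> {353/50..42}" and y: "kink_y z \<in> Ys"
  shows "0 \<le> ridge_2_5 (kink_x z) (kink_y z)"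
proof -
  have z': "z \<in> {0..42}" using z by simp
  let ?x = "kink_x z" and ?y = "kink_y z"
  let ?U = "(3 - ?x) * (231 - 16 * ?x)" and ?V = "(9 - 11 * ?x) * (89 + 16 * ?x)"
  let ?r = "690 * ((3 - ?x) * (285 - 80 * ?x)) - 640 * ?U - 870 * ?V"
  have x: "?x \<in> Xs" by (rule kink_x_box[OF z'])
  have V: "0 < ?V" "0 < ?U" using x by (auto intro!: mult_pos_pos)
  have "?r = - 1885214/3125 + 2670431/31250 * z + 619/312500 * (z * z)"
    by (simp add: kink_x_def field_simps)
  moreover have "0 \<le> (z - 353/50) * (z - 353/50)" by simp
  ultimately have r: "0 \<le> ?r" using z by (simp add: algebra_simps)
  have "3 * (?U + ?V) * ridge_2_5 ?x ?y = ?V * ?r + (3 * ((3 - ?x) * (285 - 80 * ?x)) - ?V) * ridge_9_3 ?x ?y"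
    by (simp add: ridge_2_5_def ridge_9_3_def algebra_simps)
  also have "ridge_9_3 ?x ?y = 0" by (simp add: ridge_9_3_zero[OF z'])
  finally have "3 * (?U + ?V) * ridge_2_5 ?x ?y = ?V * ?r" by simp
  moreover have "0 \<le> ?V * ?r" by (rule mult_nonneg_nonneg[OF less_imp_le[OF V(1)] r])
  ultimately have "0 \<le> (3 * (?U + ?V)) * ridge_2_5 ?x ?y" by (simp only:)
  moreover have "0 < 3 * (?U + ?V)" by (intro mult_pos_pos add_pos_pos V) simp
  ultimately show ?thesis by (simp only: zero_le_mult_iff) linarith
qed

text \<open>Past \<open>z = 353/50\<close> no undecided edge besides \<open>edge_6_stand\<close> is negative at a kink, so \<open>kink_value\<close> is really
  achieved there.\<close>

lemma kink_value_le:
  assumes z: "z \<in> {353/50..42}" and y: "kink_y z \<in> Ys" and p: "ridge_6_stand (kink_x z) (kink_y z) \<le> 0"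
    and th: "kink_share z \<in> Th" and m: "box_max (kink_share z) v"
  shows "kink_value z \<le> v"
proof -
  have z': "z \<in> {0..42}" using z by simp
  note x = kink_x_box[OF z'] and k = along_ridge_kink[OF z' y]
  have "0 \<le> edge_2_5 (kink_share z) (kink_x z) (kink_y z)" using ridge_edges(4)[OF x y] ridge_2_5_kink[OF z y] unfolding k by simp
  then have "box_payoff (kink_share z) (kink_x z) (kink_y z) = kink_value z"
    using box_payoff_ridge[OF x y _ p] k th base_payoff_kink[OF z'] by simp
  then show ?thesis using m x y unfolding box_max_def by fastforce
qed

lemma peak_box:
  shows "kink_share peak \<in> Th" "kink_y peak \<in> Ys" "kink_y peak \<le> 4/5" "ridge_6_stand (kink_x peak) (kink_y peak) \<le> 0"
proof -
  show "kink_share peak \<in> Th" using kink_share_peak[unfolded abs_le_iff] by auto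
  have "kink_y (103/8) < kink_y peak" "kink_y peak < kink_y (1289/100)" using peak by (intro kink_y_less; simp)+
  moreover have "11/14 \<le> kink_y (103/8)" "kink_y (1289/100) \<le> 4/5" by (simp_all add: kink_y_def y_num_def y_den_def)
  ultimately show y: "kink_y peak \<in> Ys" "kink_y peak \<le> 4/5" by auto
  have "ridge_6_stand (kink_x peak) (kink_y peak) \<le> ridge_6_stand (kink_x (103/8)) (kink_y (103/8))"
    using peak \<open>11/14 \<le> kink_y (103/8)\<close> \<open>kink_y (103/8) < kink_y peak\<close> y(2) by (intro ridge_6_stand_mono) (auto simp: kink_x_def)
  also have "\<dots> \<le> 0" by (simp add: ridge_6_stand_def kink_x_def kink_y_def y_num_def y_den_def)
  finally show "ridge_6_stand (kink_x peak) (kink_y peak) \<le> 0" .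
qed

lemma box_max_le_peak:
  assumes "\<theta> \<in> Th" "box_max \<theta> v"
  shows "v \<le> kink_value peak"
proof -
  obtain x y where xy: "x \<in> Xs" "y \<in> {7881/10000..9/11}" "\<theta> = ridge_share x y" "ridge_6_stand x y \<le> 0" "v = box_payoff (ridge_share x y) x y"
    by (rule box_max_ridge[OF assms])
  obtain z where z: "z \<in> {0..42}" "kink_y z = y" using kink_point[OF xy(2)] by blast
  have "v \<le> kink_value z" using box_max_le_kink(1)[of x y z] xy z assms(1) by simp
  also have "\<dots> \<le> kink_value peak" by (rule kink_value_le_peak[OF z(1)])
  finally show ?thesis .
qed

lemma box_max_peak: "box_max (kink_share peak) v \<Longrightarrow> v = kink_value peak"
  using box_max_le_peak[OF peak_box(1)] kink_value_le[of peak v] peak_box peak by fastforce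

text \<open>Early kinks do not matter: there the edge at (6, stand) is positive, which no optimum allows.\<close>

lemma low_kink_ridge_6_stand:
  assumes z: "z \<in> {0..353/50}" and y: "11/14 \<le> kink_y z"
  shows "0 < ridge_6_stand (kink_x z) (kink_y z)"
proof -
  have k: "kink_y z \<le> kink_y (353/50)" 
  proof (cases "z = 353/50")
    case True then show ?thesis by (simp only: order_refl)
  next
    case False then show ?thesis using kink_y_less[of z "353/50"] z by simp
  qed
  have "kink_y (353/50) \<le> 4/5" by (simp add: kink_y_def y_num_def y_den_def)
  have "0 < ridge_6_stand (kink_x (353/50)) (kink_y (353/50))" by (simp add: ridge_6_stand_def kink_x_def kink_y_def y_num_def y_den_def)
  also have "\<dots> \<le> ridge_6_stand (kink_x z) (kink_y z)"
    using z y k \<open>kink_y (353/50) \<le> 4/5\<close> by (intro ridge_6_stand_mono) (auto simp: kink_x_def)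
  finally show ?thesis .
qed

text \<open>If the edge at (9, 3, 4) is negative at the optimum, both branches that may be the payoff rise in \<open>x\<close>, and a small step to the right along the
  ridge increases share and payoff together.  Otherwise the value is at most that of a kink with a smaller or equal share; the
  kink with share \<open>c\<close> comes later on the curve, hence is better, and its value is achieved because it lies above and to the right
  of the optimum, where the edge at (6, stand) stays nonpositive.\<close>

lemma box_max_step:
  assumes U: "\<And>\<theta>. \<theta> \<in> Th \<Longrightarrow> box_max \<theta> (U \<theta>)" and th: "\<theta> \<in> Th" "\<theta> < c" "c \<le> kink_share peak"
  shows "\<exists>\<theta>'\<in>{\<theta><..c}. U \<theta> < U \<theta>'"
proof -
  obtain x y where xy: "x \<in> Xs" "y \<in> {7881/10000..9/11}" "\<theta> = ridge_share x y" "ridge_6_stand x y \<le> 0" "U \<theta> = box_payoff (ridge_share x y) x y"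
    by (rule box_max_ridge[OF th(1) U[OF th(1)]])
  have y: "y \<in> Ys" using xy(2) by simp
  have t: "ridge_share x y \<in> Th" using th xy(3) by simp
  note reg = ridge_region[OF xy(1) y t xy(4)]
  have c: "c \<in> Th" using th peak_box(1) by auto
  show ?thesis
  proof (cases "ridge_9_3 x y < 0")
    case True
    have "isCont (\<lambda>x. ridge_share x y) x"
      using ridge_ab_pos[OF xy(1) y] by (intro DERIV_isCont[OF ridge_share_deriv]) auto
    then have "((\<lambda>x. ridge_share x y) \<longlongrightarrow> ridge_share x y) (at_right x)"
      unfolding isCont_def by (rule tendsto_mono[OF at_le[OF subset_UNIV]])
    then have 1: "\<forall>\<^sub>F x' in at_right x. ridge_share x' y < c"
      by (rule order_tendstoD(2)) (use th xy(3) in simp)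
    have "((\<lambda>x. ridge_9_3 x y) \<longlongrightarrow> ridge_9_3 x y) (at_right x)"
      unfolding ridge_9_3_def by (intro tendsto_intros)
    then have 2: "\<forall>\<^sub>F x' in at_right x. ridge_9_3 x' y < 0"
      using True by (rule order_tendstoD(2))
    have "x < 19/24" using reg(4) by (simp add: kink_x_def)
    then have 3: "\<forall>\<^sub>F x' in at_right x. x' \<in> {x<..<19/24}"
      by (rule eventually_at_right_real)
    have "\<exists>x'. ridge_share x' y < c \<and> ridge_9_3 x' y < 0 \<and> x' \<in> {x<..<19/24}"
      using eventually_happens'[OF trivial_limit_at_right_real eventually_conj[OF 1 eventually_conj[OF 2 3]]] .
    then obtain x' where x': "ridge_share x' y < c" "ridge_9_3 x' y < 0" "x < x'" "x' < 19/24" by auto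
    have X': "x' \<in> Xs" using x' xy(1) by simp
    have lt: "ridge_share x y < ridge_share x' y" by (rule ridge_share_less[OF y x'(3) xy(1) X'])
    have t': "ridge_share x' y \<in> Th" using lt x'(1) t c by simp
    have p': "ridge_6_stand x' y \<le> 0" using ridge_6_stand_persists[OF xy(4,1) X' y y] x'(3) by simp
    have edge_9_3: "edge_9_3 (ridge_share x' y) x' y \<le> 0" using ridge_edges(2)[OF X' y] x'(2) by simp
    have "along_ridge 1 0 x y < along_ridge 1 0 x' y" "along_ridge 1 1 x y < along_ridge 1 1 x' y"
      by (rule along_ridge_increasing[OF xy(2) x'(3) xy(1) X' reg(3)]; simp)+
    then have "box_payoff (ridge_share x y) x y < box_payoff (ridge_share x' y) x' y"
      unfolding box_payoff_ridge[OF xy(1) y t xy(4)] box_payoff_ridge[OF X' y t' p'] using edge_9_3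
      by (simp add: along_ridge_def with_edges_def min_def)
    also have "\<dots> \<le> U (ridge_share x' y)" using U[OF t'] X' y unfolding box_max_def by blast
    finally have "U \<theta> < U (ridge_share x' y)" using xy(5) by simp
    moreover have "ridge_share x' y \<in> {\<theta><..c}" using lt x'(1) xy(3) by simp
    ultimately show ?thesis by blast
  next
    case False
    obtain z where z: "z \<in> {0..42}" "kink_y z = y" using kink_point[OF xy(2)] by blast
    have le: "U \<theta> \<le> kink_value z" and zx: "kink_x z \<le> x"
      using box_max_le_kink[OF t xy(1,2,4) z] False xy(5) by simp_all
    have zy: "kink_y z \<in> Ys" using z y by simp
    have "kink_share z = ridge_share (kink_x z) y" using along_ridge_kink(2)[OF z(1) zy] z(2) by simp
    also have "\<dots> \<le> \<theta>"
      using ridge_share_less[OF y _ kink_x_box[OF z(1)] xy(1)] zx xy(3) by (cases "kink_x z = x") auto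
    finally have kz: "kink_share z < c" using th by simp
    have zz0: "z < peak"
    proof (rule ccontr)
      assume "\<not> z < peak"
      then have "kink_share peak \<le> kink_share z" using kink_share_less[of peak z] peak z(1) by (cases "z = peak") auto
      then show False using kz th by simp
    qed
    have "\<exists>w\<ge>z. w \<le> peak \<and> kink_share w = c"
    proof (rule IVT')
      show "continuous_on {z..peak} kink_share"
      proof -
        have "poly share_den v \<noteq> 0" if "v \<in> {z..peak}" for v
          using denominators_pos(2)[of v] that z(1) peak by auto
        then show ?thesis unfolding kink_share_def by (intro continuous_intros) auto
      qed
    qed (use kz th zz0 in auto)
    then obtain w where w: "z \<le> w" "w \<le> peak" "kink_share w = c" by blast
    then have zw: "z < w" using kz by (cases "z = w") auto
    have W: "w \<in> {0..42}" using w z peak by simp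
    have "y < kink_y w" using kink_y_less[of z w] zw W z by simp
    moreover have "kink_y w \<le> kink_y peak" using kink_y_less[of w peak] w(2) W peak by (cases "w = peak") auto
    ultimately have wy: "kink_y w \<in> Ys" "y \<le> kink_y w" using y peak_box(2) by auto
    have wx: "x \<le> kink_x w"
    proof (rule ccontr)
      assume "\<not> x \<le> kink_x w"
      then have "ridge_share (kink_x w) (kink_y w) < ridge_share x (kink_y w)"
        using ridge_share_less[OF wy(1) _ kink_x_box[OF W] xy(1)] by simp
      also have "\<dots> \<le> ridge_share x y" by (rule ridge_share_antimono[OF wy(2) y wy(1) xy(1)])
      finally show False using along_ridge_kink(2)[OF W wy(1)] w(3) th xy(3) by simp
    qed
    have p: "ridge_6_stand (kink_x w) (kink_y w) \<le> 0" by (rule ridge_6_stand_persists[OF xy(4,1) kink_x_box[OF W] y wy(1) wx wy(2)])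
    then have "353/50 \<le> w" using low_kink_ridge_6_stand[of w] W wy(1) by (cases "w \<le> 353/50") auto
    then have "kink_value w \<le> U c"
      using kink_value_le[of w "U c"] wy(1) p w(3) c U[OF c] W by simp
    moreover have "kink_value z < kink_value w" using kink_value_increasing[of z w] z zw w(2) by simp
    ultimately have "U \<theta> < U c" using le by simp
    then show ?thesis using th by auto
  qed
qed

text \<open>The maximum over the interval can only be attained at its right end.\<close>

lemma less_if_local_less:
  fixes U :: "real \<Rightarrow> real"
  assumes "a < b" "continuous_on {a..b} U" and step: "\<And>\<theta>. \<theta> \<in> {a..<b} \<Longrightarrow> \<exists>\<theta>'\<in>{\<theta><..b}. U \<theta> < U \<theta>'"
  shows "U a < U b"
proof -
  obtain m where m: "m \<in> {a..b}" "\<And>\<theta>. \<theta> \<in> {a..b} \<Longrightarrow> U \<theta> \<le> U m"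
    using continuous_attains_sup[of "{a..b}" U] assms(1,2) by auto
  have "m = b" using step[of m] m by (force simp: not_le[symmetric])
  moreover obtain \<theta>' where "\<theta>' \<in> {a<..b}" "U a < U \<theta>'" using step[of a] assms(1) by auto
  ultimately show ?thesis using m(2)[of \<theta>'] by auto
qed

lemma box_max_less:
  assumes U: "\<And>\<theta>. \<theta> \<in> Th \<Longrightarrow> box_max \<theta> (U \<theta>)" and c: "continuous_on Th U"
    and th: "49/100 \<le> \<theta>1" "\<theta>1 < \<theta>2" "\<theta>2 \<le> kink_share peak"
  shows "U \<theta>1 < U \<theta>2"
proof (rule less_if_local_less[OF th(2)])
  have "{\<theta>1..\<theta>2} \<subseteq> Th" using th peak_box(1) by auto
  then show "continuous_on {\<theta>1..\<theta>2} U" by (rule continuous_on_subset[OF c])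
  show "\<exists>\<theta>'\<in>{\<theta><..\<theta>2}. U \<theta> < U \<theta>'" if "\<theta> \<in> {\<theta>1..<\<theta>2}" for \<theta>
    by (rule box_max_step[OF U]) (use that th peak_box(1) in auto)
qed

section \<open>Continuity, growth and the maximum\<close>

lemma scaled_payoff_eq_box_payoff:
  assumes "\<theta> \<in> Th" "x \<in> Xs" "y \<in> Ys"
  shows "scaled_payoff \<theta> x y = 16 * box_payoff \<theta> x y"
proof -
  have scale: "min 0 (16 * a) = 16 * min 0 (a::real)" for a by (simp add: min_def)
  have e: "cell_edge (2, 5, 5) \<theta> x y = 16 * edge_2_5 \<theta> x y" "cell_edge (5, 2, 5) \<theta> x y = 16 * edge_5_2 \<theta> x y"
    "cell_edge (6, 10, 6) \<theta> x y = 16 * edge_6_stand \<theta> x y" "cell_edge (9, 3, 4) \<theta> x y = 16 * edge_9_3 \<theta> x y"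
    "cell_edge (10, 6, 6) \<theta> x y = 16 * edge_stand_6 \<theta> x y"
    by (simp_all add: cell_edge_def edge_def lin_def card_gains_def card_weights_def banker_weight_def
      edge_2_5_def edge_5_2_def edge_6_stand_def edge_9_3_def edge_stand_6_def algebra_simps)
  have r: "weigh (cube_weights (\<theta>, 1 - \<theta>) (1, x) (1, y))
      [-94522528, -10015232, 13120624, 45056, -94522528, 13120624, -10015232, 45056] = 16 * fixed_part \<theta> x y"
    by (simp add: weigh_def cube_weights_def fixed_part_def algebra_simps)
  show ?thesis
    unfolding scaled_payoff_box[OF assms] definite_box r
    by (simp add: undecided_def e scale box_payoff_def)
qed

lemma box_max_upper:
  assumes "\<theta> \<in> Th"
  shows "box_max \<theta> (scaled_lower_value \<theta> / 16)"
proof -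
  obtain x y where opt: "optimal \<theta> x y" using optimal_exists by blast
  have xy: "x \<in> Xs" "y \<in> Ys" using optimal_box3[OF opt assms] by auto
  have "scaled_lower_value \<theta> / 16 = box_payoff \<theta> x y" using opt scaled_payoff_eq_box_payoff[OF assms xy] by (simp add: optimal_def)
  moreover have "box_payoff \<theta> x' y' \<le> scaled_lower_value \<theta> / 16" if "x' \<in> Xs" "y' \<in> Ys" for x' y'
    using scaled_payoff_le_upper[of x' y' \<theta>] scaled_payoff_eq_box_payoff[OF assms that] that by simp
  ultimately show ?thesis using xy unfolding box_max_def by blast
qed

text \<open>An affine function on an interval is bounded by the values at the ends; this gives a bound for the slopes in \<open>\<theta>\<close> that is
  uniform in the mixing probabilities.\<close>

lemma game_corners:
  assumes "x \<in> {0..1}" "y \<in> {0..1}"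
  shows "\<bar>game T \<theta> x y\<bar> \<le> \<bar>game T \<theta> 0 0\<bar> + \<bar>game T \<theta> 0 1\<bar> + \<bar>game T \<theta> 1 0\<bar> + \<bar>game T \<theta> 1 1\<bar>"
proof -
  have segment: "\<bar>(1 - t) * a + t * b\<bar> \<le> \<bar>a\<bar> + \<bar>b\<bar>" if "t \<in> {0..1}" for t a b :: real
  proof -
    have "\<bar>(1 - t) * a + t * b\<bar> \<le> (1 - t) * \<bar>a\<bar> + t * \<bar>b\<bar>"
      using that abs_triangle_ineq[of "(1 - t) * a" "t * b"] by (simp add: abs_mult)
    also have "\<dots> \<le> 1 * \<bar>a\<bar> + 1 * \<bar>b\<bar>" using that by (intro add_mono mult_right_mono) auto
    finally show ?thesis by simp
  qed
  have X: "game T \<theta> x y = (1 - x) * game T \<theta> 0 y + x * game T \<theta> 1 y" for y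
    using game_linear(2)[of T \<theta> x y 0] game_linear(2)[of T \<theta> 1 y 0] by (simp add: algebra_simps)
  have Y: "game T \<theta> x' y = (1 - y) * game T \<theta> x' 0 + y * game T \<theta> x' 1" for x'
    using game_linear(3)[of T \<theta> x' y 0] game_linear(3)[of T \<theta> x' 1 0] by (simp add: algebra_simps)
  show ?thesis
    using segment[OF assms(1), of "game T \<theta> 0 y" "game T \<theta> 1 y"] segment[OF assms(2), of "game T \<theta> 0 0" "game T \<theta> 0 1"]
      segment[OF assms(2), of "game T \<theta> 1 0" "game T \<theta> 1 1"]
    unfolding X[symmetric] Y[symmetric] by linarith
qed

lemma lower_value_lipschitz: "\<exists>L. L-lipschitz_on UNIV lower_value"
proof -
  define g where "g T \<theta> = \<bar>game T \<theta> 0 0\<bar> + \<bar>game T \<theta> 0 1\<bar> + \<bar>game T \<theta> 1 0\<bar> + \<bar>game T \<theta> 1 1\<bar>" for T \<theta>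
  define K where "K = (\<Sum>T\<in>Pow info_sets. g T 0 + g T 1)"
  have g0: "0 \<le> g T \<theta>" for T \<theta> by (simp add: g_def)
  have K: "0 \<le> K" unfolding K_def by (intro sum_nonneg add_nonneg_nonneg g0)
  have slope: "\<bar>game T \<theta>' x y - game T \<theta> x y\<bar> \<le> K * \<bar>\<theta>' - \<theta>\<bar>"
    if T: "T \<subseteq> info_sets" and xy: "x \<in> {0..1}" "y \<in> {0..1}" for T \<theta> \<theta>' x y
  proof -
    have "game T \<theta>' x y - game T \<theta> x y = (\<theta>' - \<theta>) * (game T 1 x y - game T 0 x y)"
      using game_linear(1)[of T \<theta>' x y \<theta>] game_linear(1)[of T 1 x y 0] by simp
    moreover have "\<bar>game T 1 x y - game T 0 x y\<bar> \<le> g T 0 + g T 1"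
      using game_corners[OF xy, of T 0] game_corners[OF xy, of T 1] unfolding g_def by linarith
    moreover have "g T 0 + g T 1 \<le> K"
      unfolding K_def using T by (intro member_le_sum) (auto simp: finite_info_sets g0)
    ultimately have "\<bar>game T \<theta>' x y - game T \<theta> x y\<bar> \<le> \<bar>\<theta>' - \<theta>\<bar> * K"
      by (simp add: abs_mult mult_left_mono)
    then show ?thesis by (simp add: mult.commute)
  qed
  have one_sided: "scaled_lower_value \<theta>' \<le> scaled_lower_value \<theta> + K * \<bar>\<theta>' - \<theta>\<bar>" for \<theta> \<theta>'
  proof -
    obtain x y where opt: "optimal \<theta>' x y" using optimal_exists by blast
    then have xy: "x \<in> {0..1}" "y \<in> {0..1}" "scaled_lower_value \<theta>' = scaled_payoff \<theta>' x y" by (auto simp: optimal_def)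
    obtain T where T: "reply \<theta> x y T" using reply_exists by blast
    note sub = reply_subset[OF T]
    have "scaled_payoff \<theta>' x y \<le> game T \<theta>' x y" by (rule scaled_payoff_le[OF sub])
    also have "\<dots> \<le> game T \<theta> x y + K * \<bar>\<theta>' - \<theta>\<bar>" using slope[OF sub xy(1,2), of \<theta>' \<theta>] by linarith
    also have "game T \<theta> x y \<le> scaled_lower_value \<theta>" using scaled_payoff_le_upper[OF xy(1,2), of \<theta>] scaled_payoff_reply[OF T] by simp
    finally show ?thesis using xy(3) by simp
  qed
  have two_sided: "\<bar>scaled_lower_value \<theta>' - scaled_lower_value \<theta>\<bar> \<le> K * \<bar>\<theta>' - \<theta>\<bar>" for \<theta> \<theta>'
    using one_sided[of \<theta>' \<theta>] one_sided[of \<theta> \<theta>'] unfolding abs_minus_commute[of \<theta> \<theta>']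
    by (intro abs_leI) linarith+
  have "(K / 13 ^ 9)-lipschitz_on UNIV lower_value"
  proof (rule lipschitz_onI)
    fix \<theta>' \<theta>
    have "scaled_lower_value \<theta>' - scaled_lower_value \<theta> = 13 ^ 9 * (lower_value \<theta>' - lower_value \<theta>)"
      by (simp add: scaled_lower_value_def)
    then have "\<bar>scaled_lower_value \<theta>' - scaled_lower_value \<theta>\<bar> = 13 ^ 9 * \<bar>lower_value \<theta>' - lower_value \<theta>\<bar>"
      by (simp only: abs_mult) simp
    then show "dist (lower_value \<theta>') (lower_value \<theta>) \<le> K / 13 ^ 9 * dist \<theta>' \<theta>"
      using two_sided[of \<theta>' \<theta>] by (simp add: dist_real_def)
  qed (use K in simp)
  then show ?thesis by blast
qed

theorem mainTheorem8:
  shows "continuous_on {0<..1/2} lower_value \<and>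
    (\<exists>\<theta>\<^sub>0\<in>{0<..1/2}.
       \<bar>\<theta>\<^sub>0 - 0.496000\<bar> \<le> 0.0000005 \<and>
       strict_mono_on {0<..\<theta>\<^sub>0} lower_value \<and>
       (\<forall>\<theta>\<in>{0<..1/2}. lower_value \<theta> \<le> lower_value \<theta>\<^sub>0) \<and>
       \<bar>lower_value \<theta>\<^sub>0 - (- 0.008679984)\<bar> \<le> 0.0000000005)"
proof (intro conjI bexI[of _ "kink_share peak"])
  obtain L where "L-lipschitz_on UNIV lower_value" using lower_value_lipschitz by blast
  then have cont: "continuous_on A lower_value" for A
    by (meson continuous_on_subset lipschitz_on_continuous_on subset_UNIV)
  show "continuous_on {0<..1/2} lower_value" by (rule cont)
  have uc: "continuous_on Th (\<lambda>\<theta>. scaled_lower_value \<theta> / 16)" unfolding scaled_lower_value_def by (intro continuous_intros cont) simp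
  have peak: "scaled_lower_value (kink_share peak) / 16 = kink_value peak" by (rule box_max_peak[OF box_max_upper[OF peak_box(1)]])
  have less: "scaled_lower_value \<theta>1 < scaled_lower_value \<theta>2" if "0 < \<theta>1" "\<theta>1 < \<theta>2" "\<theta>2 \<le> kink_share peak" for \<theta>1 \<theta>2
  proof -
    have right: "scaled_lower_value a < scaled_lower_value b" if "49/100 \<le> a" "a < b" "b \<le> kink_share peak" for a b
      using box_max_less[OF box_max_upper uc that] by simp
    consider "\<theta>2 \<le> 49/100" | "49/100 \<le> \<theta>1" | "\<theta>1 < 49/100" "49/100 < \<theta>2" by linarith
    then show ?thesis
      using scaled_lower_value_less[of \<theta>1 \<theta>2] right[of \<theta>1 \<theta>2] scaled_lower_value_less[of \<theta>1 "49/100"] right[of "49/100" \<theta>2] that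
      by cases auto
  qed
  then show "strict_mono_on {0<..kink_share peak} lower_value"
    by (auto simp: strict_mono_on_def scaled_lower_value_def)
  show "\<forall>\<theta>\<in>{0<..1/2}. lower_value \<theta> \<le> lower_value (kink_share peak)"
  proof
    fix \<theta> :: real assume th: "\<theta> \<in> {0<..1/2}"
    have "scaled_lower_value \<theta> \<le> scaled_lower_value (kink_share peak)"
    proof (cases "49/100 \<le> \<theta>")
      case True
      then show ?thesis using box_max_le_peak[OF _ box_max_upper, of \<theta>] th peak by simp
    next
      case False
      then show ?thesis using less[of \<theta> "kink_share peak"] th peak_box(1) by auto
    qed
    then show "lower_value \<theta> \<le> lower_value (kink_share peak)" by (simp add: scaled_lower_value_def)
  qed
  have peak_value: "lower_value (kink_share peak) = 16 * kink_value peak / 13 ^ 9" using peak by (simp add: scaled_lower_value_def field_simps)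
  show "\<bar>lower_value (kink_share peak) - (- 0.008679984)\<bar> \<le> 0.0000000005"
    unfolding peak_value using kink_value_peak by simp
  show "\<bar>kink_share peak - 0.496000\<bar> \<le> 0.0000005" using kink_share_peak by simp
  show "kink_share peak \<in> {0<..1/2}" using peak_box(1) by auto
qed

end
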